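(* Let $k \geq 3$. If $D$ is a $k$-extremal digraph, then one of the following holds: $D=\overleftrightarrow{K}_{k+1}$; or $k=3$ and $D$ is a symmetric odd wheel; or $D$ is a directed Hajós join of two $k$-extremal digraphs; or $D$ is a Hajós bijoin of two $k$-extremal digraphs.
   Context: Digraphs have no loops and no parallel arcs, but may contain digons. $\vec{\chi}(D)$ is the dichromatic number (least number of parts in a partition of $V(D)$ into sets inducing acyclic subdigraphs); $\lambda(D)$ is the maximum over ordered pairs of distinct vertices $(u,v)$ of the maximum number of pairwise arc-disjoint directed $uv$-paths. A digraph $D$ is $k$-extremal if it is strongly connected, its underlying graph is 2-connected, and $\vec{\chi}(D)=k+1=\lambda(D)+1$. $\overleftrightarrow{K}_{k+1}$ is the complete graph on $k+1$ vertices with every edge replaced by a pair of opposite arcs; a symmetric odd wheel is obtained from an undirected odd wheel (odd cycle of length at least 3 plus a vertex adjacent to all its vertices) by replacing each edge by a pair of opposite arcs. Directed Hajós join: given digraphs $D_1,D_2$ with $uv_1\in A(D_1)$, $v_2w\in A(D_2)$, it is obtained from the disjoint union of $D_1-uv_1$ and $D_2-v_2w$ by identifying $v_1,v_2$ into a new vertex $v$ and adding the arc $uw$. Hajós bijoin: let $D_1, D_2$ be digraphs; let $ta_1, a_1w\in A(D_1)$ (with $t=w$ allowed) such that $t$ and $w$ are in the same connected component of the underlying graph of $D_1 - a_1$; let $va_2, a_2u\in A(D_2)$ (with $u=v$ allowed) such that $u$ and $v$ are in the same connected component of the underlying graph of $D_2 - a_2$. The Hajós bijoin of $D_1$ and $D_2$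 with respect to $((t,a_1,w),(v,a_2,u))$ is the digraph obtained from the disjoint union of $D_1-\{ta_1,a_1w\}$ and $D_2-\{va_2,a_2u\}$ by identifying $a_1$ and $a_2$ into a new vertex $a$ and adding the arcs $tu$ and $vw$. *)

theory Defs
  imports "Graph_Theory.Graph_Theory" "HOL-Library.Disjoint_Sets"
begin

text \<open>
  Digraphs are finite \<open>pair_digraph\<close>s: arcs are ordered pairs of distinct vertices, so there are
  no loops and no parallel arcs, while digons are allowed.
\<close>

definition acyclic_set :: "'a pair_pre_digraph \<Rightarrow> 'a set \<Rightarrow> bool" where
  "acyclic_set D S \<longleftrightarrow> \<not> (\<exists>p. pre_digraph.cycle (with_proj D \<restriction> S) p)"

definition dichromatic_number :: "'a pair_pre_digraph \<Rightarrow> nat" where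
  "dichromatic_number D =
     (LEAST n. \<exists>P. partition_on (pverts D) P \<and> (\<forall>S\<in>P. acyclic_set D S) \<and> card P = n)"

definition arc_disjoint_paths ::
    "'a pair_pre_digraph \<Rightarrow> 'a \<Rightarrow> 'a \<Rightarrow> ('a \<times> 'a) awalk set \<Rightarrow> bool" where
  "arc_disjoint_paths D u v P \<longleftrightarrow>
     (\<forall>p\<in>P. pre_digraph.apath (with_proj D) u p v) \<and>
     pairwise (\<lambda>p q. set p \<inter> set q = {}) P"

definition local_arc_connectivity :: "'a pair_pre_digraph \<Rightarrow> 'a \<Rightarrow> 'a \<Rightarrow> nat" where
  "local_arc_connectivity D u v = Max {card P | P. arc_disjoint_paths D u v P}"

text \<open>Only meaningful for digraphs with at least two vertices (otherwise it is \<open>Max {}\<close>).\<close>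

definition max_arc_connectivity :: "'a pair_pre_digraph \<Rightarrow> nat" where
  "max_arc_connectivity D =
     Max {local_arc_connectivity D u v | u v. u \<in> pverts D \<and> v \<in> pverts D \<and> u \<noteq> v}"

text \<open>
  The library's \<open>connected\<close> is connectedness of the underlying graph \<open>mk_symmetric\<close>, and
  deleting a vertex commutes with passing to the underlying graph.
\<close>

definition underlying_2_connected :: "'a pair_pre_digraph \<Rightarrow> bool" where
  "underlying_2_connected D \<longleftrightarrow>
     3 \<le> card (pverts D) \<and> connected (with_proj D) \<and>
     (\<forall>x\<in>pverts D. connected (with_proj D \<restriction> (pverts D - {x})))"

definition extremal :: "nat \<Rightarrow> 'a pair_pre_digraph \<Rightarrow> bool" where
  "extremal k D \<longleftrightarrow>
     pair_digraph D \<and> strongly_connected (with_proj D) \<and> underlying_2_connected D \<and>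
     dichromatic_number D = k + 1 \<and> k + 1 = max_arc_connectivity D + 1"

text \<open>The rim is the cycle \<open>0, \<dots>, n - 1\<close> and the hub is \<open>n\<close>.\<close>

definition wheel_edges :: "nat \<Rightarrow> nat rel" where
  "wheel_edges n = {(i, Suc i mod n) | i. i < n} \<union> {(i, n) | i. i < n}"

definition symmetric_wheel :: "nat \<Rightarrow> nat pair_pre_digraph" where
  "symmetric_wheel n =
     \<lparr>pverts = {..n}, parcs = wheel_edges n \<union> (wheel_edges n)\<inverse>\<rparr>"

definition symmetric_odd_wheel :: "'a pair_pre_digraph \<Rightarrow> bool" where
  "symmetric_odd_wheel D \<longleftrightarrow>
     (\<exists>n\<ge>3. odd n \<and> digraph_iso (with_proj D) (with_proj (symmetric_wheel n)))"

text \<open>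
  The disjoint union is taken in the sum type. Identifying \<open>x1\<close> in the left part with \<open>x2\<close> in the
  right part is done by naming the merged vertex \<open>Inl x1\<close>; \<open>glue x1 x2\<close> embeds the right part.
  Being a join is understood up to isomorphism. A join has at least as many vertices as each of its
  parts, so isomorphic copies of both parts exist on the vertex type of the join.
\<close>

definition glue :: "'a \<Rightarrow> 'b \<Rightarrow> 'b \<Rightarrow> 'a + 'b" where
  "glue x1 x2 y = (if y = x2 then Inl x1 else Inr y)"

definition directed_hajos_join ::
    "'a pair_pre_digraph \<Rightarrow> 'a \<Rightarrow> 'a \<Rightarrow> 'b pair_pre_digraph \<Rightarrow> 'b \<Rightarrow> 'b \<Rightarrow>
     ('a + 'b) pair_pre_digraph" where
  "directed_hajos_join D1 u v1 D2 v2 w =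
     \<lparr>pverts = Inl ` pverts D1 \<union> glue v1 v2 ` pverts D2,
      parcs = map_prod Inl Inl ` (parcs D1 - {(u, v1)})
        \<union> map_prod (glue v1 v2) (glue v1 v2) ` (parcs D2 - {(v2, w)})
        \<union> {(Inl u, glue v1 v2 w)}\<rparr>"

definition is_directed_hajos_join ::
    "'c pair_pre_digraph \<Rightarrow> 'a pair_pre_digraph \<Rightarrow> 'b pair_pre_digraph \<Rightarrow> bool" where
  "is_directed_hajos_join D D1 D2 \<longleftrightarrow>
     (\<exists>u v1 v2 w. (u, v1) \<in> parcs D1 \<and> (v2, w) \<in> parcs D2 \<and>
        digraph_iso (with_proj D) (with_proj (directed_hajos_join D1 u v1 D2 v2 w)))"

definition same_component_without :: "'a pair_pre_digraph \<Rightarrow> 'a \<Rightarrow> 'a \<Rightarrow> 'a \<Rightarrow> bool" where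
  "same_component_without D a x y \<longleftrightarrow>
     x \<rightarrow>\<^sup>*\<^bsub>with_proj (mk_symmetric (with_proj D \<restriction> (pverts D - {a})))\<^esub> y"

definition hajos_bijoin ::
    "'a pair_pre_digraph \<Rightarrow> 'a \<Rightarrow> 'a \<Rightarrow> 'a \<Rightarrow> 'b pair_pre_digraph \<Rightarrow> 'b \<Rightarrow> 'b \<Rightarrow> 'b \<Rightarrow>
     ('a + 'b) pair_pre_digraph" where
  "hajos_bijoin D1 t a1 w D2 v a2 u =
     \<lparr>pverts = Inl ` pverts D1 \<union> glue a1 a2 ` pverts D2,
      parcs = map_prod Inl Inl ` (parcs D1 - {(t, a1), (a1, w)})
        \<union> map_prod (glue a1 a2) (glue a1 a2) ` (parcs D2 - {(v, a2), (a2, u)})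
        \<union> {(Inl t, glue a1 a2 u), (glue a1 a2 v, Inl w)}\<rparr>"

definition is_hajos_bijoin ::
    "'c pair_pre_digraph \<Rightarrow> 'a pair_pre_digraph \<Rightarrow> 'b pair_pre_digraph \<Rightarrow> bool" where
  "is_hajos_bijoin D D1 D2 \<longleftrightarrow>
     (\<exists>t a1 w v a2 u.
        (t, a1) \<in> parcs D1 \<and> (a1, w) \<in> parcs D1 \<and> same_component_without D1 a1 t w \<and>
        (v, a2) \<in> parcs D2 \<and> (a2, u) \<in> parcs D2 \<and> same_component_without D2 a2 u v \<and>
        digraph_iso (with_proj D) (with_proj (hajos_bijoin D1 t a1 w D2 v a2 u)))"

end

theory Submission
  imports Defs "HOL-Combinatorics.Transposition"
begin

text \<open>
  Let \<open>E\<close> be the arc set of a \<open>k\<close>-extremal digraph. By Menger, any two vertices are separated by a set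
  left by at most \<open>k\<close> arcs, and then \<open>E\<close> is critical and Eulerian, and every proper nonempty set is left
  by at least \<open>k\<close> arcs. Call \<open>E\<close> decomposable if deleting some vertex \<open>a\<close> leaves two parts joined by at
  most one arc in each direction; contracting either part together with \<open>a\<close> then exhibits \<open>E\<close> as a
  directed Hajos join or a Hajos bijoin.

  Suppose a set \<open>X\<close> is left by exactly \<open>k\<close> arcs, with at least two vertices on each side. Combining
  colourings of the two sides up to all permutations of the colours shows that one side, say \<open>X\<close>,
  receives a single colour on its boundary in each of its \<open>k\<close>-colourings. Adding to \<open>X\<close> one arc or one
  digon between boundary vertices then creates a smaller extremal digraph \<open>G\<close>. Since every minimum cut
  is almost used up by \<open>G\<close>, the arcs of \<open>E - G\<close> fall apart along at most one arc in each direction into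
  pieces around single vertices of \<open>G\<close>, and such a vertex decomposes \<open>E\<close>.

  If there is no such \<open>X\<close>, all vertices except at most one vertex \<open>x\<close> have in- and out-degree \<open>k\<close>. Greedy
  colouring towards a root, as in Lovasz's proof of Brooks' theorem, shows for an indecomposable \<open>E\<close>
  that \<open>x\<close> forms a digon with every other vertex; deleting \<open>x\<close> lowers \<open>k\<close> by one, and the rest is
  complete, or for \<open>k = 3\<close> a symmetric odd cycle.
\<close>

section \<open>Colourings and arc cuts\<close>

text \<open>The working notion is \<open>crit_sep\<close> rather than extremality: shrinking a
  digraph only shrinks its cuts, so every non-colourable digraph whose vertices are separated by
  small cuts contains a \<open>crit_sep\<close> one, while strong connectivity and 2-connectivity
  may be lost on the way and come back as consequences. A smaller \<open>crit_sep\<close> digraph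
  \<open>G\<close> again has at least \<open>k\<close> arcs in every cut, so a set that separates
  two vertices of \<open>G\<close> by \<open>k\<close> arcs of \<open>E\<close> leaves the arcs of
  \<open>E - G\<close> hardly any room; this count yields the structure. The obstacle is the closing
  digon: the arcs outside \<open>G\<close> may tie together more than two vertices of
  \<open>G\<close>, and then no decomposition is visible yet. The closing is repeated with other end
  vertices, and the part \<open>F\<close> that stays fixed shrinks until the process must stop. The
  bound \<open>k \<ge> 3\<close> enters through a third colour, which allows recolouring while two
  given colours stay untouched. With two colours this is missing, so what remains for
  \<open>k = 3\<close> after deleting the hub is treated by direct recolouring.\<close>

text \<open>Digraphs are handled as bare relations \<open>E\<close> with vertex set \<open>Field E\<close>; this loses nothing because
  extremal digraphs have no isolated vertices.\<close>

definition mono_arcs :: "'a rel \<Rightarrow> ('a \<Rightarrow> nat) \<Rightarrow> 'a rel" where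
  "mono_arcs E f = {(x, y) \<in> E. f x = f y}"

definition kcol :: "nat \<Rightarrow> 'a rel \<Rightarrow> ('a \<Rightarrow> nat) \<Rightarrow> bool" where
  "kcol k E f \<longleftrightarrow> (\<forall>v. f v < k) \<and> acyclic (mono_arcs E f)"

definition colourable :: "nat \<Rightarrow> 'a rel \<Rightarrow> bool" where
  "colourable k E \<longleftrightarrow> (\<exists>f. kcol k E f)"

definition induced :: "'a rel \<Rightarrow> 'a set \<Rightarrow> 'a rel" where
  "induced E X = E \<inter> X \<times> X"

definition out_cut :: "'a rel \<Rightarrow> 'a set \<Rightarrow> 'a rel" where
  "out_cut E X = E \<inter> X \<times> (- X)"

text \<open>By Menger the last clause bounds the arc-disjoint paths between any two vertices by
  \<open>k\<close>. Criticality is with respect to arcs; as the vertex set is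
  \<open>Field E\<close>, it also covers the deletion of vertices.\<close>

definition crit_sep :: "nat \<Rightarrow> 'a rel \<Rightarrow> bool" where
  "crit_sep k E \<longleftrightarrow> finite E \<and> (\<forall>x. (x, x) \<notin> E) \<and> \<not> colourable k E \<and> (\<forall>E'. E' \<subset> E \<longrightarrow> colourable k E')
     \<and> (\<forall>u\<in>Field E. \<forall>v\<in>Field E. u \<noteq> v \<longrightarrow> (\<exists>X. u \<in> X \<and> v \<notin> X \<and> card (out_cut E X) \<le> k))"

lemma mono_arcs_iff: "(x, y) \<in> mono_arcs E f \<longleftrightarrow> (x, y) \<in> E \<and> f x = f y"
  by (simp add: mono_arcs_def)

lemma mono_arcs_subset: "mono_arcs E f \<subseteq> E"
  by (auto simp: mono_arcs_def)

lemma mono_arcs_Un: "mono_arcs (E \<union> F) f = mono_arcs E f \<union> mono_arcs F f"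
  by (auto simp: mono_arcs_def)

lemma mono_arcs_mono: "E \<subseteq> F \<Longrightarrow> mono_arcs E f \<subseteq> mono_arcs F f"
  by (auto simp: mono_arcs_def)

lemma mono_arcs_cong: "(\<And>x. x \<in> Field E \<Longrightarrow> f x = g x) \<Longrightarrow> mono_arcs E f = mono_arcs E g"
  unfolding mono_arcs_def Field_def by (auto; metis DomainI RangeI UnCI)

lemma mono_arcs_comp_inj: "inj p \<Longrightarrow> mono_arcs E (p \<circ> f) = mono_arcs E f"
  by (auto simp: mono_arcs_def inj_eq)

lemma colourableI: "acyclic (mono_arcs E f) \<Longrightarrow> \<forall>v. f v < k \<Longrightarrow> colourable k E"
  unfolding colourable_def kcol_def by (rule exI[of _ f]) simp

lemma kcol_mono: "kcol k F f \<Longrightarrow> E \<subseteq> F \<Longrightarrow> kcol k E f"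
  unfolding kcol_def using acyclic_subset mono_arcs_mono by metis

lemma colourable_mono: "colourable k F \<Longrightarrow> E \<subseteq> F \<Longrightarrow> colourable k E"
  unfolding colourable_def using kcol_mono by metis

lemma mono_rtrancl_colour: "(x, y) \<in> (mono_arcs E f)\<^sup>* \<Longrightarrow> f x = f y"
  by (induction rule: rtrancl_induct) (auto simp: mono_arcs_def)

lemma mono_trancl_colour: "(x, y) \<in> (mono_arcs E f)\<^sup>+ \<Longrightarrow> f x = f y"
  by (induction rule: trancl_induct) (auto simp: mono_arcs_def)

text \<open>A cycle of \<open>R \<union> S\<close> that meets \<open>Field R\<close> consists of
  arcs of \<open>R\<close> and stretches in \<open>S\<close>. The stretches have both ends in
  \<open>Field R\<close>, so replacing each by one shortcut leaves a closed walk of the relation in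
  the second assumption. A cycle that avoids \<open>Field R\<close> lies in
  \<open>S\<close>.\<close>

lemma acyclic_glue:
  assumes S: "acyclic S" and R: "acyclic (R \<union> (S\<^sup>+ \<inter> Field R \<times> Field R))"
  shows "acyclic (R \<union> S)"
proof -
  let ?Q = "R \<union> (S\<^sup>+ \<inter> Field R \<times> Field R)"
  \<comment> \<open>The second alternative is a walk whose current stretch in \<open>S\<close> has
    not yet returned to \<open>Field R\<close>.\<close>
  have key: "(x, y) \<in> ?Q\<^sup>+ \<or> (\<exists>p\<in>Field R. (x, p) \<in> ?Q\<^sup>* \<and> (p, y) \<in> S\<^sup>+)"
    if "(x, y) \<in> (R \<union> S)\<^sup>+" "x \<in> Field R" for x y
    using that
  proof (induction rule: trancl_induct)
    case (base y)
    then show ?case by blast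
  next
    case (step y z)
    note IH = step.IH[OF step.prems]
    show ?case
    proof (cases "(y, z) \<in> R")
      case True
      then have yz: "(y, z) \<in> ?Q" and yR: "y \<in> Field R" by (auto simp: Field_def)
      from IH show ?thesis
      proof
        assume "(x, y) \<in> ?Q\<^sup>+" then show ?thesis using yz by (meson trancl.trancl_into_trancl)
      next
        assume "\<exists>p\<in>Field R. (x, p) \<in> ?Q\<^sup>* \<and> (p, y) \<in> S\<^sup>+"
        then obtain p where "p \<in> Field R" "(x, p) \<in> ?Q\<^sup>*" "(p, y) \<in> S\<^sup>+" by blast
        then have "(x, p) \<in> ?Q\<^sup>*" "(p, y) \<in> ?Q" using yR by auto
        then have "(x, y) \<in> ?Q\<^sup>+" by (meson rtrancl_into_trancl1)
        then show ?thesis using yz by (meson trancl.trancl_into_trancl)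
      qed
    next
      case False
      then have yz: "(y, z) \<in> S" using step by auto
      from IH show ?thesis
      proof
        assume a: "(x, y) \<in> ?Q\<^sup>+"
        then have "y \<in> Range ?Q" by (meson Range.intros tranclD2)
        then have "y \<in> Field R" by (auto simp: Field_def)
        then show ?thesis using a yz by (meson r_into_trancl trancl_into_rtrancl)
      next
        assume "\<exists>p\<in>Field R. (x, p) \<in> ?Q\<^sup>* \<and> (p, y) \<in> S\<^sup>+"
        then show ?thesis using yz by (meson trancl.trancl_into_trancl)
      qed
    qed
  qed
  have cyc: False if "(x, x) \<in> (R \<union> S)\<^sup>+" "x \<in> Field R" for x
    using key[OF that]
  proof
    assume "(x, x) \<in> ?Q\<^sup>+" then show False using R by (simp add: acyclic_def)
  next
    assume "\<exists>p\<in>Field R. (x, p) \<in> ?Q\<^sup>* \<and> (p, x) \<in> S\<^sup>+"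
    then obtain p where p: "p \<in> Field R" "(x, p) \<in> ?Q\<^sup>*" "(p, x) \<in> S\<^sup>+" by blast
    then have "(p, x) \<in> ?Q" using that(2) by blast
    with p(2) have "(x, x) \<in> ?Q\<^sup>+" by (meson rtrancl_into_trancl1)
    then show False using R by (simp add: acyclic_def)
  qed
  have nR: "(x, y) \<in> S\<^sup>+ \<or> (\<exists>r\<in>Field R. (x, r) \<in> (R \<union> S)\<^sup>* \<and> (r, y) \<in> (R \<union> S)\<^sup>*)"
    if "(x, y) \<in> (R \<union> S)\<^sup>+" for x y
    using that
  proof (induction rule: trancl_induct)
    case (base y)
    then show ?case by (auto simp: Field_def)
  next
    case (step y z)
    show ?case
    proof (cases "(y, z) \<in> R")
      case True
      then have "y \<in> Field R" "(x, y) \<in> (R \<union> S)\<^sup>*" "(y, z) \<in> (R \<union> S)\<^sup>*"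
        using step by (auto simp: Field_def)
      then show ?thesis by blast
    next
      case False
      then have yz: "(y, z) \<in> S" using step by auto
      then have "(y, z) \<in> R \<union> S" by auto
      then show ?thesis using step.IH yz by (meson rtrancl.rtrancl_into_rtrancl trancl.trancl_into_trancl)
    qed
  qed
  show ?thesis
  proof (unfold acyclic_def, intro allI notI)
    fix x assume a: "(x, x) \<in> (R \<union> S)\<^sup>+"
    from nR[OF a] show False
    proof
      assume "(x, x) \<in> S\<^sup>+" then show False using S by (simp add: acyclic_def)
    next
      assume "\<exists>r\<in>Field R. (x, r) \<in> (R \<union> S)\<^sup>* \<and> (r, x) \<in> (R \<union> S)\<^sup>*"
      then obtain r where r: "r \<in> Field R" "(x, r) \<in> (R \<union> S)\<^sup>*" "(r, x) \<in> (R \<union> S)\<^sup>*" by blast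
      then have "(r, r) \<in> (R \<union> S)\<^sup>+" using a by (meson rtrancl_trancl_trancl trancl_rtrancl_trancl)
      then show False using cyc r(1) by blast
    qed
  qed
qed

lemma acyclic_glue_disjoint:
  assumes "acyclic R" "acyclic S" "\<And>p q. p \<in> Field R \<Longrightarrow> q \<in> Field R \<Longrightarrow> (p, q) \<in> S\<^sup>+ \<Longrightarrow> False"
  shows "acyclic (R \<union> S)"
proof -
  have "S\<^sup>+ \<inter> Field R \<times> Field R = {}" using assms(3) by auto
  then show ?thesis using acyclic_glue[of S R] assms by simp
qed

lemma trancl_stays_in:
  assumes "(x, y) \<in> R\<^sup>+" "x \<in> X" "\<And>a b. (a, b) \<in> R \<Longrightarrow> a \<in> X \<Longrightarrow> b \<in> X"
  shows "(x, y) \<in> (R \<inter> X \<times> X)\<^sup>+ \<and> y \<in> X"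
  using assms(1)
proof (induction rule: trancl_induct)
  case (base y)
  then show ?case using assms by blast
next
  case (step y z)
  then have "(y, z) \<in> R \<inter> X \<times> X" using assms by blast
  then show ?case using step by (meson SigmaD2 Int_iff trancl.trancl_into_trancl)
qed

text \<open>A monochromatic cycle crossing \<open>X\<close> crosses it in both directions, in its own colour.\<close>

lemma acyclic_mono_cut:
  assumes X: "acyclic (mono_arcs (induced E X) f)" and Y: "acyclic (mono_arcs (induced E (- X)) f)"
    and no: "\<And>x y y' x'. (x, y) \<in> E \<Longrightarrow> x \<in> X \<Longrightarrow> y \<notin> X \<Longrightarrow> (y', x') \<in> E \<Longrightarrow> y' \<notin> X \<Longrightarrow> x' \<in> X \<Longrightarrow>
      f x = f y \<Longrightarrow> f y' = f x' \<Longrightarrow> f x = f y' \<Longrightarrow> False"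
  shows "acyclic (mono_arcs E f)"
proof (unfold acyclic_def, intro allI notI)
  fix z assume z: "(z, z) \<in> (mono_arcs E f)\<^sup>+"
  let ?R = "mono_arcs E f \<inter> {v. f v = f z} \<times> {v. f v = f z}"
  have zR: "(z, z) \<in> ?R\<^sup>+"
    using trancl_stays_in[OF z, of "{v. f v = f z}"] by (auto simp: mono_arcs_def)
  show False
  proof (cases "\<exists>x y. (x, y) \<in> ?R \<and> x \<in> X \<and> y \<notin> X")
    case True
    then have noin: "\<And>a b. (a, b) \<in> ?R \<Longrightarrow> a \<notin> X \<Longrightarrow> b \<notin> X"
      using no by (auto simp: mono_arcs_def) metis
    show False
    proof (cases "z \<in> X")
      case zX: False
      have "(z, z) \<in> (?R \<inter> (-X) \<times> (-X))\<^sup>+"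
        using trancl_stays_in[OF zR, of "- X"] noin zX by auto
      then have "(z, z) \<in> (mono_arcs (induced E (- X)) f)\<^sup>+"
        by (rule trancl_mono) (auto simp: mono_arcs_def induced_def)
      then show False using Y by (simp add: acyclic_def)
    next
      case zX: True
      \<comment> \<open>Here \<open>X\<close> cannot be entered in this colour; for the reversed
        relation this says that it cannot be left.\<close>
      have "(z, z) \<in> (?R\<inverse>)\<^sup>+" using zR by (simp add: trancl_converse)
      from trancl_stays_in[OF this zX] noin have "(z, z) \<in> (?R\<inverse> \<inter> X \<times> X)\<^sup>+" by auto
      then have "(z, z) \<in> ((mono_arcs (induced E X) f)\<inverse>)\<^sup>+"
        by (rule trancl_mono) (auto simp: mono_arcs_def induced_def)
      then show False using X by (simp add: acyclic_def trancl_converse)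
    qed
  next
    case False
    then have noout: "\<And>a b. (a, b) \<in> ?R \<Longrightarrow> a \<in> X \<Longrightarrow> b \<in> X" by blast
    show False
    proof (cases "z \<in> X")
      case zX: True
      have "(z, z) \<in> (?R \<inter> X \<times> X)\<^sup>+"
        using trancl_stays_in[OF zR zX] noout by auto
      then have "(z, z) \<in> (mono_arcs (induced E X) f)\<^sup>+"
        by (rule trancl_mono) (auto simp: mono_arcs_def induced_def)
      then show False using X by (simp add: acyclic_def)
    next
      case zX: False
      have "(z, z) \<in> (?R\<inverse>)\<^sup>+" using zR by (simp add: trancl_converse)
      from trancl_stays_in[OF this, of "- X"] noout zX have "(z, z) \<in> (?R\<inverse> \<inter> (-X) \<times> (-X))\<^sup>+" by auto
      then have "(z, z) \<in> ((mono_arcs (induced E (-X)) f)\<inverse>)\<^sup>+"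
        by (rule trancl_mono) (auto simp: mono_arcs_def induced_def)
      then show False using Y by (simp add: acyclic_def trancl_converse)
    qed
  qed
qed

section \<open>Matching colourings of the two sides of a cut\<close>

lemma kcol_perm:
  assumes "kcol k E f" "inj p" "\<And>i. i < k \<Longrightarrow> p i < k"
  shows "kcol k E (p \<circ> f)"
  using assms mono_arcs_comp_inj[of p E f] by (simp add: kcol_def)

lemma transpose_less: "a < k \<Longrightarrow> b < k \<Longrightarrow> i < k \<Longrightarrow> transpose a b i < (k::nat)"
  by (auto simp: transpose_def)

lemma inj_transpose: "inj (transpose a b)"
  by (rule bij_is_inj[OF bij_transpose])

lemma exists_perm2:
  fixes k :: nat
  assumes "j < k" "j' < k" "i < k" "i' < k" "j \<noteq> j'" "i \<noteq> i'"
  obtains p where "inj p" "\<And>a. a < k \<Longrightarrow> p a < k" "p j = i" "p j' = i'"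
proof
  let ?a = "transpose j i j'"
  \<comment> \<open>The first transposition settles \<open>j\<close> and sends \<open>j'\<close> to
    \<open>?a\<close>; as \<open>?a\<close> and \<open>i'\<close> both differ from \<open>i\<close>,
    the second one does not disturb \<open>i\<close>.\<close>
  let ?p = "transpose ?a i' \<circ> transpose j i"
  have a: "?a < k" using assms by (simp add: transpose_less)
  have ai: "?a \<noteq> i" using assms by (auto simp: transpose_def)
  show "inj ?p" by (simp add: inj_transpose inj_compose)
  show "\<And>b. b < k \<Longrightarrow> ?p b < k" using a assms by (simp add: transpose_less)
  show "?p j = i" using ai assms by (simp add: transpose_def)
  show "?p j' = i'" by simp
qed

text \<open>The \<open>k\<close> cyclic shifts of a permutation partition the grid, so a set of at most \<open>k\<close> cells that
  meets every permutation meets each shift in exactly one cell.\<close>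

lemma grid_blocking:
  fixes k :: nat
  assumes k: "1 \<le> k" and B: "B \<subseteq> {..<k} \<times> {..<k}" and c: "card B \<le> k"
    and block: "\<And>p. inj p \<Longrightarrow> (\<And>i. i < k \<Longrightarrow> p i < k) \<Longrightarrow> \<exists>j<k. (p j, j) \<in> B"
  shows "card B = k \<and> ((\<exists>i<k. B = {i} \<times> {..<k}) \<or> (\<exists>j<k. B = {..<k} \<times> {j}))"
proof -
  have finB: "finite B" using B finite_subset by blast
  \<comment> \<open>\<open>m \<sigma>\<close> names the cyclic shift of \<open>\<sigma>\<close> that
    passes through a cell; the added \<open>k\<close> keeps the subtraction from being
    truncated.\<close>
  define m where "m \<sigma> = (\<lambda>(i, j). (i + k - \<sigma> j) mod k)" for \<sigma> :: "nat \<Rightarrow> nat"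
  have surj: "{..<k} \<subseteq> m \<sigma> ` B" if s: "inj \<sigma>" "\<And>i. i < k \<Longrightarrow> \<sigma> i < k" for \<sigma>
  proof
    fix s assume "s \<in> {..<k}"
    then have sk: "s < k" by simp
    let ?p = "\<lambda>j. if j < k then (\<sigma> j + s) mod k else j"
    have inj: "inj ?p"
    proof (rule injI)
      fix x y assume e: "?p x = ?p y"
      have lt: "?p z < k \<longleftrightarrow> z < k" for z using k by auto
      show "x = y"
      proof (cases "x < k")
        case True
        then have "y < k" using e lt by metis
        then have "(\<sigma> x + s) mod k = (\<sigma> y + s) mod k" "\<sigma> x < k" "\<sigma> y < k" using e True s by auto
        then have "\<sigma> x = \<sigma> y"
          using sk by (auto simp: mod_if split: if_splits)
        then show ?thesis using s(1) by (simp add: inj_eq)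
      next
        case False
        then have "\<not> y < k" using e lt by metis
        then show ?thesis using e False by simp
      qed
    qed
    have "?p i < k" if "i < k" for i using that k by simp
    from block[OF inj this] obtain j where j: "j < k" "((\<sigma> j + s) mod k, j) \<in> B" by auto
    have "m \<sigma> ((\<sigma> j + s) mod k, j) = s"
    proof (cases "\<sigma> j + s < k")
      case True then show ?thesis using sk by (simp add: m_def)
    next
      case False
      then have "(\<sigma> j + s) mod k = \<sigma> j + s - k" using s(2)[OF j(1)] sk by (simp add: mod_if)
      then show ?thesis using False sk by (simp add: m_def)
    qed
    then show "s \<in> m \<sigma> ` B" using j(2) by (metis image_eqI)
  qed
  have ck: "card B = k \<and> inj_on (m \<sigma>) B" if s: "inj \<sigma>" "\<And>i. i < k \<Longrightarrow> \<sigma> i < k" for \<sigma>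
  proof -
    have "k \<le> card (m \<sigma> ` B)" using card_mono[OF _ surj[OF s]] finB by simp
    moreover have "card (m \<sigma> ` B) \<le> card B" using finB card_image_le by blast
    ultimately have "card (m \<sigma> ` B) = card B" "card B = k" using c by auto
    then show ?thesis using finB eq_card_imp_inj_on by blast
  qed
  have cB: "card B = k" using ck[of id] by simp
  \<comment> \<open>Two cells in different rows and columns lie on a common permutation
    \<open>p\<close>, hence both in shift 0 of it, against the injectivity of \<open>m p\<close> on
    \<open>B\<close>.\<close>
  have coll: "i = i' \<or> j = j'" if "(i, j) \<in> B" "(i', j') \<in> B" for i j i' j'
  proof (rule ccontr)
    assume n: "\<not> (i = i' \<or> j = j')"
    have lt: "i < k" "j < k" "i' < k" "j' < k" using that B by auto
    obtain p where p: "inj p" "\<And>a. a < k \<Longrightarrow> p a < k" "p j = i" "p j' = i'"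
      using exists_perm2[of j k j' i i'] lt n by auto
    have "m p (i, j) = m p (i', j')" using p lt by (simp add: m_def)
    then show False using ck[OF p(1,2)] that n by (auto dest: inj_onD)
  qed
  have "B \<noteq> {}" using cB k by auto
  then obtain i j where ij: "(i, j) \<in> B" by auto
  have full: "B = C" if "B \<subseteq> C" "finite C" "card C = k" for C
    using card_subset_eq that cB by blast
  show ?thesis
  proof (cases "\<exists>i' j'. (i', j') \<in> B \<and> i' \<noteq> i")
    case True
    then obtain i' j' where i': "(i', j') \<in> B" "i' \<noteq> i" by auto
    then have j': "j' = j" using coll[OF ij i'(1)] by auto
    have "B \<subseteq> {..<k} \<times> {j}"
    proof
      fix z assume z: "z \<in> B"
      obtain a b where ab: "z = (a, b)" by force
      have "b = j" using coll[of a b i j] coll[of a b i' j] z ab ij i' j' by auto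
      then show "z \<in> {..<k} \<times> {j}" using z ab B by auto
    qed
    then have "B = {..<k} \<times> {j}" using full by (simp add: card_cartesian_product)
    moreover have "j < k" using ij B by auto
    ultimately show ?thesis using cB by auto
  next
    case False
    then have "B \<subseteq> {i} \<times> {..<k}" using B by force
    then have "B = {i} \<times> {..<k}" using full by (simp add: card_cartesian_product)
    moreover have "i < k" using ij B by auto
    ultimately show ?thesis using cB by auto
  qed
qed

context
  fixes k :: nat and E :: "'a rel" and X f g
  assumes fin: "finite E" and k1: "1 \<le> k" and nc: "\<not> colourable k E"
    and f: "kcol k (induced E X) f" and g: "kcol k (induced E (- X)) g"
    and tight: "card (out_cut E X) \<le> k"
begin

text \<open>Rows are colours used in \<open>X\<close>, columns are colours used outside. After
  permuting the outer colours by \<open>p\<close>, a monochromatic cycle across the cut needs an arc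
  in each direction in one colour, which is a bad cell \<open>(p j, j)\<close>. Each arc leaving
  \<open>X\<close> supplies at most one cell, so at most \<open>k\<close> cells are bad.\<close>

private definition "bad = {(i, j). \<exists>x y y' x'. (x, y) \<in> out_cut E X \<and> (y', x') \<in> out_cut E (- X) \<and>
   f x = i \<and> f x' = i \<and> g y = j \<and> g y' = j}"

private lemma finite_cuts: "finite (out_cut E X)" "finite (out_cut E (- X))"
  using fin by (auto simp: out_cut_def)

private lemma bad_sub1: "bad \<subseteq> (\<lambda>(x, y). (f x, g y)) ` out_cut E X"
  by (force simp: bad_def)

private lemma bad_sub2: "bad \<subseteq> (\<lambda>(y, x). (f x, g y)) ` out_cut E (- X)"
  by (force simp: bad_def)

private lemma bad_card: "card bad = k \<and> ((\<exists>i<k. bad = {i} \<times> {..<k}) \<or> (\<exists>j<k. bad = {..<k} \<times> {j}))"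
proof (rule grid_blocking[OF k1])
  show "bad \<subseteq> {..<k} \<times> {..<k}" using f g by (auto simp: bad_def kcol_def)
  show "card bad \<le> k"
    using bad_sub1 tight by (meson card_image_le card_mono finite_cuts(1) finite_imageI le_trans)
  fix p :: "nat \<Rightarrow> nat" assume p: "inj p" "\<And>i. i < k \<Longrightarrow> p i < k"
  show "\<exists>j<k. (p j, j) \<in> bad"
  proof (rule ccontr)
    assume n: "\<not> (\<exists>j<k. (p j, j) \<in> bad)"
    let ?h = "\<lambda>v. if v \<in> X then f v else p (g v)"
    have "mono_arcs (induced E X) ?h = mono_arcs (induced E X) f"
      by (auto simp: mono_arcs_def induced_def)
    moreover have "mono_arcs (induced E (- X)) ?h = mono_arcs (induced E (- X)) g"
      using p(1) by (auto simp: mono_arcs_def induced_def inj_eq)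
    moreover have "acyclic (mono_arcs E ?h)"
    proof (rule acyclic_mono_cut[of E X])
      fix x y y' x' assume a: "(x, y) \<in> E" "x \<in> X" "y \<notin> X" "(y', x') \<in> E" "y' \<notin> X" "x' \<in> X"
        "?h x = ?h y" "?h y' = ?h x'" "?h x = ?h y'"
      then have e: "f x = p (g y)" "f x' = p (g y')" "p (g y') = p (g y)" by auto
      then have "g y' = g y" using p(1) by (simp add: inj_eq)
      with e have "f x = p (g y)" "f x' = p (g y)" "g y' = g y" by auto
      then have "(p (g y), g y) \<in> bad" unfolding bad_def using a(1-6) by (fastforce simp: out_cut_def)
      then show False using n g by (auto simp: kcol_def)
    qed (use f g calculation in \<open>auto simp: kcol_def\<close>)
    moreover have "\<forall>v. ?h v < k" using f g p(2) by (auto simp: kcol_def)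
    ultimately have "colourable k E" using colourableI by blast
    then show False using nc by simp
  qed
qed

private lemma in_bad1: "(\<lambda>(x, y). (f x, g y)) ` out_cut E X = bad \<Longrightarrow> (x, y) \<in> out_cut E X \<Longrightarrow> (f x, g y) \<in> bad"
  by (metis (no_types, lifting) case_prod_conv image_eqI)

private lemma in_bad2: "(\<lambda>(y, x). (f x, g y)) ` out_cut E (- X) = bad \<Longrightarrow> (y, x) \<in> out_cut E (- X) \<Longrightarrow> (f x, g y) \<in> bad"
  by (metis (no_types, lifting) case_prod_conv image_eqI)

private lemma row_bij:
  assumes "(\<lambda>e. (a e, b e)) ` C = {i} \<times> {..<k}" "inj_on (\<lambda>e. (a e, b e)) C"
  shows "bij_betw b C {..<k}"
proof (rule bij_betw_imageI)
  have "a e = i" if "e \<in> C" for e using assms(1) that by blast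
  then show "inj_on b C" using assms(2) by (simp add: inj_on_def)
  have "b ` C = snd ` ((\<lambda>e. (a e, b e)) ` C)" by (simp add: image_image)
  then show "b ` C = {..<k}" using assms(1) by simp
qed

text \<open>The \<open>k\<close> bad cells are covered by the images of at most \<open>k\<close>
  arcs, so nothing is wasted: the arcs correspond one to one to the bad cells.\<close>

private lemma bad_inj:
  assumes "bad \<subseteq> h ` C" "finite C" "card C \<le> k"
  shows "h ` C = bad \<and> inj_on h C \<and> card C = k"
proof -
  have "card bad \<le> card (h ` C)" using assms card_mono by blast
  moreover have "card (h ` C) \<le> card C" using assms card_image_le by blast
  ultimately have e: "card (h ` C) = card C" "card C = k" "card bad = card (h ` C)"
    using bad_card assms(3) by auto
  then have "h ` C = bad" using assms by (metis card_subset_eq finite_imageI)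
  then show ?thesis using e assms eq_card_imp_inj_on by blast
qed

lemma cut_size_eq: "card (out_cut E X) = k"
  using bad_inj[OF bad_sub1 finite_cuts(1) tight] by simp

text \<open>The two alternatives are a full row and a full column of bad cells, read through the
  one-to-one correspondence with the arcs of each cut. For a column only the surjectivity inside
  \<open>X\<close> is kept; that is enough to contradict a rigid boundary of
  \<open>X\<close>.\<close>

lemma tight_cut_colouring:
  assumes tight': "card (out_cut E (- X)) \<le> k"
  shows "(\<exists>i<k. (\<forall>(x, y)\<in>out_cut E X. f x = i) \<and> (\<forall>(y, x)\<in>out_cut E (- X). f x = i)
            \<and> bij_betw (\<lambda>(x, y). g y) (out_cut E X) {..<k} \<and> bij_betw (\<lambda>(y, x). g y) (out_cut E (- X)) {..<k})
       \<or> (\<exists>j<k. (\<forall>(x, y)\<in>out_cut E X. g y = j) \<and> (\<forall>(y, x)\<in>out_cut E (- X). g y = j)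
            \<and> (\<lambda>(x, y). f x) ` out_cut E X = {..<k})"
proof -
  note b1 = bad_inj[OF bad_sub1 finite_cuts(1) tight]
  note b2 = bad_inj[OF bad_sub2 finite_cuts(2) tight']
  from bad_card show ?thesis
  proof (elim conjE disjE exE)
    fix i assume i: "i < k" and bi: "bad = {i} \<times> {..<k}"
    have f1: "\<forall>(x, y)\<in>out_cut E X. f x = i"
      using in_bad1 b1 bi by blast
    have f2: "\<forall>(y, x)\<in>out_cut E (- X). f x = i"
      using in_bad2 b2 bi by blast
    have "bij_betw (\<lambda>(x, y). g y) (out_cut E X) {..<k}"
      using row_bij[of "\<lambda>(x, y). f x" "\<lambda>(x, y). g y" "out_cut E X" i] b1 bi by (simp add: case_prod_unfold)
    moreover have "bij_betw (\<lambda>(y, x). g y) (out_cut E (- X)) {..<k}"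
      using row_bij[of "\<lambda>(y, x). f x" "\<lambda>(y, x). g y" "out_cut E (- X)" i] b2 bi by (simp add: case_prod_unfold)
    ultimately show ?thesis using i f1 f2 by blast
  next
    fix j assume j: "j < k" and bj: "bad = {..<k} \<times> {j}"
    have "\<forall>(x, y)\<in>out_cut E X. g y = j"
      using in_bad1 b1 bj by blast
    moreover have "\<forall>(y, x)\<in>out_cut E (- X). g y = j"
      using in_bad2 b2 bj by blast
    moreover have "(\<lambda>(x, y). f x) ` out_cut E X = {..<k}"
    proof -
      have "(\<lambda>(x, y). f x) ` out_cut E X = fst ` ((\<lambda>(x, y). (f x, g y)) ` out_cut E X)"
        by (simp add: image_image case_prod_unfold)
      then show ?thesis using b1 bj by simp
    qed
    ultimately show ?thesis using j by blast
  qed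
qed

end

text \<open>Both sides induce proper subdigraphs and are therefore colourable; with fewer than
  \<open>k\<close> arcs some permutation of the colours of one side would avoid every
  conflict.\<close>

lemma crit_sep_cut_ge:
  assumes E: "crit_sep k E" and k: "1 \<le> k" and X: "X \<inter> Field E \<noteq> {}" "Field E - X \<noteq> {}"
  shows "k \<le> card (out_cut E X)"
proof (rule ccontr)
  assume n: "\<not> k \<le> card (out_cut E X)"
  have "induced E X \<subset> E" using X by (auto simp: induced_def Field_def)
  moreover have "induced E (- X) \<subset> E" using X by (auto simp: induced_def Field_def)
  ultimately obtain f g where "kcol k (induced E X) f" "kcol k (induced E (- X)) g"
    using E unfolding crit_sep_def colourable_def by metis
  from cut_size_eq[OF _ k _ this] show False using E n by (auto simp: crit_sep_def)
qed

section \<open>Submodularity of cuts and the Eulerian property\<close>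

lemma cut_submodular:
  assumes "finite E"
  shows "card (out_cut E (X \<inter> Y)) + card (out_cut E (X \<union> Y)) \<le> card (out_cut E X) + card (out_cut E Y)"
proof -
  have fin: "finite (out_cut E Z)" for Z using assms by (simp add: out_cut_def)
  have "card (out_cut E (X \<inter> Y)) + card (out_cut E (X \<union> Y)) =
      card (out_cut E (X \<inter> Y) \<union> out_cut E (X \<union> Y)) + card (out_cut E (X \<inter> Y) \<inter> out_cut E (X \<union> Y))"
    using card_Un_Int fin by blast
  also have "\<dots> \<le> card (out_cut E X \<union> out_cut E Y) + card (out_cut E X \<inter> out_cut E Y)"
    by (intro add_mono card_mono) (auto simp: fin, auto simp: out_cut_def)
  also have "\<dots> = card (out_cut E X) + card (out_cut E Y)" using card_Un_Int fin by metis
  finally show ?thesis .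
qed

text \<open>The net outflow at a vertex. It measures both the defect from being Eulerian and, in the
  proof of Menger's theorem, the value of a flow.\<close>

definition excess :: "'a rel \<Rightarrow> 'a \<Rightarrow> int" where
  "excess E x = int (card (E `` {x})) - int (card (E\<inverse> `` {x}))"

lemma cut_excess:
  assumes fin: "finite E" "finite X"
  shows "int (card (out_cut E X)) - int (card (out_cut E (- X))) = (\<Sum>x\<in>X. excess E x)"
proof -
  have finI: "finite (E `` {x})" "finite (E\<inverse> `` {x})" for x
    using fin by (auto simp: finite_Image)
  have "card (SIGMA x:X. E `` {x}) = (\<Sum>x\<in>X. card (E `` {x}))"
    using fin finI by simp
  moreover have "(SIGMA x:X. E `` {x}) = out_cut E X \<union> induced E X" by (auto simp: out_cut_def induced_def)
  moreover have "card (out_cut E X \<union> induced E X) = card (out_cut E X) + card (induced E X)"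
    using fin by (intro card_Un_disjoint) (auto simp: out_cut_def induced_def)
  moreover have "card (SIGMA x:X. E\<inverse> `` {x}) = (\<Sum>x\<in>X. card (E\<inverse> `` {x}))"
    using fin finI by simp
  moreover have "(SIGMA x:X. E\<inverse> `` {x}) = (out_cut E (- X) \<union> induced E X)\<inverse>" by (auto simp: out_cut_def induced_def)
  moreover have "card (out_cut E (- X) \<union> induced E X) = card (out_cut E (- X)) + card (induced E X)"
    using fin by (intro card_Un_disjoint) (auto simp: out_cut_def induced_def)
  ultimately show ?thesis by (simp add: excess_def sum_subtractf flip: of_nat_sum)
qed

text \<open>Fix \<open>v\<close> and take the maximal nonempty sets avoiding \<open>v\<close> that
  are left by at most \<open>k\<close> arcs. If two of them meet, their intersection is left by at
  least \<open>k\<close> arcs, so by submodularity their union is again such a set; hence they are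
  disjoint, and they cover all vertices but \<open>v\<close>. Each is entered by at least
  \<open>k\<close> arcs, so these vertices have total excess at most 0 and \<open>v\<close> has
  excess at least 0. As all excesses sum to 0, they vanish.\<close>

lemma crit_sep_excess_0:
  assumes E: "crit_sep k E" and k: "1 \<le> k"
  shows "excess E v = 0"
proof -
  let ?V = "Field E"
  have fin: "finite E" "finite ?V" using E by (auto simp: crit_sep_def finite_Field)
  have nonneg: "0 \<le> excess E v" if v: "v \<in> ?V" for v
  proof -
    define T where "T = {X. X \<subseteq> ?V - {v} \<and> X \<noteq> {} \<and> card (out_cut E X) \<le> k}"
    define M where "M = {X \<in> T. \<forall>Y\<in>T. X \<subseteq> Y \<longrightarrow> X = Y}"
    have finT: "finite T" unfolding T_def using fin by (auto intro: finite_subset[of _ "Pow ?V"])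
    have eqI: "out_cut E (X \<inter> ?V) = out_cut E X" for X by (auto simp: out_cut_def Field_def)
    have cover: "\<exists>X\<in>M. u \<in> X" if u: "u \<in> ?V - {v}" for u
    proof -
      obtain X where "u \<in> X" "v \<notin> X" "card (out_cut E X) \<le> k"
        using E u v unfolding crit_sep_def by blast
      then have X: "X \<inter> ?V \<in> T" "u \<in> X \<inter> ?V" using u by (auto simp: T_def eqI)
      from finite_has_maximal2[OF finT X(1)] obtain Y where "Y \<in> T" "X \<inter> ?V \<subseteq> Y" "\<forall>Z\<in>T. Y \<subseteq> Z \<longrightarrow> Y = Z"
        by auto
      then show ?thesis using X by (auto simp: M_def)
    qed
    have ge: "k \<le> card (out_cut E X)" if "X \<subseteq> ?V - {v}" "X \<noteq> {}" for X
      using crit_sep_cut_ge[OF E k, of X] that v by auto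
    have disj: "X \<inter> Y = {}" if "X \<in> M" "Y \<in> M" "X \<noteq> Y" for X Y
    proof (rule ccontr)
      assume ne: "X \<inter> Y \<noteq> {}"
      have XT: "X \<in> T" "Y \<in> T" using that by (auto simp: M_def)
      have "k \<le> card (out_cut E (X \<inter> Y))" using XT ne by (intro ge) (auto simp: T_def)
      then have "card (out_cut E (X \<union> Y)) \<le> k"
        using cut_submodular[OF fin(1), of X Y] XT by (auto simp: T_def)
      then have "X \<union> Y \<in> T" using XT by (auto simp: T_def)
      then have "X = X \<union> Y" "Y = X \<union> Y" using that by (auto simp: M_def)
      then show False using that by simp
    qed
    have U: "\<Union>M = ?V - {v}" using cover by (auto simp: M_def T_def)
    have "(\<Sum>x\<in>?V - {v}. excess E x) = (\<Sum>X\<in>M. \<Sum>x\<in>X. excess E x)"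
    proof -
      have "finite X" if "X \<in> M" for X
      proof (rule finite_subset[OF _ fin(2)])
        show "X \<subseteq> ?V" using that by (auto simp: M_def T_def)
      qed
      then show ?thesis unfolding U[symmetric] using disj by (subst sum.Union_disjoint) auto
    qed
    also have "\<dots> \<le> (\<Sum>X\<in>M. 0)"
    proof (rule sum_mono)
      fix X assume X: "X \<in> M"
      then have XT: "X \<subseteq> ?V - {v}" "X \<noteq> {}" "card (out_cut E X) \<le> k" by (auto simp: M_def T_def)
      have "k \<le> card (out_cut E (- X))"
        using crit_sep_cut_ge[OF E k, of "- X"] XT v by auto
      moreover have "finite X" using XT fin finite_subset by blast
      ultimately show "(\<Sum>x\<in>X. excess E x) \<le> 0" using cut_excess[OF fin(1), of X] XT by simp
    qed
    finally have "(\<Sum>x\<in>?V - {v}. excess E x) \<le> 0" by simp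
    moreover have "(\<Sum>x\<in>?V. excess E x) = 0"
    proof -
      have "out_cut E ?V = {}" "out_cut E (- ?V) = {}" by (auto simp: out_cut_def Field_def)
      then show ?thesis using cut_excess[OF fin] by simp
    qed
    moreover have "(\<Sum>x\<in>?V. excess E x) = excess E v + (\<Sum>x\<in>?V - {v}. excess E x)"
      using v fin by (simp add: sum.remove)
    ultimately show ?thesis by simp
  qed
  have z: "(\<Sum>x\<in>?V. excess E x) = 0"
  proof -
    have "out_cut E ?V = {}" "out_cut E (- ?V) = {}" by (auto simp: out_cut_def Field_def)
    then show ?thesis using cut_excess[OF fin] by simp
  qed
  show ?thesis
  proof (cases "v \<in> ?V")
    case True
    then show ?thesis using z nonneg fin sum_nonneg_eq_0_iff[of ?V "excess E"] by auto
  next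
    case False
    then have "E `` {v} = {}" "E\<inverse> `` {v} = {}" by (auto simp: Field_def)
    then show ?thesis by (simp add: excess_def)
  qed
qed

lemma excess_0_cut:
  assumes fin: "finite E" and e: "\<And>v. excess E v = 0"
  shows "card (out_cut E (- X)) = card (out_cut E X)"
proof -
  have "out_cut E X = out_cut E (X \<inter> Field E)" "out_cut E (- X) = out_cut E (- (X \<inter> Field E))"
    by (auto simp: out_cut_def Field_def)
  moreover have "finite (X \<inter> Field E)" using fin by (simp add: finite_Field)
  ultimately show ?thesis using cut_excess[OF fin, of "X \<inter> Field E"] e by simp
qed

lemma crit_sep_balanced: "crit_sep k E \<Longrightarrow> 1 \<le> k \<Longrightarrow> card (out_cut E (- X)) = card (out_cut E X)"
  using excess_0_cut crit_sep_excess_0 by (metis crit_sep_def)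

section \<open>Critical digraphs all of whose vertex pairs are separated by few arcs\<close>

lemma crit_sepD:
  assumes "crit_sep k E"
  shows "finite E" "\<And>x. (x, x) \<notin> E" "\<not> colourable k E" "\<And>E'. E' \<subset> E \<Longrightarrow> colourable k E'"
    "\<And>u v. u \<in> Field E \<Longrightarrow> v \<in> Field E \<Longrightarrow> u \<noteq> v \<Longrightarrow> \<exists>X. u \<in> X \<and> v \<notin> X \<and> card (out_cut E X) \<le> k"
  using assms unfolding crit_sep_def by blast+

lemma finite_cut: "finite E \<Longrightarrow> finite (out_cut E X)"
  by (simp add: out_cut_def)

lemma rtrancl_crosses:
  assumes "(u, v) \<in> R\<^sup>*" "u \<in> X" "v \<notin> X"
  shows "out_cut R X \<noteq> {}"
  using assms by (induction rule: rtrancl_induct) (auto simp: out_cut_def)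

lemma ind_psubset:
  assumes "v \<in> Field E" "v \<notin> X"
  shows "induced E X \<subset> E"
  using assms by (auto simp: induced_def Field_def)

lemma Field_mono_ind: "Field (mono_arcs (induced E X) f) \<subseteq> X"
  by (auto simp: mono_arcs_def induced_def Field_def)

lemma trancl_Field: "(x, y) \<in> R\<^sup>+ \<Longrightarrow> x \<in> Field R \<and> y \<in> Field R"
  by (auto dest: tranclD tranclD2 simp: Field_def)

text \<open>Colour the two sides separately, with \<open>a\<close> in both, and transpose colours on
  one side so that they agree at \<open>a\<close>. A monochromatic path through one side that joins
  vertices of the other would start and end at \<open>a\<close>, so gluing creates no cycle.\<close>

lemma crit_sep_no_cutvertex:
  assumes E: "crit_sep k E"
    and A: "A \<inter> Field E \<noteq> {}" "Field E - A - {a} \<noteq> {}" "a \<notin> A"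
    and c: "out_cut E A \<subseteq> A \<times> {a}" "out_cut E (- A) \<subseteq> {a} \<times> A"
  shows False
proof -
  obtain x y where xy: "x \<in> A" "x \<in> Field E" "y \<in> Field E" "y \<notin> A \<union> {a}" using A by auto
  obtain f where f: "kcol k (induced E (A \<union> {a})) f"
    using crit_sepD(4)[OF E ind_psubset[OF xy(3,4)]] by (auto simp: colourable_def)
  obtain g where g: "kcol k (induced E (- A)) g"
    using crit_sepD(4)[OF E ind_psubset[OF xy(2)], of "- A"] xy by (auto simp: colourable_def)
  let ?p = "transpose (g a) (f a)"
  have p: "inj ?p" "\<And>i. i < k \<Longrightarrow> ?p i < k"
    using f g by (auto simp: inj_transpose transpose_less kcol_def)
  let ?h = "\<lambda>v. if v \<in> A then f v else ?p (g v)"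
  have R: "mono_arcs (induced E (A \<union> {a})) ?h = mono_arcs (induced E (A \<union> {a})) f"
    by (rule mono_arcs_cong) (use A in \<open>auto simp: induced_def Field_def\<close>)
  have S: "mono_arcs (induced E (- A)) ?h = mono_arcs (induced E (- A)) g"
    using p(1) by (auto simp: mono_arcs_def induced_def inj_eq)
  have aS: "acyclic (mono_arcs (induced E (- A)) ?h)" using g S by (simp add: kcol_def)
  have "acyclic (mono_arcs (induced E (A \<union> {a})) ?h \<union> mono_arcs (induced E (- A)) ?h)"
  proof (rule acyclic_glue_disjoint)
    fix p q assume "p \<in> Field (mono_arcs (induced E (A \<union> {a})) ?h)" "q \<in> Field (mono_arcs (induced E (A \<union> {a})) ?h)"
      and pq: "(p, q) \<in> (mono_arcs (induced E (- A)) ?h)\<^sup>+"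
    then have "p = a" "q = a"
      using Field_mono_ind[of E "A \<union> {a}" ?h] Field_mono_ind[of E "- A" ?h] trancl_Field[OF pq] by auto
    then show False using pq aS by (auto simp: acyclic_def)
  qed (use f R aS in \<open>auto simp: kcol_def\<close>)
  moreover have "E = induced E (A \<union> {a}) \<union> induced E (- A)"
    using c by (auto simp: induced_def out_cut_def)
  ultimately have "acyclic (mono_arcs E ?h)" by (metis mono_arcs_Un)
  moreover have "\<forall>v. ?h v < k" using f g p by (auto simp: kcol_def)
  ultimately show False using crit_sepD(3)[OF E] colourableI by blast
qed

text \<open>Replacing paths outside \<open>F\<close> by single arcs does not enlarge cuts, because the two new arcs
  never leave the same set.\<close>

lemma card_cut_replace:
  assumes fin: "finite E" and FE: "F \<subseteq> E" and G: "G \<subseteq> F \<union> {(p, q), (q, r)}"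
    and pq: "(p, q) \<in> G - F \<Longrightarrow> (p, q) \<in> (E - F)\<^sup>*" and qr: "(q, r) \<in> G - F \<Longrightarrow> (q, r) \<in> (E - F)\<^sup>*"
  shows "card (out_cut G X) \<le> card (out_cut E X)"
proof (cases "out_cut G X \<subseteq> F")
  case True
  then have "out_cut G X \<subseteq> out_cut E X" using FE by (auto simp: out_cut_def)
  then show ?thesis using fin by (simp add: card_mono finite_cut)
next
  case False
  then obtain u v where uv: "(u, v) \<in> out_cut G X" "(u, v) \<notin> F" by auto
  then have uv': "(u, v) = (p, q) \<or> (u, v) = (q, r)" "(u, v) \<in> G - F" using G by (auto simp: out_cut_def)
  then have path: "(u, v) \<in> (E - F)\<^sup>*" using pq qr by auto
  then obtain e where e: "e \<in> out_cut (E - F) X"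
    using rtrancl_crosses[OF path, of X] uv by (auto simp: out_cut_def)
  have "out_cut G X \<subseteq> insert (u, v) (out_cut E X - {e})"
    using G FE uv uv' e by (auto simp: out_cut_def)
  then have "card (out_cut G X) \<le> card (insert (u, v) (out_cut E X - {e}))"
    using fin by (intro card_mono) (auto simp: finite_cut)
  also have "\<dots> \<le> Suc (card (out_cut E X - {e}))" by (simp add: card_insert_if fin finite_cut)
  also have "\<dots> = card (out_cut E X)"
    using e fin by (intro card_Suc_Diff1) (auto simp: out_cut_def)
  finally show ?thesis .
qed

lemma exists_crit_sep:
  assumes fin: "finite H" and irr: "\<And>x. (x, x) \<notin> H" and nc: "\<not> colourable k H"
    and sep: "\<And>u v. u \<in> Field H \<Longrightarrow> v \<in> Field H \<Longrightarrow> u \<noteq> v \<Longrightarrow> \<exists>X. u \<in> X \<and> v \<notin> X \<and> card (out_cut H X) \<le> k"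
  obtains G where "G \<subseteq> H" "crit_sep k G"
proof -
  let ?A = "{G. G \<subseteq> H \<and> \<not> colourable k G}"
  have "finite ?A" using fin by (auto intro: finite_subset[of _ "Pow H"])
  moreover have "H \<in> ?A" using nc by simp
  ultimately obtain G where G: "G \<in> ?A" "\<forall>G'\<in>?A. G' \<subseteq> G \<longrightarrow> G = G'"
    using finite_has_minimal[of ?A] by blast
  have "crit_sep k G"
    unfolding crit_sep_def
  proof (intro conjI ballI allI impI)
    show "finite G" using G fin by (auto intro: finite_subset)
    show "\<not> colourable k G" using G by simp
    show "(x, x) \<notin> G" for x using G irr by auto
    show "colourable k G'" if "G' \<subset> G" for G' using G that by blast
    fix u v assume "u \<in> Field G" "v \<in> Field G" "u \<noteq> v"
    then obtain X where X: "u \<in> X" "v \<notin> X" "card (out_cut H X) \<le> k"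
      using sep G by (auto simp: Field_def) (metis Domain.DomainI Field_def Range.RangeI UnCI in_mono)+
    have "card (out_cut G X) \<le> card (out_cut H X)"
      using G fin by (intro card_mono) (auto simp: out_cut_def)
    then show "\<exists>X. u \<in> X \<and> v \<notin> X \<and> card (out_cut G X) \<le> k" using X by (meson le_trans)
  qed
  then show ?thesis using that G by auto
qed

definition splits :: "'a rel \<Rightarrow> 'a \<Rightarrow> 'a set \<Rightarrow> 'a set \<Rightarrow> bool" where
  "splits E a A B \<longleftrightarrow> A \<noteq> {} \<and> B \<noteq> {} \<and> a \<notin> A \<and> a \<notin> B \<and> A \<inter> B = {} \<and> A \<union> B \<union> {a} = Field E
     \<and> card (E \<inter> A \<times> B) \<le> 1 \<and> card (E \<inter> B \<times> A) \<le> 1"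

definition decomposable :: "'a rel \<Rightarrow> bool" where
  "decomposable E \<longleftrightarrow> (\<exists>a A B. splits E a A B)"

lemma card_cut_split:
  assumes "finite E"
  shows "card (out_cut E X) = card (out_cut (E - G) X) + card (out_cut (E \<inter> G) X)"
proof -
  have "out_cut E X = out_cut (E - G) X \<union> out_cut (E \<inter> G) X" by (auto simp: out_cut_def)
  then show ?thesis using assms by (simp add: card_Un_disjoint out_cut_def disjoint_iff)
qed

text \<open>Both relations are balanced across \<open>X\<close>, and their common arcs
  cancel.\<close>

lemma card_cut_balance_diff:
  assumes E: "crit_sep k E" and G: "crit_sep k G" and k: "1 \<le> k"
  shows "card (out_cut (E - G) X) + card (out_cut (G - E) (- X)) = card (out_cut (E - G) (- X)) + card (out_cut (G - E) X)"
  using card_cut_split[OF crit_sepD(1)[OF E], of X G] card_cut_split[OF crit_sepD(1)[OF E], of "- X" G]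
    card_cut_split[OF crit_sepD(1)[OF G], of X E] card_cut_split[OF crit_sepD(1)[OF G], of "- X" E]
    crit_sep_balanced[OF E k, of X] crit_sep_balanced[OF G k, of X] by (simp add: Int_commute)

text \<open>\<open>Z\<close> separates two vertices of \<open>G\<close>, so \<open>G\<close> has at
  least \<open>k\<close> arcs across it in either direction while \<open>E\<close> has at most
  \<open>k\<close>; the common arcs cancel.\<close>

lemma card_cut_tight_diff:
  assumes E: "crit_sep k E" and G: "crit_sep k G" and k: "1 \<le> k"
    and Z: "u \<in> Field G" "v \<in> Field G" "u \<in> Z" "v \<notin> Z" "card (out_cut E Z) \<le> k"
  shows "card (out_cut (E - G) Z) \<le> card (out_cut (G - E) Z)" "card (out_cut (E - G) (- Z)) \<le> card (out_cut (G - E) (- Z))"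
proof -
  have "k \<le> card (out_cut G Z)" using crit_sep_cut_ge[OF G k, of Z] Z by auto
  then show "card (out_cut (E - G) Z) \<le> card (out_cut (G - E) Z)"
    using card_cut_split[OF crit_sepD(1)[OF E], of Z G] card_cut_split[OF crit_sepD(1)[OF G], of Z E] Z
    by (simp add: Int_commute)
  have "k \<le> card (out_cut G (- Z))" using crit_sep_cut_ge[OF G k, of "- Z"] Z by auto
  then show "card (out_cut (E - G) (- Z)) \<le> card (out_cut (G - E) (- Z))"
    using card_cut_split[OF crit_sepD(1)[OF E], of "- Z" G] card_cut_split[OF crit_sepD(1)[OF G], of "- Z" E] Z
      crit_sep_balanced[OF E k, of Z]
    by (simp add: Int_commute)
qed

lemma rtrancl_in_Field: "(x, y) \<in> R\<^sup>* \<Longrightarrow> x = y \<or> (x \<in> Field R \<and> y \<in> Field R)"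
  by (metis rtrancl_eq_or_trancl trancl_Field)

text \<open>The arcs of \<open>E - G\<close> are balanced up to one unit flowing from \<open>t\<close> to \<open>h\<close>, so its strong
  components form a chain linked by single arcs, and each of them contains at most one vertex of \<open>G\<close>.\<close>

lemma decomposable_one_arc:
  assumes E: "crit_sep k E" and G: "crit_sep k G" and k: "2 \<le> k"
    and sub: "Field G \<subset> Field E" and N: "G - E \<subseteq> {(t, h)}"
  shows "decomposable E"
proof -
  have k1: "1 \<le> k" using k by simp
  define C where "C = E - G"
  have cutN: "card (out_cut (G - E) X) \<le> 1" for X
    using card_mono[of "{(t, h)}" "out_cut (G - E) X"] N by (auto simp: out_cut_def)
  obtain p where p: "p \<in> Field E" "p \<notin> Field G" using sub by auto
  \<comment> \<open>\<open>S\<close> is the strong component of \<open>p\<close> in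
    \<open>E - G\<close>. No arc of \<open>C\<close> enters \<open>L\<close> and none leaves
    \<open>M\<close>, and the balance turns this into a bound of one arc in the other
    direction.\<close>
  define L where "L = {z. (z, p) \<in> C\<^sup>*}"
  define M where "M = {z. (p, z) \<in> C\<^sup>*}"
  define S where "S = L \<inter> M"
  have SV: "S \<subseteq> Field E"
    using p by (auto simp: S_def M_def C_def Field_def dest!: rtrancl_in_Field)
  have pS: "p \<in> S" by (simp add: S_def L_def M_def)
  have "out_cut C (- L) = {}" by (auto simp: out_cut_def L_def intro: converse_rtrancl_into_rtrancl)
  then have cL: "card (out_cut C L) \<le> 1"
    using card_cut_balance_diff[OF E G k1, of L] cutN[of L] by (simp add: C_def)
  have "out_cut C M = {}" by (auto simp: out_cut_def M_def intro: rtrancl_into_rtrancl)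
  then have cM: "card (out_cut C (- M)) \<le> 1"
    using card_cut_balance_diff[OF E G k1, of M] cutN[of "- M"] by (simp add: C_def)
  have finC: "finite C" using crit_sepD(1)[OF E] by (simp add: C_def)
  have outS: "card (out_cut C S) \<le> 1"
  proof -
    have "out_cut C S \<subseteq> out_cut C L"
      by (auto simp: out_cut_def S_def M_def intro: rtrancl_into_rtrancl)
    then show ?thesis using cL card_mono[OF finite_cut[OF finC]] le_trans by blast
  qed
  have inS: "card (out_cut C (- S)) \<le> 1"
  proof -
    have "out_cut C (- S) \<subseteq> out_cut C (- M)"
      by (auto simp: out_cut_def S_def L_def intro: converse_rtrancl_into_rtrancl)
    then show ?thesis using cM card_mono[OF finite_cut[OF finC]] le_trans by blast
  qed
  have uniq: "x = y" if x: "x \<in> S" "x \<in> Field G" and y: "y \<in> S" "y \<in> Field G" for x y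
  proof (rule ccontr)
    assume ne: "x \<noteq> y"
    obtain Z where Z: "x \<in> Z" "y \<notin> Z" "card (out_cut E Z) \<le> k"
      using crit_sepD(5)[OF E _ _ ne] x y sub by auto
    have xy: "(x, y) \<in> C\<^sup>*" "(y, x) \<in> C\<^sup>*"
      using x y unfolding S_def L_def M_def by (auto intro: rtrancl_trans)
    have "out_cut C Z \<noteq> {}" "out_cut C (- Z) \<noteq> {}"
      using rtrancl_crosses[OF xy(1), of Z] rtrancl_crosses[OF xy(2), of "- Z"] Z by auto
    then have "card (out_cut C Z) > 0" "card (out_cut C (- Z)) > 0"
      using finite_cut[OF finC] by (simp_all add: card_gt_0_iff)
    then have "out_cut (G - E) Z \<noteq> {}" "out_cut (G - E) (- Z) \<noteq> {}"
      using card_cut_tight_diff[OF E G k1 x(2) y(2) Z] unfolding C_def by auto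
    then show False using N by (auto simp: out_cut_def)
  qed
  have fG: "\<exists>w'\<in>Field G. w' \<noteq> w" for w
  proof -
    have "G \<noteq> {}" using crit_sepD(3)[OF G] k1
      by (auto simp: colourable_def kcol_def mono_arcs_def acyclic_def intro!: exI[of _ "\<lambda>_. 0"])
    then obtain a b where "(a, b) \<in> G" by auto
    then show ?thesis using crit_sepD(2)[OF G, of a] by (metis FieldI1 FieldI2)
  qed
  show ?thesis
  proof (cases "S \<inter> Field G = {}")
    case True
    \<comment> \<open>Without a vertex of \<open>G\<close>, all arcs at \<open>S\<close> lie in
      \<open>C\<close>, so \<open>E\<close> would have a cut with at most one arc.\<close>
    then have "out_cut E S \<subseteq> out_cut C S" by (auto simp: out_cut_def C_def Field_def)
    then have "card (out_cut E S) \<le> 1" using outS card_mono[OF finite_cut[OF finC]] le_trans by blast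
    moreover have "k \<le> card (out_cut E S)"
      using crit_sep_cut_ge[OF E k1, of S] True pS p sub fG[of p] by fastforce
    ultimately show ?thesis using k by simp
  next
    case False
    then obtain w where w: "w \<in> S" "w \<in> Field G" by auto
    have "splits E w (S - {w}) (Field E - S)"
      unfolding splits_def
    proof (intro conjI)
      show "S - {w} \<noteq> {}" using pS p w by auto
      obtain w' where "w' \<in> Field G" "w' \<noteq> w" using fG by blast
      then show "Field E - S \<noteq> {}" using uniq w sub by blast
      have "E \<inter> (S - {w}) \<times> (Field E - S) \<subseteq> out_cut C S"
        using uniq w by (auto simp: out_cut_def C_def Field_def)
      then show "card (E \<inter> (S - {w}) \<times> (Field E - S)) \<le> 1"
        using outS card_mono[OF finite_cut[OF finC]] le_trans by blast
      have "E \<inter> (Field E - S) \<times> (S - {w}) \<subseteq> out_cut C (- S)"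
        using uniq w by (auto simp: out_cut_def C_def Field_def)
      then show "card (E \<inter> (Field E - S) \<times> (S - {w})) \<le> 1"
        using inS card_mono[OF finite_cut[OF finC]] le_trans by blast
    qed (use w SV in auto)
    then show ?thesis by (auto simp: decomposable_def)
  qed
qed

section \<open>Sets forced to be monochromatic\<close>

definition rigid :: "nat \<Rightarrow> 'a rel \<Rightarrow> 'a set \<Rightarrow> bool" where
  "rigid k F S \<longleftrightarrow> (\<forall>f. kcol k F f \<longrightarrow> (\<forall>s\<in>S. \<forall>s'\<in>S. f s = f s'))"

text \<open>The arcs outside \<open>F\<close> touch \<open>F\<close> only in \<open>S\<close> and tie \<open>S\<close> together, while \<open>F\<close> alone forces \<open>S\<close>
  to be monochromatic. Closing \<open>F\<close> by a digon inside \<open>S\<close> therefore destroys colourability without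
  enlarging any cut.\<close>

definition forcing :: "nat \<Rightarrow> 'a rel \<Rightarrow> 'a rel \<Rightarrow> 'a set \<Rightarrow> bool" where
  "forcing k E F S \<longleftrightarrow> F \<subseteq> E \<and> S \<subseteq> Field E \<and> \<not> Field E \<subseteq> Field F \<union> S
     \<and> (\<forall>x y. (x, y) \<in> E - F \<longrightarrow> (x \<in> Field F \<longrightarrow> x \<in> S) \<and> (y \<in> Field F \<longrightarrow> y \<in> S))
     \<and> (\<forall>s\<in>S. \<forall>s'\<in>S. (s, s') \<in> (E - F)\<^sup>*)
     \<and> rigid k F S"

lemma rigidD: "rigid k F S \<Longrightarrow> kcol k F f \<Longrightarrow> s \<in> S \<Longrightarrow> s' \<in> S \<Longrightarrow> f s = f s'"
  unfolding rigid_def by (drule spec[of _ f]) blast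

lemma forcingD:
  assumes "forcing k E F S"
  shows "F \<subseteq> E" "S \<subseteq> Field E" "\<not> Field E \<subseteq> Field F \<union> S"
    "\<And>x y. (x, y) \<in> E - F \<Longrightarrow> x \<in> Field F \<Longrightarrow> x \<in> S"
    "\<And>x y. (x, y) \<in> E - F \<Longrightarrow> y \<in> Field F \<Longrightarrow> y \<in> S"
    "\<And>s s'. s \<in> S \<Longrightarrow> s' \<in> S \<Longrightarrow> (s, s') \<in> (E - F)\<^sup>*"
  using assms unfolding forcing_def by blast+

lemma forcing_constant: "forcing k E F S \<Longrightarrow> kcol k F f \<Longrightarrow> s \<in> S \<Longrightarrow> s' \<in> S \<Longrightarrow> f s = f s'"
  using rigidD unfolding forcing_def by metis

text \<open>Each component of \<open>C\<close> meets \<open>W\<close> at most once, so a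
  monochromatic path in \<open>C\<close> between two vertices of \<open>F\<close> would be closed,
  which the acyclicity of \<open>C\<close> in its colours excludes.\<close>

lemma kcol_glue:
  assumes F: "Field F \<subseteq> W" "kcol k F f" "acyclic (mono_arcs C f)"
    and uniq: "\<And>x y. x \<in> W \<Longrightarrow> y \<in> W \<Longrightarrow> (x, y) \<in> (C \<union> C\<inverse>)\<^sup>* \<Longrightarrow> x = y"
  shows "kcol k (F \<union> C) f"
proof -
  have "acyclic (mono_arcs F f \<union> mono_arcs C f)"
  proof (rule acyclic_glue_disjoint)
    fix p q assume "p \<in> Field (mono_arcs F f)" "q \<in> Field (mono_arcs F f)"
      and pq: "(p, q) \<in> (mono_arcs C f)\<^sup>+"
    then have "p \<in> W" "q \<in> W" using F(1) mono_Field[OF mono_arcs_subset, of F f] by auto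
    moreover have "(p, q) \<in> (C \<union> C\<inverse>)\<^sup>*"
      using trancl_mono[OF pq, of "C \<union> C\<inverse>"] mono_arcs_subset[of C f] by (auto intro: trancl_into_rtrancl)
    ultimately have "p = q" using uniq by blast
    then show False using pq F(3) by (simp add: acyclic_def)
  qed (use F in \<open>auto simp: kcol_def\<close>)
  then show ?thesis using F(2) by (simp add: kcol_def mono_arcs_Un)
qed

text \<open>Each component of \<open>C\<close> carries at most one prescribed colour, so
  \<open>g\<close> can be corrected on it by a transposition of its own.\<close>

lemma extend_colouring:
  assumes F: "Field F \<subseteq> W" "kcol k F f" and C: "kcol k C g"
    and uniq: "\<And>x y. x \<in> W \<Longrightarrow> y \<in> W \<Longrightarrow> (x, y) \<in> (C \<union> C\<inverse>)\<^sup>* \<Longrightarrow> x = y"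
  obtains h where "kcol k (F \<union> C) h" "\<And>w. w \<in> W \<Longrightarrow> h w = f w"
proof -
  let ?D = "(C \<union> C\<inverse>)\<^sup>*"
  \<comment> \<open>\<open>P z\<close> describes the vertex of \<open>W\<close> in the component of
    \<open>z\<close>; a component without such a vertex keeps the colours of
    \<open>g\<close>.\<close>
  define P where "P z x \<longleftrightarrow> x \<in> W \<and> (x, z) \<in> ?D" for z x
  define t where "t z = (if Ex (P z) then transpose (g (Eps (P z))) (f (Eps (P z))) else id)" for z
  define h where "h z = t z (g z)" for z
  have inj_t: "inj (t z)" for z by (simp add: t_def inj_transpose)
  have PW: "P w = (\<lambda>x. x = w)" if "w \<in> W" for w
    using uniq that by (auto simp: P_def fun_eq_iff)
  have hW: "h w = f w" if "w \<in> W" for w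
    using that by (simp add: h_def t_def PW)
  have PC: "P a = P b" if "(a, b) \<in> C" for a b
  proof -
    have "(a, b) \<in> ?D" "(b, a) \<in> ?D" using that by auto
    then show ?thesis unfolding P_def fun_eq_iff by (meson rtrancl_trans)
  qed
  have "t a = t b" if "(a, b) \<in> C" for a b unfolding t_def PC[OF that] ..
  then have "h a = h b \<longleftrightarrow> g a = g b" if "(a, b) \<in> C" for a b
    using that inj_t by (simp add: h_def inj_eq)
  then have "mono_arcs C h = mono_arcs C g"
    by (auto simp: mono_arcs_def)
  then have aC: "acyclic (mono_arcs C h)" using C by (simp add: kcol_def)
  have "mono_arcs F h = mono_arcs F f"
    by (rule mono_arcs_cong) (use F hW in auto)
  moreover have "\<forall>v. h v < k" using F C by (auto simp: h_def t_def kcol_def transpose_less)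
  ultimately have "kcol k F h" using F by (simp add: kcol_def)
  from kcol_glue[OF F(1) this aC uniq] hW that show ?thesis by blast
qed

lemma third_colour:
  assumes "3 \<le> (k::nat)"
  obtains c where "c < k" "c \<noteq> a" "c \<noteq> b"
proof -
  have "\<exists>c<3. c \<noteq> a \<and> c \<noteq> b" by presburger
  then show ?thesis using that assms by (meson order_less_le_trans)
qed

text \<open>Nothing leaves the set reached from \<open>y\<close>, so by balance nothing enters it,
  and \<open>x\<close>, from which \<open>y\<close> is reached, already belongs to it.\<close>

lemma balanced_rtrancl_sym:
  assumes fin: "finite C" and bal: "\<And>X. card (out_cut C X) = card (out_cut C (- X))"
    and xy: "(x, y) \<in> C\<^sup>*"
  shows "(y, x) \<in> C\<^sup>*"
proof (rule ccontr)
  assume n: "(y, x) \<notin> C\<^sup>*"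
  let ?L = "{z. (y, z) \<in> C\<^sup>*}"
  have "out_cut C ?L = {}" by (auto simp: out_cut_def intro: rtrancl_into_rtrancl)
  then have "out_cut C (- ?L) = {}" using bal[of ?L] fin by (simp add: finite_cut)
  then show False using rtrancl_crosses[OF xy, of "- ?L"] n by auto
qed

lemma two_arcs:
  assumes "e \<in> out_cut C Z" "e' \<in> out_cut C Z" "e \<noteq> e'" "finite C"
  shows "2 \<le> card (out_cut C Z)"
proof -
  have "card {e, e'} \<le> card (out_cut C Z)" using assms by (intro card_mono) (auto simp: finite_cut)
  then show ?thesis using assms by simp
qed

text \<open>The new \<open>F'\<close> is what the closing digon leaves of a critical subdigraph \<open>G\<close>. A set separating
  two vertices of \<open>G\<close> by \<open>k\<close> arcs is crossed by \<open>E - G\<close> at most once in each direction, and only if it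
  separates \<open>p\<close> from \<open>q\<close>; if \<open>p\<close> and \<open>q\<close> were the only members of \<open>S'\<close>, such a set would
  decompose \<open>E\<close>.\<close>

lemma forcing_step:
  assumes E: "crit_sep k E" and k: "3 \<le> k" and nd: "\<not> decomposable E"
    and FS: "forcing k E F S" and p: "p \<in> S" and q: "q \<in> S" and pq: "p \<noteq> q"
  obtains F' S' w where "F' \<subseteq> F" "(p, q) \<notin> E" "(q, p) \<notin> E" "crit_sep k (F' \<union> {(p, q), (q, p)})"
    "forcing k E F' S'" "S' \<subseteq> Field (F' \<union> {(p, q), (q, p)})" "p \<in> S'" "q \<in> S'"
    "w \<in> S'" "w \<noteq> p" "w \<noteq> q"
proof -
  have k1: "1 \<le> k" and k2: "2 \<le> k" using k by auto
  note finE = crit_sepD(1)[OF E]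
  note irr = crit_sepD(2)[OF E]
  note FE = forcingD(1)[OF FS]
  let ?V = "Field E"
  define H where "H = F \<union> {(p, q), (q, p)}"
  have HF: "H \<subseteq> F \<union> {(p, q), (q, p)}" by (simp add: H_def)
  have FH: "Field H \<subseteq> Field F \<union> S" using p q by (auto simp: H_def Field_def)
  have FHV: "Field H \<subset> ?V" using FH forcingD(2,3)[OF FS] mono_Field[OF FE] by blast
  have paths: "(p, q) \<in> (E - F)\<^sup>*" "(q, p) \<in> (E - F)\<^sup>*" using forcingD(6)[OF FS] p q by auto
  have "\<not> colourable k H"
  proof
    assume "colourable k H"
    then obtain f where f: "kcol k H f" by (auto simp: colourable_def)
    have "F \<subseteq> H" by (auto simp: H_def)
    then have "f p = f q" using forcing_constant[OF FS kcol_mono[OF f] p q] by simp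
    then have "(p, q) \<in> mono_arcs H f" "(q, p) \<in> mono_arcs H f" by (auto simp: mono_arcs_def H_def)
    then have "(p, p) \<in> (mono_arcs H f)\<^sup>+" by (meson r_into_trancl trancl_trans)
    then show False using f by (auto simp: kcol_def acyclic_def)
  qed
  moreover have "finite H" using finE FE by (auto simp: H_def intro: finite_subset)
  moreover have "(x, x) \<notin> H" for x using irr FE pq by (auto simp: H_def)
  moreover have "\<exists>X. u \<in> X \<and> v \<notin> X \<and> card (out_cut H X) \<le> k"
    if uv: "u \<in> Field H" "v \<in> Field H" "u \<noteq> v" for u v
  proof -
    obtain X where "u \<in> X" "v \<notin> X" "card (out_cut E X) \<le> k" using crit_sepD(5)[OF E _ _ uv(3)] uv FHV by blast
    moreover have "card (out_cut H X) \<le> card (out_cut E X)"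
      by (rule card_cut_replace[OF finE FE HF paths])
    ultimately show ?thesis by (meson le_trans)
  qed
  ultimately obtain G where G: "G \<subseteq> H" "crit_sep k G" using exists_crit_sep by blast
  have GV: "Field G \<subset> ?V" using mono_Field[OF G(1)] FHV by blast
  have GE: "G - E \<subseteq> {(p, q), (q, p)}" using G(1) FE by (auto simp: H_def)
  \<comment> \<open>If \<open>G\<close> did not use this arc as a new one, it would contain at most
    one arc outside \<open>E\<close>, and \<open>decomposable_one_arc\<close> would apply.\<close>
  have N1: "(p, q) \<in> G - E"
    using decomposable_one_arc[OF E G(2) k2 GV, of q p] GE nd by blast
  have N2: "(q, p) \<in> G - E"
    using decomposable_one_arc[OF E G(2) k2 GV, of p q] GE nd by blast
  have N: "G - E = {(p, q), (q, p)}" using N1 N2 GE by blast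
  define F' where "F' = G \<inter> E"
  have F'F: "F' \<subseteq> F" using N1 N2 G(1) by (auto simp: F'_def H_def)
  have "G = (G \<inter> E) \<union> (G - E)" by blast
  then have GF': "G = F' \<union> {(p, q), (q, p)}" unfolding F'_def N .
  let ?W = "Field G"
  define C where "C = E - G"
  have CF': "E - F' = C" by (auto simp: F'_def C_def)
  have finC: "finite C" using finE by (simp add: C_def)
  have EFC: "E - F \<subseteq> C" using F'F CF' by auto
  have FW: "Field F' \<subseteq> ?W" by (rule mono_Field) (simp add: F'_def)
  have pqW: "p \<in> ?W" "q \<in> ?W" using N1 by (auto simp: Field_def)
  have cutN: "card (out_cut (G - E) X) = (if (p \<in> X) = (q \<in> X) then 0 else 1)" for X
  proof -
    have "out_cut (G - E) X = (if p \<in> X \<and> q \<notin> X then {(p, q)} else if q \<in> X \<and> p \<notin> X then {(q, p)} else {})"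
      unfolding N by (auto simp: out_cut_def)
    then show ?thesis by auto
  qed
  \<comment> \<open>The new arcs form a digon and cancel when the balances of \<open>E\<close> and
    \<open>G\<close> are compared.\<close>
  have bal: "card (out_cut C X) = card (out_cut C (- X))" for X
    using card_cut_balance_diff[OF E G(2) k1, of X] by (simp add: C_def cutN)
  note sym = balanced_rtrancl_sym[OF finC bal]
  have tC: "card (out_cut C Z) \<le> 1 \<and> card (out_cut C (- Z)) \<le> 1
      \<and> (out_cut C Z \<noteq> {} \<or> out_cut C (- Z) \<noteq> {} \<longrightarrow> (p \<in> Z) \<noteq> (q \<in> Z))"
    if "u \<in> ?W" "v \<in> ?W" "u \<in> Z" "v \<notin> Z" "card (out_cut E Z) \<le> k" for u v Z
    using card_cut_tight_diff[OF E G(2) k1 that] finite_cut[OF finC]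
    unfolding C_def[symmetric] cutN by (auto split: if_splits)
  have tight: "\<exists>Z. u \<in> Z \<and> v \<notin> Z \<and> card (out_cut E Z) \<le> k" if "u \<in> ?W" "v \<in> ?W" "u \<noteq> v" for u v
    using crit_sepD(5)[OF E _ _ that(3)] that GV by blast
  \<comment> \<open>The component of \<open>E - G\<close> that contains \<open>p\<close> and
    \<open>q\<close>. Because \<open>C\<close> is balanced, reachability in it is symmetric and no
    arc of \<open>C\<close> joins \<open>K\<close> to the rest.\<close>
  define K where "K = {z. (p, z) \<in> C\<^sup>*}"
  have pK: "p \<in> K" by (simp add: K_def)
  have qK: "q \<in> K" using rtrancl_mono[OF EFC] paths(1) by (auto simp: K_def)
  have K1: "b \<in> K" if "(a, b) \<in> C" "a \<in> K" for a b
    using that by (auto simp: K_def intro: rtrancl_into_rtrancl)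
  have K2: "a \<in> K" if "(a, b) \<in> C" "b \<in> K" for a b
  proof -
    have "(b, a) \<in> C\<^sup>*" using sym[of a b] that by auto
    then show ?thesis using that by (auto simp: K_def intro: rtrancl_trans)
  qed
  have conK: "(a, b) \<in> C\<^sup>*" if "a \<in> K" "b \<in> K" for a b
    using that sym[of p a] by (auto simp: K_def intro: rtrancl_trans)
  have crossK: "\<exists>c d. (c, d) \<in> out_cut C Z \<and> c \<in> K" if "a \<in> K" "b \<in> K" "a \<in> Z" "b \<notin> Z" for a b and Z
  proof -
    have "out_cut C (Z \<inter> K) \<noteq> {}"
      using rtrancl_crosses[OF conK[OF that(1,2)], of "Z \<inter> K"] that by auto
    then obtain c d where "(c, d) \<in> out_cut C (Z \<inter> K)" by auto
    then have "(c, d) \<in> out_cut C Z" "c \<in> K" using K1[of c d] by (auto simp: out_cut_def)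
    then show ?thesis by blast
  qed
  have KV: "K \<subseteq> ?V"
  proof
    fix z assume "z \<in> K"
    then have "z = p \<or> z \<in> Field C" by (auto simp: K_def dest: rtrancl_in_Field)
    then show "z \<in> ?V" using pqW GV mono_Field[of C E] by (auto simp: C_def)
  qed
  \<comment> \<open>Every other component \<open>K'\<close> of \<open>C\<close> is a single vertex
    of \<open>G\<close>. It contains some vertex of \<open>G\<close>, as otherwise no arc of
    \<open>E\<close> would leave it. Two of them would be separated by a tight set that also
    separates \<open>p\<close> from \<open>q\<close> and is therefore left by an arc in
    \<open>K\<close> besides one in \<open>K'\<close>. If it contained further vertices, its only
    vertex of \<open>G\<close> would be a cut vertex.\<close>
  have outside: "z \<in> ?W \<and> {y. (z, y) \<in> C\<^sup>*} = {z}" if z: "z \<in> ?V" "z \<notin> K" for z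
  proof -
    define K' where "K' = {y. (z, y) \<in> C\<^sup>*}"
    have zK': "z \<in> K'" by (simp add: K'_def)
    have K'1: "b \<in> K'" if "(a, b) \<in> C" "a \<in> K'" for a b
      using that by (auto simp: K'_def intro: rtrancl_into_rtrancl)
    have K'2: "a \<in> K'" if "(a, b) \<in> C" "b \<in> K'" for a b
    proof -
      have "(b, a) \<in> C\<^sup>*" using sym[of a b] that by auto
      then show ?thesis using that by (auto simp: K'_def intro: rtrancl_trans)
    qed
    have KK': "K \<inter> K' = {}"
    proof (rule ccontr)
      assume "K \<inter> K' \<noteq> {}"
      then obtain y where "(p, y) \<in> C\<^sup>*" "(z, y) \<in> C\<^sup>*" by (auto simp: K_def K'_def)
      then have "(p, z) \<in> C\<^sup>*" using sym[of z y] by (meson rtrancl_trans)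
      then show False using z by (simp add: K_def)
    qed
    have uniq: "x = y" if x: "x \<in> K'" "x \<in> ?W" and y: "y \<in> K'" "y \<in> ?W" for x y
    proof (rule ccontr)
      assume ne: "x \<noteq> y"
      obtain Z where Z: "x \<in> Z" "y \<notin> Z" "card (out_cut E Z) \<le> k" using tight x y ne by blast
      have "(x, y) \<in> C\<^sup>*"
        using x y sym[of z x] by (auto simp: K'_def intro: rtrancl_trans)
      then obtain a b where ab: "(a, b) \<in> out_cut C Z" "a \<in> K'"
      proof -
        assume a: "\<And>a b. (a, b) \<in> out_cut C Z \<Longrightarrow> a \<in> K' \<Longrightarrow> thesis"
        obtain a b where "(a, b) \<in> out_cut C (Z \<inter> K')"
          using rtrancl_crosses[OF \<open>(x, y) \<in> C\<^sup>*\<close>, of "Z \<inter> K'"] Z x by auto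
        then show thesis using K'1[of a b] by (intro a[of a b]) (auto simp: out_cut_def)
      qed
      then have "(p \<in> Z) \<noteq> (q \<in> Z)" using tC[OF x(2) y(2) Z] by blast
      then obtain c d where cd: "(c, d) \<in> out_cut C Z" "c \<in> K"
        using crossK[OF pK qK, of Z] crossK[OF qK pK, of Z] by blast
      then have "2 \<le> card (out_cut C Z)" using two_arcs[OF ab(1) cd(1) _ finC] ab KK' by blast
      then show False using tC[OF x(2) y(2) Z] by simp
    qed
    have K'W: "K' \<inter> ?W \<noteq> {}"
    proof
      assume e: "K' \<inter> ?W = {}"
      then have "out_cut E K' \<subseteq> out_cut C K'" by (auto simp: out_cut_def C_def Field_def)
      moreover have "out_cut C K' = {}" using K'1 by (auto simp: out_cut_def)
      ultimately have "out_cut E K' = {}" by simp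
      then show False using crit_sep_cut_ge[OF E k1, of K'] zK' z pqW GV e k1 by auto
    qed
    then obtain w where w: "w \<in> K'" "w \<in> ?W" by blast
    have "K' - {w} = {}"
    proof (rule ccontr)
      assume ne: "K' - {w} \<noteq> {}"
      have K'V: "K' \<subseteq> ?V"
      proof
        fix y assume "y \<in> K'"
        then have "y = z \<or> y \<in> Field C" by (auto simp: K'_def dest: rtrancl_in_Field)
        then show "y \<in> ?V" using z mono_Field[of C E] by (auto simp: C_def)
      qed
      show False
      proof (rule crit_sep_no_cutvertex[OF E, of "K' - {w}" w])
        show "(K' - {w}) \<inter> ?V \<noteq> {}" using ne K'V by auto
        show "?V - (K' - {w}) - {w} \<noteq> {}" using pK KK' KV w by auto
        have nW: "x \<notin> ?W" if "x \<in> K' - {w}" for x using uniq w that by blast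
        have nC1: "(x, y) \<in> C" if "(x, y) \<in> E" "x \<in> K'" "x \<noteq> w" for x y
          using nW[of x] that by (auto simp: C_def Field_def)
        have nC2: "(y, x) \<in> C" if "(y, x) \<in> E" "x \<in> K'" "x \<noteq> w" for x y
          using nW[of x] that by (auto simp: C_def Field_def)
        show "out_cut E (K' - {w}) \<subseteq> (K' - {w}) \<times> {w}"
          using K'1 nC1 by (auto simp: out_cut_def)
        show "out_cut E (- (K' - {w})) \<subseteq> {w} \<times> (K' - {w})"
          using K'2 nC2 by (auto simp: out_cut_def)
      qed simp
    qed
    then have "K' = {z}" "z = w" using zK' w by auto
    then show ?thesis using w by (simp add: K'_def)
  qed
  define S' where "S' = K \<inter> ?W"
  have S'W: "S' \<subseteq> ?W" "p \<in> S'" "q \<in> S'" using pK qK pqW by (auto simp: S'_def)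
  obtain p0 where p0: "p0 \<in> ?V" "p0 \<notin> ?W" using GV by blast
  then have p0K: "p0 \<in> K" using outside by blast
  \<comment> \<open>If \<open>a\<close> and \<open>b\<close> are the only vertices of
    \<open>G\<close> in \<open>K\<close>, then \<open>Z\<close> cuts \<open>K\<close> along at most
    one arc each way. The half that contains \<open>p0\<close>, without \<open>a\<close>, has no
    vertex of \<open>G\<close>, so all its arcs lie in \<open>C\<close> and \<open>a\<close> splits
    it off.\<close>
  have dec: False if ab: "a \<in> Z" "b \<notin> Z" "S' = {a, b}" "card (out_cut C Z) \<le> 1" "card (out_cut C (- Z)) \<le> 1" "p0 \<in> Z"
    for a b Z
  proof -
    let ?A = "K \<inter> Z - {a}"
    have aW: "a \<in> K" "a \<in> ?W" "b \<in> K" "b \<in> ?W" using ab by (auto simp: S'_def)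
    have nW: "x \<notin> ?W" if "x \<in> ?A" for x using that ab by (auto simp: S'_def)
    have nC1: "(x, y) \<in> C" if "(x, y) \<in> E" "x \<in> ?A" for x y
      using nW[of x] that by (auto simp: C_def Field_def)
    have nC2: "(y, x) \<in> C" if "(y, x) \<in> E" "x \<in> ?A" for x y
      using nW[of x] that by (auto simp: C_def Field_def)
    have "splits E a ?A (?V - K \<inter> Z)"
      unfolding splits_def
    proof (intro conjI)
      show "?A \<noteq> {}" using p0 p0K ab aW by auto
      show "?V - K \<inter> Z \<noteq> {}" using aW ab KV by auto
      have "E \<inter> ?A \<times> (?V - K \<inter> Z) \<subseteq> out_cut C Z"
        using K1 nC1 by (auto simp: out_cut_def)
      then show "card (E \<inter> ?A \<times> (?V - K \<inter> Z)) \<le> 1"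
        using ab card_mono[OF finite_cut[OF finC]] le_trans by blast
      have "E \<inter> (?V - K \<inter> Z) \<times> ?A \<subseteq> out_cut C (- Z)"
        using K2 nC2 by (auto simp: out_cut_def)
      then show "card (E \<inter> (?V - K \<inter> Z) \<times> ?A) \<le> 1"
        using ab card_mono[OF finite_cut[OF finC]] le_trans by blast
      show "?A \<union> (?V - K \<inter> Z) \<union> {a} = ?V" using KV aW by auto
    qed (use ab aW in auto)
    then show False using nd by (auto simp: decomposable_def)
  qed
  have "S' \<noteq> {p, q}"
  proof
    assume s: "S' = {p, q}"
    obtain Z where Z: "p \<in> Z" "q \<notin> Z" "card (out_cut E Z) \<le> k" using tight pqW pq by blast
    show False
    proof (cases "p0 \<in> Z")
      case True
      then show False using dec[of p Z q] Z s tC[OF pqW Z] by auto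
    next
      case False
      then show False using dec[of q "- Z" p] Z s tC[OF pqW Z] by (auto simp: insert_commute)
    qed
  qed
  then obtain w where w: "w \<in> S'" "w \<noteq> p" "w \<noteq> q" using S'W by blast
  define C' where "C' = F - F'"
  let ?D = "(C' \<union> C'\<inverse>)\<^sup>*"
  have FC': "F = F' \<union> C'" using F'F by (auto simp: C'_def)
  have C'C: "C' \<subseteq> C" using FE CF' by (auto simp: C'_def)
  \<comment> \<open>A tight set between two vertices of \<open>G\<close> in one component of
    \<open>F - F'\<close> would be crossed by an arc of \<open>F - F'\<close> and, as it then
    separates \<open>p\<close> from \<open>q\<close>, also by arcs of \<open>E - F\<close> in both
    directions.\<close>
  have uniqW: "x = y" if xy: "x \<in> ?W" "y \<in> ?W" "(x, y) \<in> ?D" for x y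
  proof (rule ccontr)
    assume ne: "x \<noteq> y"
    obtain Z where Z: "x \<in> Z" "y \<notin> Z" "card (out_cut E Z) \<le> k" using tight xy ne by blast
    obtain a b where ab: "(a, b) \<in> C' \<union> C'\<inverse>" "a \<in> Z" "b \<notin> Z"
      using rtrancl_crosses[OF xy(3), of Z] Z by (auto simp: out_cut_def)
    then have "out_cut C Z \<noteq> {} \<or> out_cut C (- Z) \<noteq> {}" using C'C by (auto simp: out_cut_def)
    then have "(p \<in> Z) \<noteq> (q \<in> Z)" using tC[OF xy(1,2) Z] by blast
    then have "out_cut (E - F) Z \<noteq> {}" "out_cut (E - F) (- Z) \<noteq> {}"
      using rtrancl_crosses[OF paths(1), of Z] rtrancl_crosses[OF paths(1), of "- Z"]
       rtrancl_crosses[OF paths(2), of Z] rtrancl_crosses[OF paths(2), of "- Z"] by auto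
    then obtain e1 e2 where e: "e1 \<in> out_cut (E - F) Z" "e2 \<in> out_cut (E - F) (- Z)" by auto
    then have eC: "e1 \<in> out_cut C Z" "e2 \<in> out_cut C (- Z)" using EFC by (auto simp: out_cut_def)
    have "e1 \<notin> C'" "e2 \<notin> C'" using e by (auto simp: out_cut_def C'_def)
    then have "2 \<le> card (out_cut C Z) \<or> 2 \<le> card (out_cut C (- Z))"
      using ab two_arcs[OF eC(1) _ _ finC, of "(a, b)"] two_arcs[OF eC(2) _ _ finC, of "(b, a)"] C'C
      by (auto simp: out_cut_def)
    then show False using tC[OF xy(1,2) Z] by auto
  qed
  have const: "f w = f p" if f: "kcol k F' f" and wS: "w \<in> S'" for f w
  proof (cases "w = p")
    case True then show ?thesis by simp
  next
    case wp: False
    have "F \<subset> E" using FE forcingD(3)[OF FS] by blast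
    then have "colourable k C'" using colourable_mono[OF crit_sepD(4)[OF E]] by (auto simp: C'_def)
    then obtain g where g: "kcol k C' g" by (auto simp: colourable_def)
    obtain h where h: "kcol k F h" "\<And>w. w \<in> ?W \<Longrightarrow> h w = f w"
      using extend_colouring[OF FW f g uniqW] FC' by blast
    \<comment> \<open>Go back from \<open>z\<close> along the walk to the head of its last arc
      outside \<open>F\<close>, or to \<open>p\<close> if there is none: that vertex lies in
      \<open>S\<close>, and from there on only arcs of \<open>C'\<close> are used.\<close>
    have inv: "z \<in> Field F \<Longrightarrow> \<exists>s\<in>S. (s, z) \<in> ?D" if "(p, z) \<in> C\<^sup>*" for z
      using that
    proof (induction rule: rtrancl_induct)
      case base
      then show ?case using p by blast
    next
      case (step y z)
      show ?case
      proof (cases "(y, z) \<in> F")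
        case True
        then have "(y, z) \<in> C'" "y \<in> Field F" using step.hyps CF' by (auto simp: C'_def Field_def)
        then show ?thesis using step.IH by (meson UnI1 rtrancl.rtrancl_into_rtrancl)
      next
        case False
        then have "(y, z) \<in> E - F" using step.hyps by (auto simp: C_def)
        then have "z \<in> S" using forcingD(5)[OF FS] step.prems by blast
        then show ?thesis by blast
      qed
    qed
    have wW: "w \<in> K" "w \<in> ?W" using wS by (auto simp: S'_def)
    obtain s where s: "s \<in> S" "(s, w) \<in> ?D"
    proof (cases "w \<in> Field F")
      case True then show ?thesis using that inv wW by (auto simp: K_def)
    next
      case False
      then have "w \<in> S" using wW mono_Field[OF G(1)] FH by blast
      then show ?thesis using that by blast
    qed
    have symD: "(a, b) \<in> ?D \<Longrightarrow> (b, a) \<in> ?D" for a b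
      by (metis converse_Un converse_converse rtrancl_converseI sup_commute)
    have hs: "h s = h p" using forcing_constant[OF FS h(1) s(1) p] .
    show ?thesis
    proof (rule ccontr)
      assume "f w \<noteq> f p"
      then have ne: "h w \<noteq> h s" using h(2) wW pqW hs by simp
      \<comment> \<open>Exchanging the colour of \<open>s\<close> with a third colour on the
        component of \<open>w\<close> in \<open>C'\<close> changes \<open>s\<close>, but neither
        \<open>w\<close> nor any other vertex of \<open>G\<close>. The result still colours
        \<open>F\<close>, yet \<open>s\<close> and \<open>p\<close> now differ, against the rigidity
        of \<open>S\<close>.\<close>
      obtain c where c: "c < k" "c \<noteq> h w" "c \<noteq> h s" using third_colour[OF k] by blast
      let ?Q = "{z. (w, z) \<in> ?D}"
      let ?h = "\<lambda>z. if z \<in> ?Q then transpose (h s) c (h z) else h z"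
      have Qc: "a \<in> ?Q \<longleftrightarrow> b \<in> ?Q" if "(a, b) \<in> C'" for a b
      proof -
        have "(a, b) \<in> ?D" "(b, a) \<in> ?D" using that by auto
        then show ?thesis by (auto intro: rtrancl_trans)
      qed
      have "?h a = ?h b \<longleftrightarrow> h a = h b" if "(a, b) \<in> C'" for a b
        using Qc[OF that] by (cases "a \<in> ?Q") (simp_all add: inj_eq[OF inj_transpose])
      then have "mono_arcs C' ?h = mono_arcs C' h"
        unfolding mono_arcs_def by blast
      then have aC: "acyclic (mono_arcs C' ?h)" using kcol_mono[OF h(1), of C'] FC' by (simp add: kcol_def)
      have hW: "?h v = h v" if "v \<in> ?W" for v
        using uniqW[OF wW(2) that] ne c by (auto simp: transpose_def)
      have "mono_arcs F' ?h = mono_arcs F' h"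
        by (rule mono_arcs_cong, rule hW) (use FW in blast)
      moreover have "\<forall>v. ?h v < k" using h(1) c by (auto simp: kcol_def transpose_less)
      ultimately have "kcol k F' ?h" using kcol_mono[OF h(1) F'F] by (simp add: kcol_def)
      then have "kcol k F ?h" using kcol_glue[OF FW _ aC uniqW] FC' by simp
      then have "?h s = ?h p" using forcing_constant[OF FS _ s(1) p] by blast
      moreover have "?h s = c" using symD[OF s(2)] by simp
      moreover have "?h p = h p" using uniqW[OF wW(2) pqW(1)] wp by auto
      ultimately show False using c hs by simp
    qed
  qed
  have "forcing k E F' S'"
    unfolding forcing_def CF'
  proof (intro conjI allI impI ballI)
    show "F' \<subseteq> E" by (simp add: F'_def)
    show "S' \<subseteq> ?V" using S'W GV by blast
    show "\<not> ?V \<subseteq> Field F' \<union> S'" using S'W FW p0 by blast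
    show "x \<in> S'" if "(x, y) \<in> C" "x \<in> Field F'" for x y
    proof -
      have "x \<in> K"
      proof (rule ccontr)
        assume "x \<notin> K"
        then have "{y. (x, y) \<in> C\<^sup>*} = {x}" using outside[of x] FW GV that by blast
        then have "y = x" using that by blast
        then show False using that irr by (auto simp: C_def)
      qed
      then show ?thesis using FW that by (auto simp: S'_def)
    qed
    show "y \<in> S'" if "(x, y) \<in> C" "y \<in> Field F'" for x y
    proof -
      have "y \<in> K"
      proof (rule ccontr)
        assume "y \<notin> K"
        then have "{x. (y, x) \<in> C\<^sup>*} = {y}" using outside[of y] FW GV that by blast
        moreover have "(y, x) \<in> C\<^sup>*" using sym[of x y] that by auto
        ultimately have "x \<in> {y}" by blast
        then have "y = x" by simp
        then show False using that irr by (auto simp: C_def)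
      qed
      then show ?thesis using FW that by (auto simp: S'_def)
    qed
    show "(s, s') \<in> C\<^sup>*" if "s \<in> S'" "s' \<in> S'" for s s'
      using that conK by (auto simp: S'_def)
    have "f s = f s'" if "kcol k F' f" "s \<in> S'" "s' \<in> S'" for f s s'
      using const[OF that(1,2)] const[OF that(1,3)] by simp
    then show "rigid k F' S'" unfolding rigid_def by auto
  qed
  then show ?thesis using that[of F' S' w] F'F N1 N2 G(2) S'W w unfolding GF' by blast
qed

text \<open>Two rounds of \<open>forcing_step\<close> sharing the vertex \<open>p\<close> make
  \<open>F\<close> strictly smaller, so an indecomposable \<open>E\<close> would allow infinite
  descent. A single round is only known not to enlarge \<open>F\<close>.\<close>

lemma forcing_decomposable:
  assumes E: "crit_sep k E" and k: "3 \<le> k"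
    and FS: "forcing k E F S" and p: "p \<in> S" and q: "q \<in> S" and pq: "p \<noteq> q"
  shows "decomposable E"
proof (rule ccontr)
  assume nd: "\<not> decomposable E"
  have k1: "1 \<le> k" using k by simp
  note finE = crit_sepD(1)[OF E]
  show False
    using FS p q pq
  proof (induction "card F" arbitrary: F S p q rule: less_induct)
    case less
    obtain F1 S1 w where 1: "F1 \<subseteq> F" "(p, q) \<notin> E" "(q, p) \<notin> E" "crit_sep k (F1 \<union> {(p, q), (q, p)})"
      "forcing k E F1 S1" "S1 \<subseteq> Field (F1 \<union> {(p, q), (q, p)})" "p \<in> S1" "q \<in> S1"
      "w \<in> S1" "w \<noteq> p" "w \<noteq> q"
      using forcing_step[OF E k nd less.prems] by blast
    obtain F2 S2 where 2: "F2 \<subseteq> F1" "crit_sep k (F2 \<union> {(p, w), (w, p)})"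
      "forcing k E F2 S2" "p \<in> S2" "w \<in> S2"
      using forcing_step[OF E k nd 1(5,7,9)] 1(10) by metis
    have finF: "finite F" using forcingD(1)[OF less.prems(1)] finE finite_subset by blast
    \<comment> \<open>Otherwise \<open>F1\<close> becomes critical both with the digon on
      \<open>p\<close>, \<open>q\<close> and with the digon on \<open>p\<close>, \<open>w\<close>. A
      tight set containing \<open>q\<close> but not \<open>w\<close> is crossed by
      \<open>E - F1\<close>, so the first digon must cross it too, which puts \<open>p\<close>
      outside. The second digon then misses the set and leaves it with fewer than \<open>k\<close>
      arcs.\<close>
    have "F2 \<noteq> F1"
    proof
      assume e: "F2 = F1"
      let ?G = "F1 \<union> {(p, q), (q, p)}"
      let ?G2 = "F1 \<union> {(p, w), (w, p)}"
      note F1E = forcingD(1)[OF 1(5)]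
      have wV: "w \<in> Field E" "q \<in> Field E" using forcingD(2)[OF 1(5)] 1 by auto
      obtain Z where Z: "q \<in> Z" "w \<notin> Z" "card (out_cut E Z) \<le> k"
        using crit_sepD(5)[OF E wV(2,1)] 1(11) by blast
      have GN: "?G - E = {(p, q), (q, p)}" "E - ?G = E - F1" using 1(2,3) F1E by auto
      have ne: "out_cut (E - F1) Z \<noteq> {}"
        using rtrancl_crosses[OF forcingD(6)[OF 1(5) 1(8,9)], of Z] Z by blast
      have pos: "0 < card (out_cut (E - F1) Z)"
        using ne finE by (simp add: card_gt_0_iff finite_cut)
      have "card (out_cut (E - ?G) Z) \<le> card (out_cut (?G - E) Z)"
        using card_cut_tight_diff(1)[OF E 1(4) k1 _ _ Z] 1 by blast
      then have "out_cut (?G - E) Z \<noteq> {}" using pos GN by (metis card.empty le_zero_eq less_numeral_extra(3))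
      then have pZ: "p \<notin> Z" using Z GN by (auto simp: out_cut_def)
      have "out_cut ?G2 Z = out_cut (E \<inter> F1) Z" using pZ Z F1E by (auto simp: out_cut_def)
      then have "card (out_cut ?G2 Z) < k"
        using card_cut_split[OF finE, of Z F1] pos Z by simp
      moreover have "q \<in> Field F1"
      proof (rule ccontr)
        assume "q \<notin> Field F1"
        then have "out_cut ?G {q} \<subseteq> {(q, p)}" by (auto simp: out_cut_def Field_def)
        then have "card (out_cut ?G {q}) \<le> 1" using card_mono[of "{(q, p)}"] by simp
        moreover have "k \<le> card (out_cut ?G {q})"
        proof (rule crit_sep_cut_ge[OF 1(4) k1])
          show "{q} \<inter> Field ?G \<noteq> {}" "Field ?G - {q} \<noteq> {}" using less.prems(4) by (auto simp: Field_def)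
        qed
        ultimately show False using k by simp
      qed
      then have "q \<in> Field ?G2" "w \<in> Field ?G2" by (auto simp: Field_def)
      then have "k \<le> card (out_cut ?G2 Z)"
        using Z 2(2) e by (intro crit_sep_cut_ge[OF _ k1]) auto
      ultimately show False by simp
    qed
    then have "F2 \<subset> F" using 2(1) 1(1) by blast
    then have "card F2 < card F" by (rule psubset_card_mono[OF finF])
    then show False using less.hyps[OF _ 2(3-5)] 1(10) by blast
  qed
qed

section \<open>Tight sets with at least two vertices on each side\<close>

definition boundary :: "'a rel \<Rightarrow> 'a set \<Rightarrow> 'a set" where
  "boundary E X = {x \<in> X. \<exists>y. y \<notin> X \<and> ((x, y) \<in> E \<or> (y, x) \<in> E)}"

lemma boundary_iff: "x \<in> boundary E X \<longleftrightarrow> (\<exists>y. (x, y) \<in> out_cut E X \<or> (y, x) \<in> out_cut E (- X))"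
  by (auto simp: boundary_def out_cut_def)

lemma crit_sep_colourings:
  assumes E: "crit_sep k E" and X: "X \<inter> Field E \<noteq> {}" "Field E - X \<noteq> {}"
  obtains f g where "kcol k (induced E X) f" "kcol k (induced E (- X)) g"
proof -
  have "induced E X \<subset> E" "induced E (- X) \<subset> E" using X by (auto simp: induced_def Field_def)
  then show ?thesis using that crit_sepD(4)[OF E] unfolding colourable_def by metis
qed

text \<open>In every pair of colourings one is constant on its boundary. Two nonconstant colourings,
  chosen independently on the two sides, would form a counterexample, so one side is constant for
  all its colourings.\<close>

lemma tight_side_rigid:
  assumes E: "crit_sep k E" and k: "1 \<le> k" and c: "card (out_cut E X) \<le> k"
    and X: "X \<inter> Field E \<noteq> {}" "Field E - X \<noteq> {}"
  shows "rigid k (induced E X) (boundary E X) \<or> rigid k (induced E (- X)) (boundary E (- X))"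
proof (rule ccontr)
  assume n: "\<not> ?thesis"
  obtain f a b where f: "kcol k (induced E X) f" "a \<in> boundary E X" "b \<in> boundary E X" "f a \<noteq> f b"
    using n unfolding rigid_def by auto
  obtain g p q where g: "kcol k (induced E (- X)) g" "p \<in> boundary E (- X)" "q \<in> boundary E (- X)" "g p \<noteq> g q"
    using n unfolding rigid_def by auto
  have c': "card (out_cut E (- X)) \<le> k" using c crit_sep_balanced[OF E k] by simp
  from tight_cut_colouring[OF crit_sepD(1)[OF E] k crit_sepD(3)[OF E] f(1) g(1) c c']
  show False
  proof (elim disjE exE conjE)
    fix i assume "\<forall>(x, y)\<in>out_cut E X. f x = i" "\<forall>(y, x)\<in>out_cut E (- X). f x = i"
    then have "f a = i" "f b = i" using f(2,3) unfolding boundary_iff by blast+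
    then show False using f(4) by simp
  next
    fix j assume "\<forall>(x, y)\<in>out_cut E X. g y = j" "\<forall>(y, x)\<in>out_cut E (- X). g y = j"
    then have "g p = j" "g q = j" using g(2,3) unfolding boundary_iff by auto
    then show False using g(4) by simp
  qed
qed

text \<open>The set reached from \<open>y\<close> outside \<open>X\<close> can be left only along
  arcs into \<open>X\<close>. There are at most \<open>k\<close> of these and at least
  \<open>k\<close> are needed, so all of them start in that set, including the one to
  \<open>h\<close>.\<close>

lemma tight_path:
  assumes E: "crit_sep k E" and k: "1 \<le> k" and c: "card (out_cut E X) \<le> k"
    and ty: "(t, y) \<in> out_cut E X" and yh: "(y', h) \<in> out_cut E (- X)"
  shows "(t, h) \<in> (E - induced E X)\<^sup>*"
proof -
  define Z where "Z = {z. (y, z) \<in> (induced E (- X))\<^sup>*}"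
  have ZX: "Z \<inter> X = {}"
  proof -
    have "z \<notin> X" if "(y, z) \<in> (induced E (- X))\<^sup>*" for z
      using that by (induction rule: rtrancl_induct) (use ty in \<open>auto simp: out_cut_def induced_def\<close>)
    then show ?thesis by (auto simp: Z_def)
  qed
  have "out_cut E Z \<subseteq> out_cut E (- X)"
  proof
    fix e assume "e \<in> out_cut E Z"
    then obtain a b where ab: "e = (a, b)" "(a, b) \<in> E" "a \<in> Z" "b \<notin> Z" by (auto simp: out_cut_def)
    have "b \<in> X"
    proof (rule ccontr)
      assume "b \<notin> X"
      then have "(a, b) \<in> induced E (- X)" using ab ZX by (auto simp: induced_def)
      then show False using ab by (auto simp: Z_def intro: rtrancl_into_rtrancl)
    qed
    then show "e \<in> out_cut E (- X)" using ab ZX by (auto simp: out_cut_def)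
  qed
  moreover have "k \<le> card (out_cut E Z)"
  proof (rule crit_sep_cut_ge[OF E k])
    show "Z \<inter> Field E \<noteq> {}" using ty by (auto simp: Z_def out_cut_def Field_def)
    show "Field E - Z \<noteq> {}" using ty ZX by (auto simp: out_cut_def Field_def)
  qed
  moreover have "card (out_cut E (- X)) \<le> k" using c crit_sep_balanced[OF E k] by simp
  ultimately have "out_cut E Z = out_cut E (- X)"
    by (meson card_seteq finite_cut le_trans crit_sepD(1)[OF E])
  then have "y' \<in> Z" using yh by (auto simp: out_cut_def)
  then have "(y, y') \<in> (induced E (- X))\<^sup>*" by (simp add: Z_def)
  then have "(y, y') \<in> (E - induced E X)\<^sup>*"
    by (rule rtrancl_mono[THEN subsetD, rotated]) (auto simp: induced_def)
  moreover have "(t, y) \<in> E - induced E X" "(y', h) \<in> E - induced E X"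
    using ty yh by (auto simp: induced_def out_cut_def)
  ultimately show ?thesis
    by (meson converse_rtrancl_into_rtrancl rtrancl.rtrancl_into_rtrancl)
qed

lemma acyclic_single: "a \<noteq> b \<Longrightarrow> acyclic {(a, b)}"
  by (auto simp: acyclic_def dest!: tranclD elim: converse_rtranclE)

text \<open>Permute the outer colours so that \<open>g y\<close> becomes the common boundary colour
  of \<open>X\<close>. By injectivity the only crossing arcs that can be monochromatic are
  \<open>(t, y)\<close> and \<open>(y', h)\<close>, so the outside acts on \<open>X\<close> at worst
  like one arc from \<open>t\<close> to \<open>h\<close>. Hence \<open>X\<close> together with that
  arc is not colourable, and \<open>decomposable_one_arc\<close> applies to its critical
  part.\<close>

lemma one_arc_case:
  assumes E: "crit_sep k E" and k: "2 \<le> k" and c: "card (out_cut E X) \<le> k"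
    and rig: "rigid k (induced E X) (boundary E X)" and g: "kcol k (induced E (- X)) g"
    and out: "inj_on (\<lambda>(x, y). g y) (out_cut E X)" and inn: "inj_on (\<lambda>(y, x). g y) (out_cut E (- X))"
    and ty: "(t, y) \<in> out_cut E X" and yh: "(y', h) \<in> out_cut E (- X)" and gy: "g y = g y'" and th: "t \<noteq> h"
  shows "decomposable E"
proof -
  have k1: "1 \<le> k" using k by simp
  let ?F = "induced E X"
  define H where "H = ?F \<union> {(t, h)}"
  note finE = crit_sepD(1)[OF E]
  have FE: "?F \<subseteq> E" by (auto simp: induced_def)
  have thX: "t \<in> X" "h \<in> X" "y \<notin> X" "y' \<notin> X" using ty yh by (auto simp: out_cut_def)
  have thb: "t \<in> boundary E X" "h \<in> boundary E X" using ty yh by (auto simp: boundary_iff)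
  have "\<not> colourable k H"
  proof
    assume "colourable k H"
    then obtain f where f: "kcol k H f" by (auto simp: colourable_def)
    have fF: "kcol k ?F f" by (rule kcol_mono[OF f]) (auto simp: H_def)
    define i where "i = f t"
    have fi: "f x = i" if "x \<in> boundary E X" for x
      using rigidD[OF rig fF that thb(1)] by (simp add: i_def)
    let ?p = "transpose (g y) i"
    define c where "c v = (if v \<in> X then f v else ?p (g v))" for v
    have lt: "g v < k" "f v < k" for v using f g by (auto simp: kcol_def)
    have ck: "\<forall>v. c v < k" using lt by (auto simp: c_def i_def transpose_less)
    have pi: "?p j = i \<longleftrightarrow> j = g y" for j by (auto simp: transpose_def)
    let ?R = "mono_arcs ?F c"
    let ?S = "mono_arcs (E - ?F) c"
    let ?S1 = "mono_arcs (induced E (- X)) c"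
    have RX: "Field ?R \<subseteq> X" by (rule Field_mono_ind)
    have Rf: "?R = mono_arcs ?F f" by (rule mono_arcs_cong) (auto simp: c_def induced_def Field_def)
    have S1g: "?S1 = mono_arcs (induced E (- X)) g"
      by (auto simp: mono_arcs_def induced_def c_def inj_eq[OF inj_transpose])
    have outS: "(a, b) = (t, y)" if "(a, b) \<in> ?S" "a \<in> X" for a b
    proof -
      have ab: "(a, b) \<in> out_cut E X" "c a = c b" using that by (auto simp: mono_arcs_def out_cut_def induced_def)
      then have "f a = i" using fi by (auto simp: boundary_iff)
      then have "?p (g b) = i" using ab by (auto simp: c_def out_cut_def)
      then have "g b = g y" using pi by blast
      then show ?thesis using inj_onD[OF out, of "(a, b)" "(t, y)"] ab ty by simp
    qed
    have inS: "(a, b) = (y', h)" if "(a, b) \<in> ?S" "b \<in> X" for a b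
    proof -
      have ab: "(a, b) \<in> out_cut E (- X)" "c a = c b" using that by (auto simp: mono_arcs_def out_cut_def induced_def)
      then have "f b = i" using fi by (auto simp: boundary_iff)
      then have "?p (g a) = i" using ab by (auto simp: c_def out_cut_def)
      then have "g a = g y" using pi by blast
      then show ?thesis using inj_onD[OF inn, of "(a, b)" "(y', h)"] ab yh gy by simp
    qed
    have "?S \<subseteq> ?S1 \<union> {(t, y), (y', h)}"
    proof
      fix e assume e: "e \<in> ?S"
      obtain a b where ab: "e = (a, b)" by force
      show "e \<in> ?S1 \<union> {(t, y), (y', h)}"
        using outS[of a b] inS[of a b] e ab by (auto simp: mono_arcs_def induced_def)
    qed
    moreover have "acyclic (?S1 \<union> ({(t, y)} \<union> {(y', h)}))"
    proof (rule acyclic_glue_disjoint)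
      show "acyclic ?S1" using S1g g by (simp add: kcol_def)
      have tr: "(a, b) \<in> {(p, q)}\<^sup>+ \<Longrightarrow> a = p \<and> b = q" for a b p q :: 'a
        by (auto dest: tranclD tranclD2)
      show "acyclic ({(t, y)} \<union> {(y', h)})"
      proof (rule acyclic_glue_disjoint)
        fix p q assume "p \<in> Field {(t, y)}" "q \<in> Field {(t, y)}" "(p, q) \<in> {(y', h)}\<^sup>+"
        then show False using tr[of p q y' h] th thX by (auto simp: Field_def)
      qed (rule acyclic_single, use thX in blast)+
      fix p q assume pq: "p \<in> Field ?S1" "q \<in> Field ?S1" "(p, q) \<in> ({(t, y)} \<union> {(y', h)})\<^sup>+"
      then have nX: "p \<notin> X" "q \<notin> X" using Field_mono_ind[of E "- X" c] by auto
      obtain z where z: "(p, z) \<in> {(t, y)} \<union> {(y', h)}" "(z, q) \<in> ({(t, y)} \<union> {(y', h)})\<^sup>*"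
        using tranclD[OF pq(3)] by blast
      then have "z = h" using nX thX by auto
      have "(h, q) \<in> ({(t, y)} \<union> {(y', h)})\<^sup>*" using z(2) \<open>z = h\<close> by simp
      then show False
      proof (cases rule: converse_rtranclE)
        case base
        then show False using nX thX by simp
      next
        case (step u)
        then show False using thX th by auto
      qed
    qed
    ultimately have aS: "acyclic ?S" using acyclic_subset by (metis Un_insert_left sup_bot_left)
    have "?S\<^sup>+ \<inter> Field ?R \<times> Field ?R \<subseteq> {(t, h)}"
    proof
      fix e assume e: "e \<in> ?S\<^sup>+ \<inter> Field ?R \<times> Field ?R"
      obtain a b where ab: "e = (a, b)" by force
      then have ab': "(a, b) \<in> ?S\<^sup>+" "a \<in> X" "b \<in> X" using e RX by auto
      obtain z where "(a, z) \<in> ?S" using tranclD[OF ab'(1)] by blast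
      then have "a = t" using outS ab' by blast
      moreover obtain z where "(z, b) \<in> ?S" using tranclD2[OF ab'(1)] by blast
      then have "b = h" using inS ab' by blast
      ultimately show "e \<in> {(t, h)}" using ab by simp
    qed
    moreover have "f t = f h" using fi thb by simp
    ultimately have sub: "?R \<union> (?S\<^sup>+ \<inter> Field ?R \<times> Field ?R) \<subseteq> mono_arcs H f"
      unfolding Rf by (auto simp: mono_arcs_def H_def)
    have "acyclic (mono_arcs H f)" using f by (simp add: kcol_def)
    from acyclic_subset[OF this sub] have "acyclic (?R \<union> (?S\<^sup>+ \<inter> Field ?R \<times> Field ?R))" .
    from acyclic_glue[OF aS this] have "acyclic (mono_arcs (?F \<union> (E - ?F)) c)"
      by (simp only: mono_arcs_Un)
    moreover have "?F \<union> (E - ?F) = E" using FE by auto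
    ultimately have "colourable k E" using ck colourableI by metis
    then show False using crit_sepD(3)[OF E] by simp
  qed
  moreover have "finite H" using finE FE by (auto simp: H_def intro: finite_subset)
  moreover have "(x, x) \<notin> H" for x using crit_sepD(2)[OF E] FE th by (auto simp: H_def)
  moreover have FH: "Field H \<subseteq> X \<inter> Field E"
    using ty yh by (auto simp: H_def induced_def out_cut_def Field_def)
  moreover have "\<exists>Z. u \<in> Z \<and> v \<notin> Z \<and> card (out_cut H Z) \<le> k"
    if uv: "u \<in> Field H" "v \<in> Field H" "u \<noteq> v" for u v
  proof -
    obtain Z where "u \<in> Z" "v \<notin> Z" "card (out_cut E Z) \<le> k" using crit_sepD(5)[OF E _ _ uv(3)] uv FH by blast
    moreover have "card (out_cut H Z) \<le> card (out_cut E Z)"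
    proof (rule card_cut_replace[OF finE FE, of H t h t])
      show "(t, h) \<in> (E - ?F)\<^sup>*" by (rule tight_path[OF E k1 c ty yh])
      show "(h, t) \<in> H - ?F \<Longrightarrow> (h, t) \<in> (E - ?F)\<^sup>*" using th by (simp add: H_def)
    qed (auto simp: H_def)
    ultimately show ?thesis by (meson le_trans)
  qed
  ultimately obtain G where G: "G \<subseteq> H" "crit_sep k G" using exists_crit_sep[of H k] by blast
  show ?thesis
  proof (rule decomposable_one_arc[OF E G(2) k])
    have "y \<in> Field E" using ty by (auto simp: out_cut_def Field_def)
    then show "Field G \<subset> Field E" using mono_Field[OF G(1)] FH thX by blast
    show "G - E \<subseteq> {(t, h)}" using G(1) FE by (auto simp: H_def)
  qed
qed

text \<open>The outer ends of the arcs leaving \<open>X\<close>, and those of the arcs entering it,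
  show every colour once, which pairs the arcs of the two cuts. A pair with distinct ends in
  \<open>X\<close> is the one-arc case. If every pair has a common end, each boundary vertex has
  arcs in both directions, so the boundary is tied together from outside and
  \<open>forcing_decomposable\<close> applies, unless it is a single vertex and thus a cut
  vertex.\<close>

lemma rigid_tight_decomposable:
  assumes E: "crit_sep k E" and k: "3 \<le> k" and c: "card (out_cut E X) \<le> k"
    and rig: "rigid k (induced E X) (boundary E X)"
    and x: "x1 \<in> X \<inter> Field E" "x2 \<in> X \<inter> Field E" "x1 \<noteq> x2" and y: "y0 \<in> Field E - X"
  shows "decomposable E"
proof -
  have k1: "1 \<le> k" and k2: "2 \<le> k" using k by auto
  have c': "card (out_cut E (- X)) \<le> k" using c crit_sep_balanced[OF E k1] by simp
  obtain f g where f: "kcol k (induced E X) f" and g: "kcol k (induced E (- X)) g"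
    using crit_sep_colourings[OF E, of X] x y by blast
  have bij: "bij_betw (\<lambda>(x, y). g y) (out_cut E X) {..<k}" "bij_betw (\<lambda>(y, x). g y) (out_cut E (- X)) {..<k}"
  proof -
    from tight_cut_colouring[OF crit_sepD(1)[OF E] k1 crit_sepD(3)[OF E] f g c c']
    have "bij_betw (\<lambda>(x, y). g y) (out_cut E X) {..<k} \<and> bij_betw (\<lambda>(y, x). g y) (out_cut E (- X)) {..<k}"
    proof (elim disjE exE conjE)
      \<comment> \<open>A rigid boundary shows a single colour, whereas here it would show all
        \<open>k\<close>.\<close>
      assume im: "(\<lambda>(x, y). f x) ` out_cut E X = {..<k}"
      have "0 \<in> {..<k}" "1 \<in> {..<k}" using k by auto
      then obtain a b a' b' where "(a, b) \<in> out_cut E X" "f a = 0" "(a', b') \<in> out_cut E X" "f a' = 1"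
        unfolding im[symmetric] by auto
      then have "a \<in> boundary E X" "a' \<in> boundary E X" "f a \<noteq> f a'" by (auto simp: boundary_iff)
      then show ?thesis using rigidD[OF rig f] by blast
    qed blast
    then show "bij_betw (\<lambda>(x, y). g y) (out_cut E X) {..<k}" "bij_betw (\<lambda>(y, x). g y) (out_cut E (- X)) {..<k}"
      by auto
  qed
  show ?thesis
  proof (cases "\<exists>t y y' h. (t, y) \<in> out_cut E X \<and> (y', h) \<in> out_cut E (- X) \<and> g y = g y' \<and> t \<noteq> h")
    case True
    then show ?thesis using one_arc_case[OF E k2 c rig g] bij by (auto simp: bij_betw_def)
  next
    case False
    then have same: "t = h" if "(t, y) \<in> out_cut E X" "(y', h) \<in> out_cut E (- X)" "g y = g y'" for t y y' h
      using that by blast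
    have glt: "g v \<in> {..<k}" for v using g by (auto simp: kcol_def)
    have outn: "\<exists>y. (b, y) \<in> out_cut E X" and inn: "\<exists>y. (y, b) \<in> out_cut E (- X)" if b: "b \<in> boundary E X" for b
    proof -
      from b consider y where "(b, y) \<in> out_cut E X" | y where "(y, b) \<in> out_cut E (- X)"
        by (auto simp: boundary_iff)
      then have "(\<exists>y. (b, y) \<in> out_cut E X) \<and> (\<exists>y. (y, b) \<in> out_cut E (- X))"
      proof cases
        case (1 y)
        have "g y \<in> (\<lambda>(y, x). g y) ` out_cut E (- X)"
          using glt[of y] bij_betw_imp_surj_on[OF bij(2)] by simp
        then obtain y' h where "(y', h) \<in> out_cut E (- X)" "g y' = g y" by auto
        then show ?thesis using same[OF 1, of y' h] 1 by auto
      next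
        case (2 y)
        have "g y \<in> (\<lambda>(x, y). g y) ` out_cut E X"
          using glt[of y] bij_betw_imp_surj_on[OF bij(1)] by simp
        then obtain t y' where "(t, y') \<in> out_cut E X" "g y' = g y" by auto
        then show ?thesis using same[of t y' y b] 2 by auto
      qed
      then show "\<exists>y. (b, y) \<in> out_cut E X" "\<exists>y. (y, b) \<in> out_cut E (- X)" by auto
    qed
    have "forcing k E (induced E X) (boundary E X)"
      unfolding forcing_def
    proof (intro conjI allI impI ballI)
      show "induced E X \<subseteq> E" by (auto simp: induced_def)
      show "boundary E X \<subseteq> Field E" by (auto simp: boundary_def Field_def)
      show "\<not> Field E \<subseteq> Field (induced E X) \<union> boundary E X"
        using y by (auto simp: induced_def boundary_def Field_def)
      show "a \<in> boundary E X" if "(a, b) \<in> E - induced E X" "a \<in> Field (induced E X)" for a b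
        using that by (auto simp: induced_def boundary_def Field_def)
      show "b \<in> boundary E X" if "(a, b) \<in> E - induced E X" "b \<in> Field (induced E X)" for a b
        using that by (auto simp: induced_def boundary_def Field_def)
      show "(s, s') \<in> (E - induced E X)\<^sup>*" if "s \<in> boundary E X" "s' \<in> boundary E X" for s s'
        using outn[OF that(1)] inn[OF that(2)] tight_path[OF E k1 c] by blast
      show "rigid k (induced E X) (boundary E X)" by (rule rig)
    qed
    moreover have "\<exists>p\<in>boundary E X. \<exists>q\<in>boundary E X. p \<noteq> q"
    proof (rule ccontr)
      assume n: "\<not> ?thesis"
      have "out_cut E X \<noteq> {}"
        using crit_sep_cut_ge[OF E k1, of X] x y k by (metis card.empty DiffD1 DiffD2 Diff_eq_empty_iff IntI Int_iff disjoint_iff not_numeral_le_zero order_trans subsetD zero_less_numeral)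
      then obtain b where b: "b \<in> boundary E X" by (auto simp: boundary_iff)
      then have only: "z = b" if "z \<in> boundary E X" for z using n that by blast
      have bX: "b \<in> X" using b by (auto simp: boundary_def)
      show False
      proof (rule crit_sep_no_cutvertex[OF E, of "X - {b}" b])
        show "(X - {b}) \<inter> Field E \<noteq> {}" using x by auto
        show "Field E - (X - {b}) - {b} \<noteq> {}" using y bX by auto
        show "out_cut E (X - {b}) \<subseteq> (X - {b}) \<times> {b}"
        proof
          fix e assume "e \<in> out_cut E (X - {b})"
          then obtain u v where uv: "e = (u, v)" "(u, v) \<in> E" "u \<in> X" "u \<noteq> b" "v \<notin> X - {b}" by (auto simp: out_cut_def)
          have "v \<in> X" using only[of u] uv by (auto simp: boundary_def)
          then show "e \<in> (X - {b}) \<times> {b}" using uv by auto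
        qed
        show "out_cut E (- (X - {b})) \<subseteq> {b} \<times> (X - {b})"
        proof
          fix e assume "e \<in> out_cut E (- (X - {b}))"
          then obtain u v where uv: "e = (u, v)" "(u, v) \<in> E" "v \<in> X" "v \<noteq> b" "u \<notin> X - {b}" by (auto simp: out_cut_def)
          have "u \<in> X" using only[of v] uv by (auto simp: boundary_def)
          then show "e \<in> {b} \<times> (X - {b})" using uv by auto
        qed
      qed simp
    qed
    ultimately show ?thesis using forcing_decomposable[OF E k] by blast
  qed
qed

lemma nontrivial_tight_decomposable:
  assumes E: "crit_sep k E" and k: "3 \<le> k" and c: "card (out_cut E X) \<le> k"
    and x: "x1 \<in> X \<inter> Field E" "x2 \<in> X \<inter> Field E" "x1 \<noteq> x2"
    and y: "y1 \<in> Field E - X" "y2 \<in> Field E - X" "y1 \<noteq> y2"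
  shows "decomposable E"
proof -
  have k1: "1 \<le> k" using k by simp
  have c': "card (out_cut E (- X)) \<le> k" using c crit_sep_balanced[OF E k1] by simp
  have "rigid k (induced E X) (boundary E X) \<or> rigid k (induced E (- X)) (boundary E (- X))"
    using tight_side_rigid[OF E k1 c] x y by blast
  then show ?thesis
  proof
    assume "rigid k (induced E X) (boundary E X)"
    then show ?thesis using rigid_tight_decomposable[OF E k c _ x y(1)] by blast
  next
    assume "rigid k (induced E (- X)) (boundary E (- X))"
    then show ?thesis using rigid_tight_decomposable[OF E k c', of y1 y2 x1] x y by blast
  qed
qed

lemma card_cut_single: "(v, v) \<notin> E \<Longrightarrow> card (out_cut E {v}) = card (E `` {v})"
proof -
  assume "(v, v) \<notin> E"
  then have "out_cut E {v} = Pair v ` (E `` {v})" by (auto simp: out_cut_def)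
  then show ?thesis by (simp add: card_image inj_on_def)
qed

lemma crit_sep_degree_eq: "crit_sep k E \<Longrightarrow> 1 \<le> k \<Longrightarrow> card (E\<inverse> `` {v}) = card (E `` {v})"
  using crit_sep_excess_0[of k E v] by (simp add: excess_def)

text \<open>A tight set between two vertices of degree above \<open>k\<close> is neither a single
  vertex nor the complement of one, because those cuts are too large; so it has two vertices on each
  side.\<close>

lemma at_most_one_high:
  assumes E: "crit_sep k E" and k: "3 \<le> k" and nd: "\<not> decomposable E"
  obtains x where "x \<in> Field E" "\<And>v. v \<in> Field E \<Longrightarrow> v \<noteq> x \<Longrightarrow> card (E `` {v}) = k"
proof -
  have k1: "1 \<le> k" using k by simp
  have ne: "Field E \<noteq> {}"
  proof
    assume "Field E = {}"
    then have "E = {}" by (auto simp: Field_def)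
    then have "colourable k E" using k by (intro colourableI[of _ "\<lambda>_. 0"]) (auto simp: mono_arcs_def acyclic_def)
    then show False using crit_sepD(3)[OF E] by simp
  qed
  have low: "card (E `` {u}) = k \<or> card (E `` {v}) = k" if uv: "u \<in> Field E" "v \<in> Field E" "u \<noteq> v" for u v
  proof (rule ccontr)
    assume n: "\<not> ?thesis"
    have ge: "k \<le> card (E `` {w})" if "w \<in> Field E" for w
    proof -
      have "Field E - {w} \<noteq> {}" using uv by auto
      then show ?thesis using crit_sep_cut_ge[OF E k1, of "{w}"] that card_cut_single[OF crit_sepD(2)[OF E]] by simp
    qed
    have big: "k < card (out_cut E {u})" "k < card (out_cut E {v})"
      using n ge[OF uv(1)] ge[OF uv(2)] card_cut_single[OF crit_sepD(2)[OF E]] by (simp_all add: le_less)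
    obtain Z where Z: "u \<in> Z" "v \<notin> Z" "card (out_cut E Z) \<le> k" using crit_sepD(5)[OF E uv] by blast
    have "\<exists>x. x \<in> Z \<inter> Field E \<and> x \<noteq> u"
    proof (rule ccontr)
      assume "\<not> ?thesis"
      then have "out_cut E Z = out_cut E {u}" using Z by (auto simp: out_cut_def Field_def)
      then show False using big Z by simp
    qed
    moreover have "\<exists>x. x \<in> Field E - Z \<and> x \<noteq> v"
    proof (rule ccontr)
      assume "\<not> ?thesis"
      then have "out_cut E (- Z) = out_cut E {v}" using Z by (auto simp: out_cut_def Field_def)
      then show False using big Z crit_sep_balanced[OF E k1, of Z] by simp
    qed
    ultimately show False
      using nontrivial_tight_decomposable[OF E k Z(3), of u _ v] Z uv nd by blast
  qed
  show ?thesis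
  proof (cases "\<exists>x\<in>Field E. card (E `` {x}) \<noteq> k")
    case True then show ?thesis using that low by blast
  next
    case False then show ?thesis using that ne by blast
  qed
qed

section \<open>At most one vertex of large degree\<close>

lemma mono_arcs_converse: "mono_arcs (E\<inverse>) f = (mono_arcs E f)\<inverse>"
  by (auto simp: mono_arcs_def)

lemma kcol_converse: "kcol k (E\<inverse>) f \<longleftrightarrow> kcol k E f"
  by (simp add: kcol_def mono_arcs_converse)

lemma colourable_converse: "colourable k (E\<inverse>) \<longleftrightarrow> colourable k E"
  by (simp add: colourable_def kcol_converse)

lemma ind_converse: "induced (E\<inverse>) X = (induced E X)\<inverse>"
  by (auto simp: induced_def)

text \<open>A vertex whose colour is absent from its out-neighbours lies on no monochromatic cycle,
  whatever its in-neighbours look like; one free direction suffices in every greedy argument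
  below.\<close>

lemma recolour_out:
  assumes f: "kcol k (induced E (- {c})) f" and irr: "(c, c) \<notin> E" and j: "j < k"
    and free: "\<And>y. (c, y) \<in> E \<Longrightarrow> f y \<noteq> j"
  shows "kcol k E (f(c := j))"
proof -
  have "mono_arcs (induced E (- {c})) (f(c := j)) = mono_arcs (induced E (- {c})) f"
    by (rule mono_arcs_cong) (auto simp: induced_def Field_def)
  moreover have "mono_arcs (induced E {c}) (f(c := j)) = {}" using irr by (auto simp: induced_def mono_arcs_def)
  ultimately have "acyclic (mono_arcs E (f(c := j)))"
  proof (intro acyclic_mono_cut[of E "{c}"])
    fix x y assume "(x, y) \<in> E" "x \<in> {c}" "y \<notin> {c}" "(f(c := j)) x = (f(c := j)) y"
    then show False using free[of y] by simp
  qed (use f in \<open>auto simp: kcol_def acyclic_def\<close>)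
  then show ?thesis using f j by (simp add: kcol_def)
qed

lemma recolour_in:
  assumes f: "kcol k (induced E (- {c})) f" and irr: "(c, c) \<notin> E" and j: "j < k"
    and free: "\<And>y. (y, c) \<in> E \<Longrightarrow> f y \<noteq> j"
  shows "kcol k E (f(c := j))"
  using recolour_out[of k "E\<inverse>" c f j] assms by (simp add: ind_converse kcol_converse)

lemma free_colour:
  assumes "finite A" "card (f ` A) < k"
  obtains j where "j < k" "j \<notin> f ` A"
proof -
  have "\<not> {..<k} \<subseteq> f ` A"
    using assms card_mono[of "f ` A" "{..<k}"] by auto
  then show ?thesis using that by blast
qed

lemma kcol_ind: "kcol k E f \<Longrightarrow> kcol k (induced E X) f"
  by (rule kcol_mono) (auto simp: induced_def)

text \<open>Since the \<open>A\<close> side forces \<open>c\<close> to have the colour of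
  \<open>x\<close>, moving \<open>c\<close> to any other colour must fail, so each of the other
  \<open>k - 1\<close> colours occurs both on an out-neighbour and on an in-neighbour of
  \<open>c\<close> in \<open>A\<close>. At most one arc of \<open>c\<close> in each direction is
  left for \<open>B\<close>, and \<open>x\<close> splits \<open>A \<union> {c}\<close> from
  \<open>B\<close>.\<close>

lemma rigid_two_cut:
  assumes E: "crit_sep k E" and k: "2 \<le> k" and xc: "x \<in> Field E" "c \<in> Field E" "x \<noteq> c"
    and deg: "card (E `` {c}) = k"
    and AB: "A \<noteq> {}" "B \<noteq> {}" "A \<inter> B = {}" "A \<union> B = Field E - {x, c}"
    and no: "E \<inter> A \<times> B = {}" "E \<inter> B \<times> A = {}"
    and rig: "rigid k (induced E (A \<union> {x, c})) {x, c}"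
  shows "decomposable E"
proof -
  note finE = crit_sepD(1)[OF E]
  note irr = crit_sepD(2)[OF E]
  let ?EA = "induced E (A \<union> {x, c})"
  obtain b where b: "b \<in> B" "b \<in> Field E" "b \<notin> A \<union> {x, c}" using AB by blast
  obtain f where f: "kcol k ?EA f"
    using crit_sepD(4)[OF E ind_psubset[OF b(2,3)]] by (auto simp: colourable_def)
  have irrA: "(c, c) \<notin> ?EA" using irr by (simp add: induced_def)
  have finI: "finite (E `` {c})" "finite (E\<inverse> `` {c})" using finE by (auto simp: finite_Image)
  have not: "\<not> kcol k ?EA (f(c := j))" if "j \<noteq> f x" for j
    using rigidD[OF rig, of "f(c := j)" x c] that xc by auto
  have out: "{..<k} - {f x} \<subseteq> f ` (E `` {c} \<inter> A)"
  proof
    fix j assume j: "j \<in> {..<k} - {f x}"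
    show "j \<in> f ` (E `` {c} \<inter> A)"
    proof (rule ccontr)
      assume n: "j \<notin> f ` (E `` {c} \<inter> A)"
      have "kcol k ?EA (f(c := j))"
        by (rule recolour_out[OF kcol_ind[OF f] irrA]) (use j n irr in \<open>auto simp: induced_def\<close>)
      then show False using not j by simp
    qed
  qed
  have inn: "{..<k} - {f x} \<subseteq> f ` (E\<inverse> `` {c} \<inter> A)"
  proof
    fix j assume j: "j \<in> {..<k} - {f x}"
    show "j \<in> f ` (E\<inverse> `` {c} \<inter> A)"
    proof (rule ccontr)
      assume n: "j \<notin> f ` (E\<inverse> `` {c} \<inter> A)"
      have "kcol k ?EA (f(c := j))"
        by (rule recolour_in[OF kcol_ind[OF f] irrA]) (use j n irr in \<open>auto simp: induced_def\<close>)
      then show False using not j by simp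
    qed
  qed
  have few: "card (N \<inter> B) \<le> 1" if "finite N" "card N = k" "{..<k} - {f x} \<subseteq> f ` (N \<inter> A)" for N
  proof -
    have "k - 1 \<le> card ({..<k} - {f x})" by (simp add: card_Diff_singleton_if)
    also have "\<dots> \<le> card (f ` (N \<inter> A))" using that by (intro card_mono) auto
    also have "\<dots> \<le> card (N \<inter> A)" using that by (intro card_image_le) auto
    finally have "k - 1 \<le> card (N \<inter> A)" .
    moreover have "card (N \<inter> A) + card (N \<inter> B) = card ((N \<inter> A) \<union> (N \<inter> B))"
      using that AB by (intro card_Un_disjoint[symmetric]) auto
    moreover have "card ((N \<inter> A) \<union> (N \<inter> B)) \<le> card N" using that by (intro card_mono) auto
    ultimately show ?thesis using that(2) by simp
  qed
  have "splits E x (A \<union> {c}) B"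
    unfolding splits_def
  proof (intro conjI)
    have "E \<inter> (A \<union> {c}) \<times> B \<subseteq> Pair c ` (E `` {c} \<inter> B)" using no by auto
    then have "card (E \<inter> (A \<union> {c}) \<times> B) \<le> card (E `` {c} \<inter> B)"
      using finI by (intro surj_card_le) auto
    then show "card (E \<inter> (A \<union> {c}) \<times> B) \<le> 1"
      using few[OF finI(1) deg out] by simp
    have "E \<inter> B \<times> (A \<union> {c}) \<subseteq> (\<lambda>b. (b, c)) ` (E\<inverse> `` {c} \<inter> B)" using no by auto
    then have "card (E \<inter> B \<times> (A \<union> {c})) \<le> card (E\<inverse> `` {c} \<inter> B)"
      using finI by (intro surj_card_le) auto
    moreover have "card (E\<inverse> `` {c}) = k" using crit_sep_degree_eq[OF E, of c] deg k by simp
    ultimately show "card (E \<inter> B \<times> (A \<union> {c})) \<le> 1"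
      using few[OF finI(2) _ inn] by simp
  qed (use AB xc in auto)
  then show ?thesis by (auto simp: decomposable_def)
qed

text \<open>If neither side is rigid, each has a colouring that distinguishes \<open>x\<close> from
  \<open>c\<close>, and a permutation makes the two agree there. No monochromatic path then joins
  \<open>x\<close> and \<open>c\<close>, so the colourings glue without new cycles.\<close>

lemma two_cut:
  assumes E: "crit_sep k E" and k: "2 \<le> k" and xc: "x \<in> Field E" "c \<in> Field E" "x \<noteq> c"
    and deg: "card (E `` {c}) = k"
    and AB: "A \<noteq> {}" "B \<noteq> {}" "A \<inter> B = {}" "A \<union> B = Field E - {x, c}"
    and no: "E \<inter> A \<times> B = {}" "E \<inter> B \<times> A = {}"
  shows "decomposable E"
proof (rule ccontr)
  assume nd: "\<not> decomposable E"
  let ?EA = "induced E (A \<union> {x, c})"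
  let ?EB = "induced E (B \<union> {x, c})"
  have "\<not> rigid k ?EA {x, c}" using rigid_two_cut[OF E k xc deg AB no] nd by blast
  then obtain f where f: "kcol k ?EA f" "f x \<noteq> f c" unfolding rigid_def by auto
  have "\<not> rigid k ?EB {x, c}" using rigid_two_cut[OF E k xc deg AB(2,1) _ _ no(2,1)] AB nd by blast
  then obtain g where g: "kcol k ?EB g" "g x \<noteq> g c" unfolding rigid_def by auto
  have lt: "f v < k" "g v < k" for v using f g by (auto simp: kcol_def)
  obtain p where p: "inj p" "\<And>a. a < k \<Longrightarrow> p a < k" "p (g x) = f x" "p (g c) = f c"
    using exists_perm2[OF lt(2)[of x] lt(2)[of c] lt(1)[of x] lt(1)[of c] g(2) f(2)] by blast
  define h where "h v = (if v \<in> A then f v else p (g v))" for v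
  have hx: "h x = f x" "h c = f c" using AB p by (auto simp: h_def)
  have R: "mono_arcs ?EA h = mono_arcs ?EA f"
    by (rule mono_arcs_cong) (use hx in \<open>auto simp: h_def induced_def Field_def\<close>)
  have S: "mono_arcs ?EB h = mono_arcs ?EB (p \<circ> g)"
    by (rule mono_arcs_cong) (use AB in \<open>auto simp: h_def induced_def Field_def\<close>)
  have aR: "acyclic (mono_arcs ?EA h)" using f R by (simp add: kcol_def)
  have aS: "acyclic (mono_arcs ?EB h)"
    using g(1) p(1) unfolding S kcol_def by (simp add: mono_arcs_comp_inj)
  have "acyclic (mono_arcs ?EA h \<union> mono_arcs ?EB h)"
  proof (rule acyclic_glue_disjoint[OF aR aS])
    fix a b assume ab: "a \<in> Field (mono_arcs ?EA h)" "b \<in> Field (mono_arcs ?EA h)"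
      "(a, b) \<in> (mono_arcs ?EB h)\<^sup>+"
    have "a \<in> {x, c}" "b \<in> {x, c}"
      using ab Field_mono_ind[of E "A \<union> {x, c}" h] Field_mono_ind[of E "B \<union> {x, c}" h]
        trancl_Field[OF ab(3)] AB(3) by auto
    moreover have "h a = h b" using mono_trancl_colour[OF ab(3)] .
    ultimately have "a = b" using f(2) hx by auto
    then show False using ab(3) aS by (simp add: acyclic_def)
  qed
  moreover have "?EA \<union> ?EB = E"
  proof
    show "E \<subseteq> ?EA \<union> ?EB"
    proof
      fix e assume e: "e \<in> E"
      obtain a b where ab: "e = (a, b)" by force
      have abE: "(a, b) \<in> E" using e ab by simp
      then have "a \<in> Field E" "b \<in> Field E" by (auto simp: Field_def)
      then have "a \<in> A \<union> B \<union> {x, c}" "b \<in> A \<union> B \<union> {x, c}" using AB(4) by blast+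
      moreover have "\<not> (a \<in> A \<and> b \<in> B)" "\<not> (a \<in> B \<and> b \<in> A)" using no abE by blast+
      ultimately show "e \<in> ?EA \<union> ?EB" unfolding ab induced_def using abE by blast
    qed
  qed (auto simp: induced_def)
  ultimately have "acyclic (mono_arcs E h)" by (metis mono_arcs_Un)
  moreover have "\<forall>v. h v < k" using lt p by (simp add: h_def)
  ultimately show False using crit_sepD(3)[OF E] colourableI by blast
qed

text \<open>A derivation is an ordering of \<open>M\<close> in which each later vertex is adjacent,
  in either direction, to an earlier one; greedy colouring runs through it backwards.\<close>

inductive grow :: "'a rel \<Rightarrow> 'a \<Rightarrow> 'a set \<Rightarrow> bool" for E r where
  root: "grow E r {r}"
| step: "grow E r M \<Longrightarrow> v \<notin> M \<Longrightarrow> m \<in> M \<Longrightarrow> (v, m) \<in> E \<or> (m, v) \<in> E \<Longrightarrow> grow E r (insert v M)"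

lemma grow_connected:
  assumes fin: "finite M" and r: "r \<in> M"
    and conn: "\<And>A. A \<subseteq> M \<Longrightarrow> r \<in> A \<Longrightarrow> A \<noteq> M \<Longrightarrow> \<exists>a\<in>A. \<exists>b\<in>M - A. (a, b) \<in> E \<or> (b, a) \<in> E"
  shows "grow E r M"
proof -
  let ?S = "{A. A \<subseteq> M \<and> grow E r A}"
  have "finite ?S" using fin by (auto intro: finite_subset[of _ "Pow M"])
  moreover have "{r} \<in> ?S" using r by (auto intro: grow.root)
  ultimately obtain A where A: "A \<in> ?S" "{r} \<subseteq> A" "\<forall>B\<in>?S. A \<subseteq> B \<longrightarrow> A = B"
    using finite_has_maximal2[of ?S "{r}"] by metis
  have "A = M"
  proof (rule ccontr)
    assume "A \<noteq> M"
    then obtain a b where ab: "a \<in> A" "b \<in> M - A" "(a, b) \<in> E \<or> (b, a) \<in> E" using conn[of A] A by auto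
    then have "grow E r (insert b A)" using A grow.step[of E r A b a] by auto
    then have "insert b A \<in> ?S" using A ab by auto
    then show False using A(3) ab by blast
  qed
  then show ?thesis using A by simp
qed

text \<open>Colour towards the root: every other vertex still has an uncoloured neighbour when its turn comes,
  and the root sees a repeated colour.\<close>

lemma grow_colourable:
  assumes "grow E r M" and fin: "finite E" and irr: "\<And>x. (x, x) \<notin> E"
    and deg: "\<And>v. v \<in> M \<Longrightarrow> card (E `` {v}) \<le> k \<and> card (E\<inverse> `` {v}) \<le> k"
    and f: "kcol k (induced E (- M)) f"
    and u: "u1 \<in> E `` {r} - M" "u2 \<in> E `` {r} - M" "u1 \<noteq> u2" "f u1 = f u2"
  shows "colourable k E"
  using assms(1) deg f u
proof (induction arbitrary: f)
  case root
  have finI: "finite (E `` {r})" using fin by (simp add: finite_Image)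
  have "\<not> inj_on f (E `` {r})" using root.prems by (auto simp: inj_on_def)
  then have "card (f ` (E `` {r})) < k"
    using root.prems(1)[of r] card_image_le[OF finI, of f] eq_card_imp_inj_on[OF finI, of f] by force
  then obtain j where "j < k" "j \<notin> f ` (E `` {r})" using free_colour[OF finI] by blast
  then have "kcol k E (f(r := j))"
    by (intro recolour_out[OF root.prems(2) irr]) auto
  then show ?case by (auto simp: colourable_def)
next
  case (step M v m)
  let ?F = "induced E (- M)"
  have F: "induced ?F (- {v}) = induced E (- insert v M)" by (auto simp: induced_def)
  have f': "kcol k (induced ?F (- {v})) f" using step.prems(2) unfolding F .
  have irrF: "(v, v) \<notin> ?F" using irr by (simp add: induced_def)
  have finI: "finite (E `` {v})" "finite (E\<inverse> `` {v})" using fin by (auto simp: finite_Image)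
  \<comment> \<open>The vertex \<open>v\<close> added last is coloured first. Its neighbour
    \<open>m\<close> has no colour yet, so in the direction of the arc between them at most
    \<open>k - 1\<close> colours are seen.\<close>
  have "\<exists>j. kcol k ?F (f(v := j))"
    using step.hyps(4)
  proof
    assume a: "(v, m) \<in> E"
    have "card (f ` (E `` {v} - M)) \<le> card (E `` {v} - M)" using finI by (intro card_image_le) auto
    also have "\<dots> < card (E `` {v})" using a step.hyps finI by (intro psubset_card_mono) auto
    also have "\<dots> \<le> k" using step.prems(1)[of v] by simp
    finally obtain j where "j < k" "j \<notin> f ` (E `` {v} - M)" using free_colour[of "E `` {v} - M" f k] finI by auto
    then have "kcol k ?F (f(v := j))"
      by (intro recolour_out[OF f' irrF]) (auto simp: induced_def)
    then show ?thesis ..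
  next
    assume a: "(m, v) \<in> E"
    have "card (f ` (E\<inverse> `` {v} - M)) \<le> card (E\<inverse> `` {v} - M)" using finI by (intro card_image_le) auto
    also have "\<dots> < card (E\<inverse> `` {v})" using a step.hyps finI by (intro psubset_card_mono) auto
    also have "\<dots> \<le> k" using step.prems(1)[of v] by simp
    finally obtain j where "j < k" "j \<notin> f ` (E\<inverse> `` {v} - M)" using free_colour[of "E\<inverse> `` {v} - M" f k] finI by auto
    then have "kcol k ?F (f(v := j))"
      by (intro recolour_in[OF f' irrF]) (auto simp: induced_def)
    then show ?thesis ..
  qed
  then obtain j where "kcol k ?F (f(v := j))" ..
  then show ?case
    by (rule step.IH[rotated]) (use step.prems in auto)
qed

text \<open>If \<open>x\<close> and \<open>u\<close> do not form a digon, both can get colour 0 in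
  advance, which also takes care of the possibly large degree of \<open>x\<close>. Then
  \<open>r\<close> sees this colour twice and serves as root. The vertices other than
  \<open>x\<close> and \<open>u\<close> are connected, as otherwise \<open>two_cut\<close> would
  decompose \<open>E\<close>, so greedy colouring succeeds. The choice of \<open>D\<close> covers
  both directions at once.\<close>

lemma hub_step:
  assumes E: "crit_sep k E" and k: "2 \<le> k" and nd: "\<not> decomposable E" and x: "x \<in> Field E"
    and deg: "\<And>v. v \<in> Field E \<Longrightarrow> v \<noteq> x \<Longrightarrow> card (E `` {v}) = k"
    and D: "D = E \<or> D = E\<inverse>"
    and r: "(r, x) \<in> D" "(r, u) \<in> D" "u \<noteq> x"
  shows "(x, u) \<in> E \<and> (u, x) \<in> E"
proof (rule ccontr)
  assume n: "\<not> ?thesis"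
  have k1: "1 \<le> k" using k by simp
  note irr = crit_sepD(2)[OF E]
  have FD: "Field D = Field E" using D by (auto simp: Field_def)
  have uV: "u \<in> Field E" "r \<in> Field E" using r FD by (auto simp: Field_def)
  have rx: "r \<noteq> x" "r \<noteq> u" using r irr D by auto
  let ?M = "Field E - {x, u}"
  have sub: "mono_arcs (induced D (- ?M)) (\<lambda>_. 0) \<subseteq> D \<inter> {x, u} \<times> {x, u}"
    using FD by (auto simp: mono_arcs_def induced_def Field_def)
  also have "\<dots> \<subseteq> {(x, u)} \<or> \<dots> \<subseteq> {(u, x)}" using n D irr by auto
  ultimately have "acyclic (mono_arcs (induced D (- ?M)) (\<lambda>_. 0 :: nat))"
    using acyclic_single[of x u] acyclic_single[of u x] r(3) acyclic_subset by (metis subset_trans)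
  then have f: "kcol k (induced D (- ?M)) (\<lambda>_. 0)" using k by (simp add: kcol_def)
  have "colourable k D"
  proof (rule grow_colourable[OF _ _ _ _ f])
    show "finite D" "(y, y) \<notin> D" for y using D crit_sepD(1)[OF E] irr by auto
    show "card (D `` {v}) \<le> k \<and> card (D\<inverse> `` {v}) \<le> k" if "v \<in> ?M" for v
      using deg[of v] crit_sep_degree_eq[OF E k1, of v] that D by auto
    show "x \<in> D `` {r} - ?M" "u \<in> D `` {r} - ?M" "x \<noteq> u" using r by auto
    show "grow D r ?M"
    proof (rule grow_connected)
      show "finite ?M" using crit_sepD(1)[OF E] by (simp add: finite_Field)
      show "r \<in> ?M" using uV rx by auto
      fix A assume A: "A \<subseteq> ?M" "r \<in> A" "A \<noteq> ?M"
      show "\<exists>a\<in>A. \<exists>b\<in>?M - A. (a, b) \<in> D \<or> (b, a) \<in> D"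
      proof (rule ccontr)
        assume no: "\<not> ?thesis"
        have "decomposable E"
        proof (rule two_cut[OF E k x uV(1) r(3)[symmetric] deg[OF uV(1) r(3)]])
          show "A \<noteq> {}" "?M - A \<noteq> {}" "A \<inter> (?M - A) = {}" "A \<union> (?M - A) = Field E - {x, u}" using A by auto
          show "E \<inter> A \<times> (?M - A) = {}" "E \<inter> (?M - A) \<times> A = {}" using no D by auto
        qed
        then show False using nd by simp
      qed
    qed
  qed simp
  then have "colourable k E" using D colourable_converse by auto
  then show False using crit_sepD(3)[OF E] by simp
qed

text \<open>By \<open>hub_step\<close>, rooted at its members, the set \<open>S\<close> of digon
  neighbours of \<open>x\<close> is closed under adjacency apart from \<open>x\<close>. If a vertex
  were missing from it, \<open>x\<close> would be a cut vertex.\<close>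

lemma hub_adjacent_all:
  assumes E: "crit_sep k E" and k: "2 \<le> k" and nd: "\<not> decomposable E" and x: "x \<in> Field E"
    and deg: "\<And>v. v \<in> Field E \<Longrightarrow> v \<noteq> x \<Longrightarrow> card (E `` {v}) = k"
    and v: "v \<in> Field E" "v \<noteq> x"
  shows "(x, v) \<in> E \<and> (v, x) \<in> E"
proof (rule ccontr)
  assume n: "\<not> ?thesis"
  have k1: "1 \<le> k" using k by simp
  note irr = crit_sepD(2)[OF E]
  note st = hub_step[OF E k nd x deg]
  define S where "S = {v. (x, v) \<in> E \<and> (v, x) \<in> E}"
  have xS: "x \<notin> S" using irr by (simp add: S_def)
  \<comment> \<open>\<open>S\<close> is nonempty: some \<open>r\<close> has an arc to
    \<open>x\<close>, and since its degree \<open>k\<close> is at least 2 it has another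
    out-neighbour \<open>u\<close>.\<close>
  have "1 \<le> card (out_cut E (- {x}))"
    using crit_sep_cut_ge[OF E k1, of "- {x}"] v x k1 by fastforce
  then have "out_cut E (- {x}) \<noteq> {}" by auto
  then obtain r where r: "(r, x) \<in> E" "r \<noteq> x" by (auto simp: out_cut_def)
  have "card (E `` {r}) = k" using deg[OF _ r(2)] r by (auto simp: Field_def)
  then have "\<not> E `` {r} \<subseteq> {x}" using card_mono[of "{x}" "E `` {r}"] k by auto
  then obtain u where u: "(r, u) \<in> E" "u \<noteq> x" by auto
  have uS: "u \<in> S" using st[of E r u] r u by (auto simp: S_def)
  have cl1: "b \<in> S" if "(a, b) \<in> E" "a \<in> S" "b \<noteq> x" for a b
    using st[of E a b] that by (auto simp: S_def)
  have cl2: "b \<in> S" if "(b, a) \<in> E" "a \<in> S" "b \<noteq> x" for a b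
    using st[of "E\<inverse>" a b] that by (auto simp: S_def)
  show False
  proof (rule crit_sep_no_cutvertex[OF E, of S x])
    show "S \<inter> Field E \<noteq> {}" using uS u by (auto simp: Field_def)
    show "Field E - S - {x} \<noteq> {}" using v n by (auto simp: S_def)
    show "x \<notin> S" by (rule xS)
    show "out_cut E S \<subseteq> S \<times> {x}" using cl1 by (auto simp: out_cut_def)
    show "out_cut E (- S) \<subseteq> {x} \<times> S" using cl2 by (auto simp: out_cut_def)
  qed
qed

text \<open>A hub forming digons with all other vertices needs a colour of its own, so deleting it
  lowers \<open>k\<close> by one, for colourability as well as for criticality. The rest is regular
  of degree \<open>k - 1\<close>, so single vertices serve as separating sets.\<close>

lemma remove_hub:
  assumes E: "crit_sep k E" and k: "2 \<le> k" and x: "x \<in> Field E"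
    and deg: "\<And>v. v \<in> Field E \<Longrightarrow> v \<noteq> x \<Longrightarrow> card (E `` {v}) = k"
    and hub: "\<And>v. v \<in> Field E \<Longrightarrow> v \<noteq> x \<Longrightarrow> (x, v) \<in> E \<and> (v, x) \<in> E"
  shows "crit_sep (k - 1) (induced E (- {x}))" "Field (induced E (- {x})) = Field E - {x}"
    "\<And>v. v \<in> Field E - {x} \<Longrightarrow> card (induced E (- {x}) `` {v}) = k - 1"
proof -
  let ?L = "induced E (- {x})"
  let ?V = "Field E"
  note finE = crit_sepD(1)[OF E]
  note irr = crit_sepD(2)[OF E]
  have degL: "card (?L `` {v}) = k - 1" if v: "v \<in> ?V - {x}" for v
  proof -
    have "?L `` {v} = E `` {v} - {x}" using v by (auto simp: induced_def)
    moreover have "x \<in> E `` {v}" using hub v by auto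
    moreover have "finite (E `` {v})" using finE by (simp add: finite_Image)
    ultimately show ?thesis using deg[of v] v by (simp add: card_Diff_singleton)
  qed
  then show "\<And>v. v \<in> Field E - {x} \<Longrightarrow> card (induced E (- {x}) `` {v}) = k - 1" .
  show FL: "Field ?L = ?V - {x}"
  proof
    show "Field ?L \<subseteq> ?V - {x}" by (auto simp: induced_def Field_def)
    show "?V - {x} \<subseteq> Field ?L"
    proof
      fix v assume "v \<in> ?V - {x}"
      then have "?L `` {v} \<noteq> {}" using degL[of v] k by auto
      then show "v \<in> Field ?L" by (auto simp: Field_def)
    qed
  qed
  show "crit_sep (k - 1) ?L"
    unfolding crit_sep_def
  proof (intro conjI allI impI ballI)
    show "finite ?L" using finE by (simp add: induced_def)
    show "(y, y) \<notin> ?L" for y using irr by (simp add: induced_def)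
    show "\<not> colourable (k - 1) ?L"
    proof
      assume "colourable (k - 1) ?L"
      then obtain f where f: "kcol (k - 1) ?L f" by (auto simp: colourable_def)
      then have f': "kcol k ?L f" and lt: "f v < k - 1" for v
        by (auto simp: kcol_def) (metis Suc_leD Suc_le_mono diff_le_self le_trans less_eq_Suc_le)
      have "f y \<noteq> k - 1" for y using lt[of y] by simp
      then have "kcol k E (f(x := k - 1))"
        using k by (intro recolour_out[OF f' irr]) auto
      then show False using crit_sepD(3)[OF E] by (auto simp: colourable_def)
    qed
    show "colourable (k - 1) L'" if L': "L' \<subset> ?L" for L'
    proof -
      let ?E' = "E - (?L - L')"
      have "?E' \<subset> E" using L' by (auto simp: induced_def)
      then obtain f where f: "kcol k ?E' f" using crit_sepD(4)[OF E] by (auto simp: colourable_def)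
      have ne: "f v \<noteq> f x" if v: "v \<in> ?V" "v \<noteq> x" for v
      proof
        assume "f v = f x"
        then have "(x, v) \<in> mono_arcs ?E' f" "(v, x) \<in> mono_arcs ?E' f"
          using hub[OF v] by (auto simp: mono_arcs_def induced_def)
        then have "(x, x) \<in> (mono_arcs ?E' f)\<^sup>+" by (meson r_into_trancl trancl_trans)
        then show False using f by (auto simp: kcol_def acyclic_def)
      qed
      \<comment> \<open>Exchanges the colour of \<open>x\<close>, which no other vertex of
        \<open>E\<close> uses, with the top colour, so that the remaining vertices only use colours
        below \<open>k - 1\<close>.\<close>
      let ?p = "transpose (f x) (k - 1)"
      let ?g = "\<lambda>v. if v \<in> ?V - {x} then ?p (f v) else 0"
      have lt: "f v < k" for v using f by (simp add: kcol_def)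
      have "?g v < k - 1" for v
      proof (cases "v \<in> ?V - {x}")
        case True
        then have "?p (f v) \<noteq> k - 1" using ne[of v] by (auto simp: transpose_def)
        moreover have "?p (f v) < k" using lt k by (intro transpose_less) auto
        ultimately show ?thesis using True by auto
      next
        case False
        then show ?thesis using k by simp
      qed
      moreover have "L' \<subseteq> ?E'" using L' by (auto simp: induced_def)
      then have "kcol k L' f" by (rule kcol_mono[OF f])
      moreover have "mono_arcs L' ?g = mono_arcs L' (?p \<circ> f)"
      proof (rule mono_arcs_cong)
        fix v assume "v \<in> Field L'"
        then have "v \<in> ?V - {x}" using mono_Field[of L' ?L] L' FL by blast
        then show "?g v = (?p \<circ> f) v" by simp
      qed
      ultimately have "kcol (k - 1) L' ?g"
        by (simp add: kcol_def mono_arcs_comp_inj inj_transpose)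
      then show ?thesis by (auto simp: colourable_def intro: exI[of _ ?g])
    qed
    fix u v assume uv: "u \<in> Field ?L" "v \<in> Field ?L" "u \<noteq> v"
    have "card (out_cut ?L {u}) = k - 1"
      using uv FL degL[of u] card_cut_single[of u ?L] irr by (simp add: induced_def)
    then show "\<exists>X. u \<in> X \<and> v \<notin> X \<and> card (out_cut ?L X) \<le> k - 1"
      using uv by (intro exI[of _ "{u}"]) auto
  qed
qed

text \<open>Each part is left by at least \<open>m\<close> arcs, all but at most one of which go to
  \<open>a\<close>. So \<open>a\<close> would have in-degree at least \<open>2 * (m - 1)\<close>,
  which exceeds \<open>m\<close> once \<open>m \<ge> 3\<close>; for \<open>m = 2\<close> the count
  gives no contradiction.\<close>

lemma regular_not_decomposable:
  assumes L: "crit_sep m L" and m: "3 \<le> m" and deg: "\<And>v. v \<in> Field L \<Longrightarrow> card (L `` {v}) = m"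
  shows "\<not> decomposable L"
proof
  assume "decomposable L"
  then obtain a A B where s: "splits L a A B" by (auto simp: decomposable_def)
  have m1: "1 \<le> m" using m by simp
  have fin: "finite L" "finite (L\<inverse> `` {a})" using crit_sepD(1)[OF L] by (auto simp: finite_Image)
  have a: "a \<in> Field L" using s by (auto simp: splits_def)
  have d: "card (L\<inverse> `` {a}) = m" using crit_sep_degree_eq[OF L m1] deg[OF a] by simp
  have half: "m \<le> 1 + card (L\<inverse> `` {a} \<inter> P)"
    if P: "P \<noteq> {}" "Q \<noteq> {}" "P \<inter> Q = {}" "P \<union> Q \<union> {a} = Field L" "card (L \<inter> P \<times> Q) \<le> 1" for P Q
  proof -
    have "m \<le> card (out_cut L P)" using crit_sep_cut_ge[OF L m1, of P] P by blast
    also have "\<dots> \<le> card ((L \<inter> P \<times> Q) \<union> (\<lambda>b. (b, a)) ` (L\<inverse> `` {a} \<inter> P))"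
    proof (rule card_mono)
      show "finite ((L \<inter> P \<times> Q) \<union> (\<lambda>b. (b, a)) ` (L\<inverse> `` {a} \<inter> P))" using fin by auto
      show "out_cut L P \<subseteq> (L \<inter> P \<times> Q) \<union> (\<lambda>b. (b, a)) ` (L\<inverse> `` {a} \<inter> P)"
      proof
        fix e assume "e \<in> out_cut L P"
        then obtain u v where uv: "e = (u, v)" "(u, v) \<in> L" "u \<in> P" "v \<notin> P" by (auto simp: out_cut_def)
        then have "v \<in> Field L" by (auto simp: Field_def)
        then have "v \<in> Q \<or> v = a" using P uv by blast
        then show "e \<in> (L \<inter> P \<times> Q) \<union> (\<lambda>b. (b, a)) ` (L\<inverse> `` {a} \<inter> P)" using uv by auto
      qed
    qed
    also have "\<dots> \<le> card (L \<inter> P \<times> Q) + card ((\<lambda>b. (b, a)) ` (L\<inverse> `` {a} \<inter> P))" by (rule card_Un_le)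
    also have "\<dots> \<le> 1 + card (L\<inverse> `` {a} \<inter> P)" using P fin by (intro add_mono card_image_le) auto
    finally show ?thesis .
  qed
  have "m \<le> 1 + card (L\<inverse> `` {a} \<inter> A)" using s half[of A B] by (auto simp: splits_def)
  moreover have "m \<le> 1 + card (L\<inverse> `` {a} \<inter> B)" using s half[of B A] by (auto simp: splits_def Un_commute)
  moreover have "card (L\<inverse> `` {a} \<inter> A) + card (L\<inverse> `` {a} \<inter> B) = card ((L\<inverse> `` {a} \<inter> A) \<union> (L\<inverse> `` {a} \<inter> B))"
    using s fin by (intro card_Un_disjoint[symmetric]) (auto simp: splits_def)
  moreover have "\<dots> \<le> card (L\<inverse> `` {a})" using fin by (intro card_mono) auto
  ultimately show False using d m by simp
qed

text \<open>After deleting \<open>x\<close> the rest is regular of degree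
  \<open>k - 1 \<ge> 3\<close>, hence again indecomposable, and any of its vertices can play the
  hub. A hub \<open>y\<close> that is joined to all others and has degree \<open>k - 1\<close>
  determines the number of vertices.\<close>

lemma hub_complete:
  assumes E: "crit_sep k E" and k: "4 \<le> k" and nd: "\<not> decomposable E" and x: "x \<in> Field E"
    and deg: "\<And>v. v \<in> Field E \<Longrightarrow> v \<noteq> x \<Longrightarrow> card (E `` {v}) = k"
  shows "card (Field E) = k + 1" "\<And>u v. u \<in> Field E \<Longrightarrow> v \<in> Field E \<Longrightarrow> u \<noteq> v \<Longrightarrow> (u, v) \<in> E"
proof -
  have k2: "2 \<le> k" and k1: "1 \<le> k" using k by auto
  let ?L = "induced E (- {x})"
  let ?V = "Field E"
  have fin: "finite ?V" using crit_sepD(1)[OF E] by (simp add: finite_Field)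
  note irr = crit_sepD(2)[OF E]
  have hub: "(x, v) \<in> E \<and> (v, x) \<in> E" if "v \<in> ?V" "v \<noteq> x" for v
    using hub_adjacent_all[OF E k2 nd x deg that] .
  have rm: "crit_sep (k - 1) ?L" "Field ?L = ?V - {x}" "\<And>v. v \<in> ?V - {x} \<Longrightarrow> card (?L `` {v}) = k - 1"
    using remove_hub[OF E k2 x deg hub] by auto
  have degL: "card (?L `` {v}) = k - 1" if "v \<in> Field ?L" for v using rm that by auto
  have ndL: "\<not> decomposable ?L" using regular_not_decomposable[OF rm(1) _ degL] k by simp
  obtain y where y: "(x, y) \<in> E \<or> (y, x) \<in> E" "y \<noteq> x" using x irr by (auto simp: Field_def)
  then have yV: "y \<in> ?V - {x}" by (auto simp: Field_def)
  have adj: "(y, v) \<in> ?L" if "v \<in> ?V - {x}" "v \<noteq> y" for v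
    using hub_adjacent_all[OF rm(1) _ ndL, of y v] k yV that rm(2) degL by auto
  have "?L `` {y} = ?V - {x} - {y}"
  proof
    show "?L `` {y} \<subseteq> ?V - {x} - {y}" using irr by (auto simp: induced_def Field_def)
  qed (use adj in auto)
  then have "card (?V - {x} - {y}) = k - 1" using rm(3)[OF yV] by simp
  then have "card (?V - {x}) = k" using yV fin k by (simp add: card_Diff_singleton_if split: if_splits)
  then show cV: "card ?V = k + 1" using x fin k by (simp add: card_Diff_singleton_if split: if_splits)
  fix u v assume uv: "u \<in> ?V" "v \<in> ?V" "u \<noteq> v"
  show "(u, v) \<in> E"
  proof (cases "u = x")
    case True then show ?thesis using hub uv by auto
  next
    case False
    have "E `` {u} \<subseteq> ?V - {u}" using irr by (auto simp: Field_def)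
    moreover have "card (E `` {u}) = card (?V - {u})" using deg[OF uv(1) False] cV uv fin by simp
    ultimately have "E `` {u} = ?V - {u}" using fin card_subset_eq by blast
    then show ?thesis using uv by auto
  qed
qed

section \<open>Two-regular critical digraphs are symmetric odd cycles\<close>

lemma card2_eq: "card S = 2 \<Longrightarrow> a \<in> S \<Longrightarrow> b \<in> S \<Longrightarrow> a \<noteq> b \<Longrightarrow> S = {a, b}"
  by (metis card_2_iff doubleton_eq_iff insertE singletonD)

lemma flip_colour: "(a::nat) < 2 \<Longrightarrow> 1 - a < 2 \<and> 1 - a \<noteq> a"
  by presburger

locale two_regular =
  fixes L :: "'a rel"
  assumes crit: "crit_sep 2 L" and deg: "\<And>v. v \<in> Field L \<Longrightarrow> card (L `` {v}) = 2"
begin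

lemma fin: "finite L" and irr: "(v, v) \<notin> L" and nc: "\<not> colourable 2 L"
  using crit_sepD(1-3)[OF crit] by auto

lemma indeg: "v \<in> Field L \<Longrightarrow> card (L\<inverse> `` {v}) = 2"
  using crit_sep_degree_eq[OF crit] deg by simp

lemma cut_ge: "a \<in> X \<Longrightarrow> a \<in> Field L \<Longrightarrow> b \<notin> X \<Longrightarrow> b \<in> Field L \<Longrightarrow> 2 \<le> card (out_cut L X)"
  using crit_sep_cut_ge[OF crit, of X] by auto

text \<open>The set of \<open>r\<close>, \<open>u1\<close>, \<open>u2\<close> can be entered only at
  \<open>r\<close>. If there are further vertices, at least two arcs enter it, so both arcs into
  \<open>r\<close> come from outside; then a colouring of the rest extends with \<open>r\<close> and
  \<open>u2\<close> alike and \<open>u1\<close> different.\<close>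

lemma digon_case:
  assumes r: "L `` {r} = {u1, u2}" "u1 \<noteq> u2" and dig: "(u1, u2) \<in> L" "(u2, u1) \<in> L"
  shows "(u1, r) \<in> L \<and> (u2, r) \<in> L"
proof (rule ccontr)
  assume n: "\<not> ?thesis"
  have ru: "(r, u1) \<in> L" "(r, u2) \<in> L" using r by auto
  then have F: "r \<in> Field L" "u1 \<in> Field L" "u2 \<in> Field L" by (auto simp: Field_def)
  have ne: "r \<noteq> u1" "r \<noteq> u2" using ru irr by auto
  have in1: "L\<inverse> `` {u1} = {r, u2}" using indeg[OF F(2)] ru dig ne by (intro card2_eq) auto
  have in2: "L\<inverse> `` {u2} = {r, u1}" using indeg[OF F(3)] ru dig ne by (intro card2_eq) auto
  have finr: "finite (L\<inverse> `` {r})" using fin by (simp add: finite_Image)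
  let ?T = "{r, u1, u2}"
  have "Field L \<noteq> ?T"
  proof
    assume e: "Field L = ?T"
    have "L\<inverse> `` {r} \<subseteq> {u1, u2}"
    proof
      fix x assume "x \<in> L\<inverse> `` {r}"
      then have "x \<in> Field L" "x \<noteq> r" using irr by (auto simp: Field_def)
      then show "x \<in> {u1, u2}" using e by blast
    qed
    then have "L\<inverse> `` {r} = {u1, u2}" using indeg[OF F(1)] r(2) by (intro card_seteq) auto
    then show False using n by auto
  qed
  then obtain w where "w \<in> Field L" "w \<notin> ?T" using F by auto
  then have "2 \<le> card (out_cut L (- ?T))" using cut_ge[of w "- ?T" r] F by auto
  also have "out_cut L (- ?T) \<subseteq> (\<lambda>b. (b, r)) ` (L\<inverse> `` {r} - {u1, u2})"
    using in1 in2 by (auto simp: out_cut_def)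
  then have "card (out_cut L (- ?T)) \<le> card (L\<inverse> `` {r} - {u1, u2})"
    using finr by (intro surj_card_le) auto
  finally have "L\<inverse> `` {r} - {u1, u2} = L\<inverse> `` {r}"
    using indeg[OF F(1)] finr by (intro card_seteq) auto
  then have nr: "(u1, r) \<notin> L" "(u2, r) \<notin> L" by auto
  obtain q where q: "(u2, q) \<in> L" "q \<noteq> u1"
  proof -
    have "\<not> L `` {u2} \<subseteq> {u1}" using deg[OF F(3)] card_mono[of "{u1}" "L `` {u2}"] by auto
    then show ?thesis using that by auto
  qed
  have out2: "L `` {u2} = {u1, q}" using deg[OF F(3)] q dig by (intro card2_eq) auto
  have qne: "q \<noteq> r" "q \<noteq> u2" using q nr irr by auto
  obtain f where f: "kcol 2 (induced L (- {u1, u2})) f"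
    using crit_sepD(4)[OF crit ind_psubset[OF F(2)], of "- {u1, u2}"] by (auto simp: colourable_def)
  have lt: "f v < 2" for v using f by (simp add: kcol_def)
  \<comment> \<open>\<open>c\<close> avoids the colour of \<open>q\<close>, the out-neighbour of
    \<open>u2\<close> other than \<open>u1\<close>. When their turns come, \<open>r\<close> has no
    coloured out-neighbour, \<open>u2\<close> sees only \<open>q\<close> ahead, and both
    in-neighbours of \<open>u1\<close> have colour \<open>c\<close>.\<close>
  define c where "c = 1 - f q"
  have c: "c < 2" "f q \<noteq> c" "1 - c < 2" "1 - c \<noteq> c" using flip_colour[OF lt[of q]] flip_colour[of c] by (auto simp: c_def)
  have f1: "kcol 2 (induced L (- {u1, u2})) (f(r := c))"
    by (rule recolour_out[OF kcol_ind[OF f] _ c(1)]) (use irr r in \<open>auto simp: induced_def\<close>)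
  have "induced (induced L (- {u1})) (- {u2}) = induced L (- {u1, u2})" by (auto simp: induced_def)
  then have f1': "kcol 2 (induced (induced L (- {u1})) (- {u2})) (f(r := c))" using f1 by simp
  have f2: "kcol 2 (induced L (- {u1})) (f(r := c, u2 := c))"
  proof (rule recolour_out[OF f1' _ c(1)])
    show "(u2, u2) \<notin> induced L (- {u1})" using irr by (simp add: induced_def)
    fix y assume "(u2, y) \<in> induced L (- {u1})"
    then have "y = q" using out2 by (auto simp: induced_def)
    then show "(f(r := c)) y \<noteq> c" using qne c(2) by simp
  qed
  have "kcol 2 L (f(r := c, u2 := c, u1 := 1 - c))"
    by (rule recolour_in[OF f2 irr c(3)]) (use in1 c ne in auto)
  then show False using nc by (auto simp: colourable_def)
qed

text \<open>With \<open>u1\<close> and \<open>u2\<close> in one colour, greedy colouring rooted at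
  \<open>r\<close> succeeds unless \<open>u1\<close> and \<open>u2\<close> separate a set
  \<open>A\<close> containing \<open>r\<close> from a set \<open>B\<close>. Counting arcs at
  \<open>B\<close> shows that \<open>A\<close> can be left only from \<open>r\<close>, whose colour
  is free inside \<open>A\<close>. If symmetry fails at \<open>r\<close>, one of \<open>u1\<close>,
  \<open>u2\<close> has so few arcs back into \<open>A\<close> that a monochromatic cycle through it
  can be prevented.\<close>

lemma nondigon_case:
  assumes r: "L `` {r} = {u1, u2}" "u1 \<noteq> u2" and dig: "\<not> ((u1, u2) \<in> L \<and> (u2, u1) \<in> L)"
  shows "(u1, r) \<in> L \<and> (u2, r) \<in> L"
proof (rule ccontr)
  assume n: "\<not> ?thesis"
  let ?V = "Field L"
  have ru: "(r, u1) \<in> L" "(r, u2) \<in> L" using r by auto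
  then have F: "r \<in> ?V" "u1 \<in> ?V" "u2 \<in> ?V" by (auto simp: Field_def)
  have ne: "r \<noteq> u1" "r \<noteq> u2" using ru irr by auto
  let ?M = "?V - {u1, u2}"
  have finV: "finite ?V" using fin by (simp add: finite_Field)
  have sub: "mono_arcs (induced L (- ?M)) (\<lambda>_. 0) \<subseteq> L \<inter> {u1, u2} \<times> {u1, u2}"
    by (auto simp: mono_arcs_def induced_def Field_def)
  also have "\<dots> \<subseteq> {(u1, u2)} \<or> \<dots> \<subseteq> {(u2, u1)}" using dig irr by auto
  ultimately have "acyclic (mono_arcs (induced L (- ?M)) (\<lambda>_. 0 :: nat))"
    using acyclic_single[of u1 u2] acyclic_single[of u2 u1] r(2) acyclic_subset by (metis subset_trans)
  then have f0: "kcol 2 (induced L (- ?M)) (\<lambda>_. 0)" by (simp add: kcol_def)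
  have "\<not> grow L r ?M"
  proof
    assume g: "grow L r ?M"
    have "colourable 2 L"
      by (rule grow_colourable[OF g fin irr _ f0, of u1 u2]) (use deg indeg r in auto)
    then show False using nc by simp
  qed
  moreover have "finite ?M" "r \<in> ?M" using finV F ne by auto
  ultimately obtain A where A: "A \<subseteq> ?M" "r \<in> A" "A \<noteq> ?M"
    "\<And>a b. a \<in> A \<Longrightarrow> b \<in> ?M - A \<Longrightarrow> (a, b) \<notin> L \<and> (b, a) \<notin> L"
    using grow_connected[of ?M r L] by blast
  define B where "B = ?M - A"
  have noAB: "(a, b) \<notin> L" "(b, a) \<notin> L" if "a \<in> A" "b \<in> B" for a b
    using A(4) that by (auto simp: B_def)
  obtain b0 where b0: "b0 \<in> B" using A by (auto simp: B_def)
  have BV: "B \<subseteq> ?V" "r \<notin> B" "u1 \<notin> B" "u2 \<notin> B" using A by (auto simp: B_def)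
  have uA: "u1 \<notin> A" "u2 \<notin> A" using A by auto
  have V: "?V = A \<union> B \<union> {u1, u2}" using A(1) F by (auto simp: B_def)
  have nbr: "a \<in> ?V" "b \<in> ?V" if "(a, b) \<in> L" for a b using that by (auto simp: Field_def)
  have fI: "finite (L `` {v})" "finite (L\<inverse> `` {v})" for v using fin by (auto simp: finite_Image)
  have inB: "card (L\<inverse> `` {u} \<inter> B) \<le> 1" if "u \<in> {u1, u2}" for u
  proof -
    have "L\<inverse> `` {u} \<inter> B \<subseteq> L\<inverse> `` {u} - {r}" using BV by auto
    moreover have "card (L\<inverse> `` {u} - {r}) = 1" using indeg[of u] that ru F fI by auto
    ultimately show ?thesis using card_mono[of "L\<inverse> `` {u} - {r}"] fI by (metis finite_Diff)
  qed
  have "2 \<le> card (out_cut L B)" using cut_ge[of b0 B r] b0 BV F by auto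
  also have "\<dots> \<le> card ((\<lambda>b. (b, u1)) ` (L\<inverse> `` {u1} \<inter> B) \<union> (\<lambda>b. (b, u2)) ` (L\<inverse> `` {u2} \<inter> B))"
  proof (rule card_mono)
    show "out_cut L B \<subseteq> (\<lambda>b. (b, u1)) ` (L\<inverse> `` {u1} \<inter> B) \<union> (\<lambda>b. (b, u2)) ` (L\<inverse> `` {u2} \<inter> B)"
    proof
      fix e assume "e \<in> out_cut L B"
      then obtain a b where ab: "e = (a, b)" "(a, b) \<in> L" "a \<in> B" "b \<notin> B" by (auto simp: out_cut_def)
      then have "b \<in> {u1, u2}" using nbr(2)[OF ab(2)] V noAB by blast
      then show "e \<in> (\<lambda>b. (b, u1)) ` (L\<inverse> `` {u1} \<inter> B) \<union> (\<lambda>b. (b, u2)) ` (L\<inverse> `` {u2} \<inter> B)" using ab by auto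
    qed
  qed (use fI in auto)
  also have "\<dots> \<le> card ((\<lambda>b. (b, u1)) ` (L\<inverse> `` {u1} \<inter> B)) + card ((\<lambda>b. (b, u2)) ` (L\<inverse> `` {u2} \<inter> B))"
    by (rule card_Un_le)
  also have "\<dots> \<le> card (L\<inverse> `` {u1} \<inter> B) + card (L\<inverse> `` {u2} \<inter> B)"
    using fI by (intro add_mono card_image_le) auto
  finally have "card (L\<inverse> `` {u1} \<inter> B) = 1" "card (L\<inverse> `` {u2} \<inter> B) = 1"
    using inB[of u1] inB[of u2] by auto
  then obtain b1 b2 where b: "b1 \<in> L\<inverse> `` {u1} \<inter> B" "b2 \<in> L\<inverse> `` {u2} \<inter> B"
    by (metis card_1_singletonE insertI1)
  have in1: "L\<inverse> `` {u1} = {r, b1}" using indeg[OF F(2)] ru b BV by (intro card2_eq) auto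
  have in2: "L\<inverse> `` {u2} = {r, b2}" using indeg[OF F(3)] ru b BV by (intro card2_eq) auto
  \<comment> \<open>The two arcs into \<open>u1\<close>, and likewise those into \<open>u2\<close>,
    come from \<open>r\<close> and from one vertex of \<open>B\<close>.\<close>
  have leave: "x = r \<and> y \<in> {u1, u2}" if "(x, y) \<in> L" "x \<in> A" "y \<notin> A" for x y
  proof -
    have y: "y \<in> {u1, u2}" using nbr(2)[OF that(1)] V noAB that by blast
    moreover have "x \<in> {r, b1, b2}" using y in1 in2 that by blast
    ultimately show ?thesis using that noAB b A(1) by (auto simp: B_def)
  qed
  have enter: "y \<in> {u1, u2}" if "(y, x) \<in> L" "x \<in> A" "y \<notin> A" for x y
    using nbr(1)[OF that(1)] V noAB that by blast
  have "2 \<le> card (out_cut L (- B))" using cut_ge[of r "- B" b0] b0 BV F by auto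
  also have "\<dots> \<le> card (Pair u1 ` (L `` {u1} \<inter> B) \<union> Pair u2 ` (L `` {u2} \<inter> B))"
  proof (rule card_mono)
    show "out_cut L (- B) \<subseteq> Pair u1 ` (L `` {u1} \<inter> B) \<union> Pair u2 ` (L `` {u2} \<inter> B)"
    proof
      fix e assume "e \<in> out_cut L (- B)"
      then obtain a b where ab: "e = (a, b)" "(a, b) \<in> L" "a \<notin> B" "b \<in> B" by (auto simp: out_cut_def)
      then have "a \<in> {u1, u2}" using nbr(1)[OF ab(2)] V noAB by blast
      then show "e \<in> Pair u1 ` (L `` {u1} \<inter> B) \<union> Pair u2 ` (L `` {u2} \<inter> B)" using ab by auto
    qed
  qed (use fI in auto)
  also have "\<dots> \<le> card (Pair u1 ` (L `` {u1} \<inter> B)) + card (Pair u2 ` (L `` {u2} \<inter> B))"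
    by (rule card_Un_le)
  also have "\<dots> \<le> card (L `` {u1} \<inter> B) + card (L `` {u2} \<inter> B)"
    using fI by (intro add_mono card_image_le) auto
  finally have outB: "2 \<le> card (L `` {u1} \<inter> B) + card (L `` {u2} \<inter> B)" .
  have split: "card (L `` {u} \<inter> A) + card (L `` {u} \<inter> B) \<le> 2" if "u \<in> {u1, u2}" for u
  proof -
    have "card (L `` {u} \<inter> A) + card (L `` {u} \<inter> B) = card ((L `` {u} \<inter> A) \<union> (L `` {u} \<inter> B))"
      using fI A by (intro card_Un_disjoint[symmetric]) (auto simp: B_def)
    also have "\<dots> \<le> card (L `` {u})" using fI by (intro card_mono) auto
    finally show ?thesis using deg[of u] that F by auto
  qed
  \<comment> \<open>Of the four arcs leaving \<open>u1\<close> and \<open>u2\<close>, at least two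
    enter \<open>B\<close>.\<close>
  have total: "card (L `` {u1} \<inter> A) + card (L `` {u2} \<inter> A) \<le> 2"
    using outB split[of u1] split[of u2] by simp
  have zero: "card (L `` {v} \<inter> A) = 0 \<longleftrightarrow> L `` {v} \<inter> A = {}" for v using fI by auto
  \<comment> \<open>Take the one without an arc to \<open>r\<close>; if it has two arcs into
    \<open>A\<close>, the other one has none and is taken instead.\<close>
  obtain u where u: "u \<in> {u1, u2}" "card (L `` {u} \<inter> A) \<le> 1" "(u, r) \<notin> L"
  proof (cases "(u1, r) \<in> L")
    case True
    then have 2: "(u2, r) \<notin> L" using n by simp
    show ?thesis
    proof (cases "card (L `` {u2} \<inter> A) \<le> 1")
      case True then show ?thesis using that[of u2] 2 by simp
    next
      case False
      then have "L `` {u1} \<inter> A = {}" using total zero[of u1] by auto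
      then show ?thesis using that[of u1] A(2) by auto
    qed
  next
    case 1: False
    show ?thesis
    proof (cases "card (L `` {u1} \<inter> A) \<le> 1")
      case True then show ?thesis using that[of u1] 1 by simp
    next
      case False
      then have "L `` {u2} \<inter> A = {}" using total zero[of u2] by auto
      then show ?thesis using that[of u2] A(2) by auto
    qed
  qed
  obtain f g where f: "kcol 2 (induced L A) f" and g: "kcol 2 (induced L (- A)) g"
    using crit_sep_colourings[OF crit, of A] A F by blast
  have lt: "f v < 2" "g v < 2" for v using f g by (auto simp: kcol_def)
  have noout: "(r, y) \<notin> induced L A" for y using r uA by (auto simp: induced_def)
  have recol: "kcol 2 (induced L A) (f'(r := c))" if "kcol 2 (induced L A) f'" "c < 2" for f' c
    by (rule recolour_out[OF kcol_ind[OF that(1)] _ that(2)]) (use noout in auto)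
  have join: False if f': "kcol 2 (induced L A) f'"
    and ok: "\<And>y y' x'. y \<in> {u1, u2} \<Longrightarrow> y' \<in> {u1, u2} \<Longrightarrow> f' r = g y \<Longrightarrow> (y', x') \<in> L \<Longrightarrow> x' \<in> A \<Longrightarrow>
       g y' = f' x' \<Longrightarrow> g y' = f' r \<Longrightarrow> False" for f'
  proof -
    define h where "h v = (if v \<in> A then f' v else g v)" for v
    have "mono_arcs (induced L A) h = mono_arcs (induced L A) f'" "mono_arcs (induced L (- A)) h = mono_arcs (induced L (- A)) g"
      by (auto simp: mono_arcs_def induced_def h_def)
    then have "acyclic (mono_arcs L h)"
    proof (intro acyclic_mono_cut[of L A])
      fix x y y' x' assume a: "(x, y) \<in> L" "x \<in> A" "y \<notin> A" "(y', x') \<in> L" "y' \<notin> A" "x' \<in> A"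
        "h x = h y" "h y' = h x'" "h x = h y'"
      have "x = r" "y \<in> {u1, u2}" "y' \<in> {u1, u2}" using leave[OF a(1-3)] enter[OF a(4,6,5)] by auto
      then show False using ok[of y y' x'] a by (simp add: h_def)
    qed (use f' g in \<open>auto simp: kcol_def\<close>)
    moreover have "\<forall>v. h v < 2" using f' g by (auto simp: h_def kcol_def)
    ultimately show False using nc colourableI by blast
  qed
  \<comment> \<open>If \<open>u1\<close> and \<open>u2\<close> agree, \<open>r\<close> takes the
    other colour and no monochromatic arc leaves \<open>A\<close>. Otherwise \<open>r\<close> takes
    the colour of \<open>u\<close>; a cycle in that colour has to re-enter \<open>A\<close> from
    \<open>u\<close>, and the colours of \<open>A\<close> are permuted beforehand so that the only
    out-neighbour of \<open>u\<close> there, if any, avoids it.\<close>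
  show False
  proof (cases "g u1 = g u2")
    case True
    show False
    proof (rule join[OF recol[OF f]])
      show "1 - g u1 < 2" using flip_colour[OF lt(2)[of u1]] by blast
      fix y assume "y \<in> {u1, u2}" "(f(r := 1 - g u1)) r = g y"
      then show False using True flip_colour[OF lt(2)[of u1]] by auto
    qed
  next
    case False
    obtain f' where f': "kcol 2 (induced L A) f'" "\<And>a. a \<in> L `` {u} \<inter> A \<Longrightarrow> f' a \<noteq> g u"
    proof (cases "L `` {u} \<inter> A = {}")
      case True
      show ?thesis by (rule that[OF f]) (use True in blast)
    next
      case nonempty: False
      then have "card (L `` {u} \<inter> A) = 1" using u(2) zero[of u] by linarith
      then obtain a where a: "L `` {u} \<inter> A = {a}" by (rule card_1_singletonE)
      let ?p = "transpose (f a) (1 - g u)"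
      have "kcol 2 (induced L A) (?p \<circ> f)"
        by (rule kcol_perm[OF f inj_transpose]) (use lt in \<open>auto intro!: transpose_less\<close>)
      moreover have "1 - g u \<noteq> g u" using flip_colour[OF lt(2)[of u]] by auto
      ultimately show ?thesis using that[of "?p \<circ> f"] a by auto
    qed
    show False
    proof (rule join[OF recol[OF f'(1) lt(2)[of u]]])
      fix y y' x' assume a: "y' \<in> {u1, u2}" "(y', x') \<in> L" "x' \<in> A" "g y' = (f'(r := g u)) x'"
        "g y' = (f'(r := g u)) r"
      then have "y' = u" using u(1) False by auto
      then have "x' \<in> L `` {u} \<inter> A" "x' \<noteq> r" using a u(3) by auto
      then show False using f'(2)[of x'] a \<open>y' = u\<close> by simp
    qed
  qed
qed

lemma symmetric: "(r, u) \<in> L \<Longrightarrow> (u, r) \<in> L"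
proof -
  assume ru: "(r, u) \<in> L"
  then have "card (L `` {r}) = 2" using deg by (auto simp: Field_def)
  then obtain u1 u2 where "L `` {r} = {u1, u2}" "u1 \<noteq> u2" by (auto simp: card_2_iff)
  moreover from this have "(u1, r) \<in> L \<and> (u2, r) \<in> L"
    using digon_case[of r u1 u2] nondigon_case[of r u1 u2] by blast
  moreover have "u \<in> L `` {r}" using ru by simp
  ultimately show ?thesis by auto
qed

lemma neighbours:
  assumes "(a, b) \<in> L" "(b, c) \<in> L" "a \<noteq> c"
  shows "L `` {b} = {a, c}"
  using assms symmetric deg[of b] by (intro card2_eq) (auto simp: Field_def)

text \<open>Continues an arc without turning back; its iterates walk around the cycle.\<close>

definition next_arc :: "'a \<times> 'a \<Rightarrow> 'a \<times> 'a" where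
  "next_arc = (\<lambda>(a, b). (b, SOME c. (b, c) \<in> L \<and> c \<noteq> a))"

lemma next_arc: "(a, b) \<in> L \<Longrightarrow> \<exists>c. next_arc (a, b) = (b, c) \<and> (b, c) \<in> L \<and> c \<noteq> a"
proof -
  assume ab: "(a, b) \<in> L"
  then have "card (L `` {b}) = 2" using deg by (auto simp: Field_def)
  then have "\<not> L `` {b} \<subseteq> {a}" using card_mono[of "{a}" "L `` {b}"] by auto
  then have "\<exists>c. (b, c) \<in> L \<and> c \<noteq> a" by auto
  from someI_ex[OF this] show ?thesis by (simp add: next_arc_def)
qed

lemma walk_exists: "\<exists>s :: nat \<Rightarrow> 'a. \<forall>i. (s i, s (Suc i)) \<in> L \<and> s (Suc (Suc i)) \<noteq> s i"
proof -
  have "L \<noteq> {}" using nc by (auto simp: mono_arcs_def acyclic_def intro!: colourableI[of _ "\<lambda>_. 0"])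
  then obtain a b where ab: "(a, b) \<in> L" by auto
  define P where "P i = (next_arc ^^ i) (a, b)" for i
  have PL: "P i \<in> L" for i
  proof (induction i)
    case (Suc i)
    then show ?case using next_arc[of "fst (P i)" "snd (P i)"] by (auto simp: P_def)
  qed (use ab in \<open>simp add: P_def\<close>)
  have PS: "fst (P (Suc i)) = snd (P i) \<and> snd (P (Suc i)) \<noteq> fst (P i)" for i
    using next_arc[of "fst (P i)" "snd (P i)"] PL[of i] by (auto simp: P_def)
  have "(fst (P i), fst (P (Suc i))) \<in> L \<and> fst (P (Suc (Suc i))) \<noteq> fst (P i)" for i
    using PL[of i] PS[of i] PS[of "Suc i"] by (metis prod.collapse)
  then show ?thesis by (intro exI[of _ "\<lambda>i. fst (P i)"]) blast
qed

text \<open>Follow a walk that never turns back up to its first repetition. It can only return to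
  its start, since an inner vertex would get a third neighbour. No arc leaves the resulting cycle,
  so it contains everything, and an even length would allow colouring by parity.\<close>

lemma odd_cycle:
  obtains n and s :: "nat \<Rightarrow> 'a" where "3 \<le> n" "odd n" "inj_on s {..<n}" "s ` {..<n} = Field L"
    "\<And>i. i < n \<Longrightarrow> L `` {s i} = {s (Suc i mod n), s ((i + n - 1) mod n)}"
proof -
  obtain s where s: "\<And>i. (s i, s (Suc i)) \<in> L" "\<And>i. s (Suc (Suc i)) \<noteq> s i"
    using walk_exists by blast
  have sV: "s i \<in> Field L" for i using s(1)[of i] by (auto simp: Field_def)
  have nb: "L `` {s (Suc i)} = {s i, s (Suc (Suc i))}" for i
    using neighbours[OF s(1)[of i] s(1)[of "Suc i"]] s(2)[of i] by auto
  have neq: "s (Suc i) \<noteq> s i" for i using s(1)[of i] irr by metis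
  define n where "n = (LEAST n. \<exists>j<n. s j = s n)"
  have "\<not> inj s"
  proof
    assume "inj s"
    moreover have "finite (range s)" using sV fin by (auto intro: finite_subset[of _ "Field L"] simp: finite_Field)
    ultimately show False using finite_imageD by blast
  qed
  then have ex: "\<exists>n. \<exists>j<n. s j = s n" unfolding inj_def by (metis linorder_neqE_nat)
  obtain j where j: "j < n" "s j = s n" using LeastI_ex[OF ex] unfolding n_def by blast
  have least: "\<not> (\<exists>j<m. s j = s m)" if "m < n" for m using not_less_Least that unfolding n_def by blast
  have inj: "inj_on s {..<n}"
    by (rule inj_onI) (metis least lessThan_iff linorder_neqE_nat)
  have j0: "j = 0"
  proof (rule ccontr)
    assume "j \<noteq> 0"
    then obtain i where i: "j = Suc i" using not0_implies_Suc by blast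
    obtain m where m: "n = Suc m" using j by (cases n) auto
    have "(s n, s m) \<in> L" using s(1)[of m] m symmetric by blast
    then have "s m \<in> L `` {s (Suc i)}" using j i by simp
    then have "s m = s i \<or> s m = s (Suc (Suc i))" using nb by auto
    then show False
    proof
      assume "s m = s i"
      then have "m = i" using inj j i m by (auto simp: inj_on_def)
      then show False using i m j by simp
    next
      assume e: "s m = s (Suc (Suc i))"
      show False
      proof (cases "Suc j < n")
        case True
        then have "m = Suc (Suc i)" using e inj i m by (auto simp: inj_on_def)
        then show False using s(2)[of "Suc i"] j i m by simp
      next
        case False
        then have "Suc (Suc i) = n" using i j by simp
        then show False using e neq[of m] m by simp
      qed
    qed
  qed
  then have s0: "s n = s 0" using j by simp
  have "n \<noteq> 1" using s0 neq[of 0] by auto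
  moreover have "n \<noteq> 2" using s0 s(2)[of 0] by (auto simp: numeral_2_eq_2)
  ultimately have n3: "3 \<le> n" using j by linarith
  then obtain m where m: "n = Suc m" by (cases n) auto
  have nbs: "L `` {s i} = {s (Suc i mod n), s ((i + n - 1) mod n)}" if i: "i < n" for i
  proof (cases i)
    case 0
    have "s m \<noteq> s 1" using inj_onD[OF inj, of m 1] n3 m by auto
    then have "L `` {s 0} = {s m, s 1}"
      using neighbours[of "s m" "s 0" "s 1"] s(1)[of m] s(1)[of 0] s0 m by simp
    then show ?thesis using 0 m n3 by auto
  next
    case (Suc i')
    have "s (Suc i mod n) = s (Suc i)" using i s0 by (cases "Suc i = n") auto
    moreover have "(i + n - 1) mod n = i'" using Suc i by simp
    ultimately show ?thesis using nb[of i'] Suc by auto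
  qed
  have img: "s ` {..<n} = Field L"
  proof (rule ccontr)
    assume ne: "s ` {..<n} \<noteq> Field L"
    have sub: "s ` {..<n} \<subseteq> Field L" using sV by auto
    have "out_cut L (s ` {..<n}) = {}"
    proof -
      have "b \<in> s ` {..<n}" if "(s i, b) \<in> L" "i < n" for i b
      proof -
        have "b \<in> {s (Suc i mod n), s ((i + n - 1) mod n)}" using nbs[OF that(2)] that(1) by blast
        then show ?thesis using n3 by auto
      qed
      then show ?thesis by (auto simp: out_cut_def)
    qed
    moreover have "2 \<le> card (out_cut L (s ` {..<n}))"
      using cut_ge[of "s 0" "s ` {..<n}"] sV ne sub n3 by auto
    ultimately show False by simp
  qed
  have "odd n"
  proof
    assume ev: "even n"
    define c where "c v = the_inv_into {..<n} s v mod 2" for v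
    have cs: "c (s i) = i mod 2" if "i < n" for i
      using that inj by (simp add: c_def the_inv_into_f_f)
    have par: "Suc i mod n mod 2 \<noteq> i mod 2" "(i + n - 1) mod n mod 2 \<noteq> i mod 2" if "i < n" for i
    proof -
      \<comment> \<open>Reduction modulo an even \<open>n\<close> preserves parity, so the arc that
        closes the cycle also gets two colours.\<close>
      have mm: "k mod n mod 2 = k mod 2" for k using ev by (simp add: mod_mod_cancel)
      show "Suc i mod n mod 2 \<noteq> i mod 2" unfolding mm by presburger
      obtain m where m: "i + n = Suc m" using n3 by (cases "i + n") auto
      have "even (i + n) = even i" using ev by simp
      then have "m mod 2 \<noteq> i mod 2" unfolding m by presburger
      then show "(i + n - 1) mod n mod 2 \<noteq> i mod 2" unfolding mm m by simp
    qed
    have "mono_arcs L c = {}"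
    proof -
      have "c a \<noteq> c b" if ab: "(a, b) \<in> L" for a b
      proof -
        have "a \<in> s ` {..<n}" using ab img by (auto simp: Field_def)
        then obtain i where i: "i < n" "a = s i" by auto
        then have "b = s (Suc i mod n) \<or> b = s ((i + n - 1) mod n)" using nbs[OF i(1)] ab by auto
        then show ?thesis using cs[of i] cs[of "Suc i mod n"] cs[of "(i + n - 1) mod n"] par[OF i(1)] i n3 by auto
      qed
      then show ?thesis by (auto simp: mono_arcs_def)
    qed
    then have "colourable 2 L" by (intro colourableI[of _ c]) (auto simp: acyclic_def c_def)
    then show False using nc by simp
  qed
  then show ?thesis using that n3 inj img nbs by blast
qed

end

lemma hub_wheel:
  assumes E: "crit_sep 3 E" and nd: "\<not> decomposable E" and x: "x \<in> Field E"
    and deg: "\<And>v. v \<in> Field E \<Longrightarrow> v \<noteq> x \<Longrightarrow> card (E `` {v}) = 3"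
  obtains n and s :: "nat \<Rightarrow> 'a" where "3 \<le> n" "odd n" "inj_on s {..n}" "s ` {..n} = Field E"
    "E = map_prod s s ` (wheel_edges n \<union> (wheel_edges n)\<inverse>)"
proof -
  let ?L = "induced E (- {x})"
  have hub: "(x, v) \<in> E \<and> (v, x) \<in> E" if "v \<in> Field E" "v \<noteq> x" for v
    using hub_adjacent_all[OF E _ nd x deg that] by simp
  have rm: "crit_sep 2 ?L" "Field ?L = Field E - {x}" "\<And>v. v \<in> Field E - {x} \<Longrightarrow> card (?L `` {v}) = 2"
    using remove_hub[OF E _ x deg hub] by simp_all
  interpret two_regular ?L using rm by unfold_locales auto
  obtain n s where n: "3 \<le> n" "odd n" and inj: "inj_on s {..<n}" and img: "s ` {..<n} = Field ?L"
    and nbs: "\<And>i. i < n \<Longrightarrow> ?L `` {s i} = {s (Suc i mod n), s ((i + n - 1) mod n)}"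
    using odd_cycle by metis
  \<comment> \<open>The hub takes index \<open>n\<close>, as in
    \<open>symmetric_wheel\<close>.\<close>
  define t where "t = s(n := x)"
  have tx: "t n = x" and ts: "\<And>i. i < n \<Longrightarrow> t i = s i" by (auto simp: t_def)
  have xs: "x \<notin> s ` {..<n}" using img rm(2) by simp
  have ats: "{..n} = insert n {..<n}" by auto
  have timg: "t ` {..<n} = s ` {..<n}" using ts by auto
  have tinj: "inj_on t {..n}"
  proof -
    have "inj_on t {..<n}" using inj inj_on_cong[of "{..<n}" t s] ts by simp
    then show ?thesis unfolding ats using xs timg tx by simp
  qed
  have tV: "t ` {..n} = Field E"
    unfolding ats using timg img rm(2) tx x by auto
  have modn: "Suc i mod n < n" "(i + n - 1) mod n < n" for i using n by auto
  have pred: "Suc ((i + n - 1) mod n) mod n = i" if "i < n" for i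
    using that n(1) by (cases i) (auto simp: mod_Suc_eq mod_simps)
  have "E = map_prod t t ` (wheel_edges n \<union> (wheel_edges n)\<inverse>)"
  proof (intro equalityI subsetI)
    fix e assume e: "e \<in> E"
    obtain a b where ab: "e = (a, b)" by force
    have aV: "a \<in> Field E" "b \<in> Field E" using e ab by (auto simp: Field_def)
    consider "a = x" | "b = x" | "a \<noteq> x" "b \<noteq> x" by blast
    then show "e \<in> map_prod t t ` (wheel_edges n \<union> (wheel_edges n)\<inverse>)"
    proof cases
      case 1
      then have "b \<in> s ` {..<n}" using img rm(2) aV e ab crit_sepD(2)[OF E] by auto
      then obtain i where "i < n" "b = s i" by auto
      then have "e = map_prod t t (n, i)" "(n, i) \<in> (wheel_edges n)\<inverse>"
        using ab 1 ts tx by (auto simp: wheel_edges_def)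
      then show ?thesis by blast
    next
      case 2
      then have "a \<in> s ` {..<n}" using img rm(2) aV e ab crit_sepD(2)[OF E] by auto
      then obtain i where "i < n" "a = s i" by auto
      then have "e = map_prod t t (i, n)" "(i, n) \<in> wheel_edges n"
        using ab 2 ts tx by (auto simp: wheel_edges_def)
      then show ?thesis by blast
    next
      case 3
      then have L: "(a, b) \<in> ?L" using e ab by (auto simp: induced_def)
      then have "a \<in> s ` {..<n}" using img by (auto simp: Field_def)
      then obtain i where i: "i < n" "a = s i" by auto
      then have "b = s (Suc i mod n) \<or> b = s ((i + n - 1) mod n)" using nbs[OF i(1)] L by auto
      then show ?thesis
      proof
        assume "b = s (Suc i mod n)"
        then have "e = map_prod t t (i, Suc i mod n)" "(i, Suc i mod n) \<in> wheel_edges n"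
          using ab i ts modn by (auto simp: wheel_edges_def)
        then show ?thesis by blast
      next
        assume b: "b = s ((i + n - 1) mod n)"
        have "((i + n - 1) mod n, Suc ((i + n - 1) mod n) mod n) \<in> wheel_edges n"
          using modn unfolding wheel_edges_def by blast
        then have "(i, (i + n - 1) mod n) \<in> (wheel_edges n)\<inverse>" using pred[OF i(1)] by simp
        moreover have "e = map_prod t t (i, (i + n - 1) mod n)" using ab b i ts modn by auto
        ultimately show ?thesis by blast
      qed
    qed
  next
    fix e assume "e \<in> map_prod t t ` (wheel_edges n \<union> (wheel_edges n)\<inverse>)"
    then obtain i j where ij: "e = (t i, t j)" "(i, j) \<in> wheel_edges n \<or> (j, i) \<in> wheel_edges n" by auto
    have sV: "s i \<in> Field E" "s i \<noteq> x" if "i < n" for i using that img rm(2) by auto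
    have W: "(t i, t j) \<in> E \<and> (t j, t i) \<in> E" if w: "(i, j) \<in> wheel_edges n" for i j
    proof (cases "j = n")
      case True
      then have "i < n" using w modn by (auto simp: wheel_edges_def)
      then show ?thesis using True ts tx hub[of "s i"] sV[of i] by auto
    next
      case False
      then have i: "i < n" "j = Suc i mod n" using w by (auto simp: wheel_edges_def)
      then have "(s i, s j) \<in> ?L" using nbs[OF i(1)] by auto
      moreover have "(s j, s i) \<in> ?L" using symmetric[OF calculation] .
      ultimately show ?thesis using ts[OF i(1)] ts[of j] modn[of i] i by (auto simp: induced_def)
    qed
    show "e \<in> E" using W ij by blast
  qed
  then show ?thesis using that[OF n tinj tV] by blast
qed

section \<open>Contraction along a split\<close>

definition two_conn :: "'a set \<Rightarrow> 'a rel \<Rightarrow> bool" where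
  "two_conn V E \<longleftrightarrow> (\<forall>a\<in>V. \<forall>A. A \<subseteq> V - {a} \<longrightarrow> A \<noteq> {} \<longrightarrow> A \<noteq> V - {a} \<longrightarrow>
     (\<exists>x\<in>A. \<exists>y\<in>V - {a} - A. (x, y) \<in> E \<or> (y, x) \<in> E))"

definition sep_le :: "nat \<Rightarrow> 'a set \<Rightarrow> 'a rel \<Rightarrow> bool" where
  "sep_le k V E \<longleftrightarrow> (\<forall>u\<in>V. \<forall>v\<in>V. u \<noteq> v \<longrightarrow> (\<exists>X. u \<in> X \<and> v \<notin> X \<and> card (out_cut E X) \<le> k))"

text \<open>Only one inequality is demanded of each invariant. The opposite ones follow:
  \<open>sep_le k\<close> yields a colouring with \<open>k + 1\<close> colours, so
  \<open>sep_le (k - 1)\<close> would contradict non-colourability.\<close>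

definition extremal_rel :: "nat \<Rightarrow> 'a set \<Rightarrow> 'a rel \<Rightarrow> bool" where
  "extremal_rel k V E \<longleftrightarrow> finite V \<and> E \<subseteq> V \<times> V \<and> (\<forall>x. (x, x) \<notin> E) \<and> 3 \<le> card V
     \<and> (\<forall>u\<in>V. \<forall>v\<in>V. (u, v) \<in> E\<^sup>*) \<and> two_conn V E \<and> \<not> colourable k E \<and> sep_le k V E"

lemma extremal_relD:
  assumes "extremal_rel k V E"
  shows "finite V" "E \<subseteq> V \<times> V" "\<And>x. (x, x) \<notin> E" "3 \<le> card V"
    "\<And>u v. u \<in> V \<Longrightarrow> v \<in> V \<Longrightarrow> (u, v) \<in> E\<^sup>*" "two_conn V E" "\<not> colourable k E" "sep_le k V E"
  using assms unfolding extremal_rel_def by blast+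

lemma crit_sep_two_vertices:
  assumes "crit_sep k E" "1 \<le> k"
  shows "\<exists>w\<in>Field E. w \<noteq> v"
proof -
  have "E \<noteq> {}" using crit_sepD(3)[OF assms(1)] assms(2)
    by (auto simp: mono_arcs_def acyclic_def intro!: colourableI[of _ "\<lambda>_. 0"])
  then obtain a b where "(a, b) \<in> E" by auto
  then show ?thesis using crit_sepD(2)[OF assms(1), of a] by (metis FieldI1 FieldI2)
qed

text \<open>Let \<open>H\<close> be a critical part. A tight set between two vertices of
  \<open>H\<close> has all its arcs in \<open>H\<close>, so \<open>C = E - H\<close> has no path
  between distinct vertices of \<open>H\<close>. By strong connectivity every vertex is reached in
  \<open>C\<close> from \<open>H\<close> and reaches \<open>H\<close> in \<open>C\<close>,
  necessarily at the same vertex \<open>w\<close>. What hangs at \<open>w\<close> in this way is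
  separated from the rest by \<open>w\<close>, so 2-connectivity forces \<open>C\<close> to be
  empty.\<close>

lemma extremal_rel_crit_sep:
  assumes c: "extremal_rel k V E" and k: "1 \<le> k"
  shows "crit_sep k E \<and> Field E = V"
proof -
  note EV = extremal_relD(2)[OF c] and irr = extremal_relD(3)[OF c] and strong = extremal_relD(5)[OF c]
  have finE: "finite E" using EV extremal_relD(1)[OF c] finite_subset by blast
  have FV: "Field E \<subseteq> V" using EV by (auto simp: Field_def)
  have FE: "Field E = V"
  proof
    show "V \<subseteq> Field E"
    proof
      fix v assume v: "v \<in> V"
      have "\<not> V \<subseteq> {v}" using card_mono[of "{v}" V] extremal_relD(4)[OF c] by auto
      then obtain u where "u \<in> V" "u \<noteq> v" by auto
      then show "v \<in> Field E" using strong[OF v, of u] rtrancl_in_Field[of v u E] by auto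
    qed
  qed (rule FV)
  obtain H where H: "H \<subseteq> E" "crit_sep k H"
    using exists_crit_sep[OF finE irr extremal_relD(7)[OF c]] extremal_relD(8)[OF c] FE unfolding sep_le_def by metis
  let ?W = "Field H"
  define C where "C = E - H"
  have WV: "?W \<subseteq> V" using mono_Field[OF H(1)] FE by simp
  have nopath: "u = v" if uv: "u \<in> ?W" "v \<in> ?W" "(u, v) \<in> C\<^sup>*" for u v
  proof (rule ccontr)
    assume ne: "u \<noteq> v"
    obtain Z where Z: "u \<in> Z" "v \<notin> Z" "card (out_cut E Z) \<le> k"
      using extremal_relD(8)[OF c] uv WV ne unfolding sep_le_def by blast
    have "k \<le> card (out_cut H Z)" using crit_sep_cut_ge[OF H(2) k, of Z] uv Z by auto
    moreover have "out_cut H Z \<subseteq> out_cut E Z" using H(1) by (auto simp: out_cut_def)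
    ultimately have "out_cut H Z = out_cut E Z" using Z(3) finE
      by (meson card_seteq finite_cut le_trans)
    moreover obtain a b where "(a, b) \<in> out_cut C Z" using rtrancl_crosses[OF uv(3), of Z] Z by auto
    ultimately show False by (auto simp: out_cut_def C_def)
  qed
  obtain w0 where w0: "w0 \<in> ?W" using crit_sep_two_vertices[OF H(2) k] by blast
  have from_W: "\<exists>w\<in>?W. (w, p) \<in> C\<^sup>*" if "p \<in> V" for p
    using strong[of w0 p] w0 WV that
  proof -
    have "(w0, p) \<in> E\<^sup>*" using strong[of w0 p] w0 WV that by auto
    then show ?thesis
    proof (induction rule: rtrancl_induct)
      case base
      then show ?case using w0 by blast
    next
      case (step y z)
      show ?case
      proof (cases "(y, z) \<in> H")
        case True then show ?thesis by (meson FieldI2 rtrancl.rtrancl_refl)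
      next
        case False then show ?thesis using step by (auto simp: C_def intro: rtrancl_into_rtrancl)
      qed
    qed
  qed
  have to_W: "\<exists>w\<in>?W. (p, w) \<in> C\<^sup>*" if "p \<in> V" for p
  proof -
    have "(p, w0) \<in> E\<^sup>*" using strong[of p w0] w0 WV that by auto
    then show ?thesis
    proof (induction rule: converse_rtrancl_induct)
      case base
      then show ?case using w0 by blast
    next
      case (step y z)
      show ?case
      proof (cases "(y, z) \<in> H")
        case True then show ?thesis by (meson FieldI1 rtrancl.rtrancl_refl)
      next
        case False then show ?thesis using step by (auto simp: C_def intro: converse_rtrancl_into_rtrancl)
      qed
    qed
  qed
  have "C = {}"
  proof (rule ccontr)
    assume "C \<noteq> {}"
    then obtain p q where pq: "(p, q) \<in> C" by auto
    then have pqV: "p \<in> V" "q \<in> V" "p \<noteq> q" using EV irr by (auto simp: C_def)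
    obtain w where w: "w \<in> ?W" "(w, p) \<in> C\<^sup>*" using from_W pqV by blast
    define A where "A = {z \<in> V. (w, z) \<in> C\<^sup>* \<and> z \<noteq> w}"
    have "p \<in> A \<or> q \<in> A" using w pq pqV by (auto simp: A_def intro: rtrancl_into_rtrancl)
    then have "A \<noteq> {}" by blast
    moreover have "A \<subseteq> V - {w}" by (auto simp: A_def)
    moreover obtain w' where w': "w' \<in> ?W" "w' \<noteq> w" using crit_sep_two_vertices[OF H(2) k] by blast
    then have "w' \<notin> A" using nopath[of w w'] w by (auto simp: A_def)
    then have "A \<noteq> V - {w}" using w' WV by blast
    moreover have "w \<in> V" using w WV by blast
    ultimately obtain x y where xy: "x \<in> A" "y \<in> V - {w} - A" "(x, y) \<in> E \<or> (y, x) \<in> E"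
      using extremal_relD(6)[OF c] unfolding two_conn_def by blast
    have xW: "x \<notin> ?W" using nopath[of w x] w xy by (auto simp: A_def)
    have wx: "(w, x) \<in> C\<^sup>*" using xy by (simp add: A_def)
    from xy(3) show False
    proof
      assume "(x, y) \<in> E"
      then have "(x, y) \<in> C" using xW by (auto simp: C_def Field_def)
      then show False using xy wx by (auto simp: A_def intro: rtrancl_into_rtrancl)
    next
      assume "(y, x) \<in> E"
      then have yx: "(y, x) \<in> C" using xW by (auto simp: C_def Field_def)
      obtain w2 where w2: "w2 \<in> ?W" "(w2, y) \<in> C\<^sup>*" using from_W xy by blast
      obtain w3 where w3: "w3 \<in> ?W" "(x, w3) \<in> C\<^sup>*" using to_W xy by (auto simp: A_def)
      have "w = w3" using nopath[OF w(1) w3(1)] wx w3(2) by (meson rtrancl_trans)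
      moreover have "w2 = w3" using nopath[OF w2(1) w3(1)] w2(2) yx w3(2)
        by (meson converse_rtrancl_into_rtrancl rtrancl_trans)
      ultimately show False using w2 xy by (auto simp: A_def)
    qed
  qed
  then have "H = E" using H(1) by (auto simp: C_def)
  then show ?thesis using H FE by simp
qed

text \<open>Otherwise \<open>E\<close> contains a critical digraph for \<open>k + 1\<close>, all of
  whose cuts have at least \<open>k + 1\<close> arcs.\<close>

lemma colourable_Suc:
  assumes fin: "finite E" and irr: "\<And>x. (x, x) \<notin> E" and sep: "sep_le k (Field E) E"
  shows "colourable (k + 1) E"
proof (rule ccontr)
  assume n: "\<not> colourable (k + 1) E"
  have "\<exists>X. u \<in> X \<and> v \<notin> X \<and> card (out_cut E X) \<le> k + 1" if "u \<in> Field E" "v \<in> Field E" "u \<noteq> v" for u v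
    using sep that unfolding sep_le_def by (meson le_add1 le_trans)
  then obtain G where G: "G \<subseteq> E" "crit_sep (k + 1) G" using exists_crit_sep[OF fin irr n] by metis
  obtain u where u: "u \<in> Field G" using crit_sep_two_vertices[OF G(2)] by auto
  obtain v where v: "v \<in> Field G" "v \<noteq> u" using crit_sep_two_vertices[OF G(2)] by auto
  have "u \<in> Field E" "v \<in> Field E" using u v mono_Field[OF G(1)] by blast+
  then obtain X where X: "u \<in> X" "v \<notin> X" "card (out_cut E X) \<le> k"
    using sep[unfolded sep_le_def, rule_format, of u v] v by auto
  have "k + 1 \<le> card (out_cut G X)" using crit_sep_cut_ge[OF G(2), of X] u v X by auto
  also have "\<dots> \<le> card (out_cut E X)" using G(1) fin by (intro card_mono) (auto simp: out_cut_def)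
  finally show False using X by simp
qed

lemma few_vertices_colourable:
  assumes V: "finite V" "E \<subseteq> V \<times> V" "card V \<le> k" and k: "1 \<le> k" and irr: "\<And>x. (x, x) \<notin> E"
  shows "colourable k E"
proof -
  obtain f where f: "bij_betw f V {0..<card V}" using ex_bij_betw_finite_nat[OF V(1)] by blast
  define g where "g v = (if v \<in> V then f v else 0)" for v
  have "g v < k" for v using bij_betw_apply[OF f, of v] V(3) k by (auto simp: g_def)
  moreover have "mono_arcs E g = {}"
  proof -
    have "a = b" if "(a, b) \<in> E" "g a = g b" for a b
    proof -
      have "a \<in> V" "b \<in> V" "f a = f b" using that V(2) by (auto simp: g_def)
      then show ?thesis using bij_betw_imp_inj_on[OF f] by (auto dest: inj_onD)
    qed
    then show ?thesis using irr by (auto simp: mono_arcs_def)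
  qed
  ultimately show ?thesis by (intro colourableI[of _ g]) (auto simp: acyclic_def)
qed

lemma crit_sep_strong:
  assumes E: "crit_sep k E" and k: "1 \<le> k" and uv: "u \<in> Field E" "v \<in> Field E"
  shows "(u, v) \<in> E\<^sup>*"
proof (rule ccontr)
  assume n: "(u, v) \<notin> E\<^sup>*"
  let ?Z = "{z. (u, z) \<in> E\<^sup>*}"
  have "out_cut E ?Z = {}" by (auto simp: out_cut_def intro: rtrancl_into_rtrancl)
  moreover have "k \<le> card (out_cut E ?Z)" using crit_sep_cut_ge[OF E k, of ?Z] uv n by auto
  ultimately show False using k by simp
qed

text \<open>Whatever is not in \<open>A\<close> is identified with \<open>a\<close>, so the
  contraction does not mention the other part of a split.\<close>

definition squash :: "'a set \<Rightarrow> 'a \<Rightarrow> 'a \<Rightarrow> 'a" where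
  "squash A a z = (if z \<in> A then z else a)"

definition contract_to :: "'a rel \<Rightarrow> 'a set \<Rightarrow> 'a \<Rightarrow> 'a rel" where
  "contract_to E A a = {(squash A a x, squash A a y) | x y. (x, y) \<in> E \<and> squash A a x \<noteq> squash A a y}"

lemma contract_toI: "(x, y) \<in> E \<Longrightarrow> squash A a x \<noteq> squash A a y \<Longrightarrow> (squash A a x, squash A a y) \<in> contract_to E A a"
  by (auto simp: contract_to_def)

lemma trancl_meets_or_avoids:
  assumes "(x, y) \<in> R\<^sup>+"
  shows "(\<exists>a\<in>A. (x, a) \<in> R\<^sup>* \<and> (a, y) \<in> R\<^sup>*) \<or> (x, y) \<in> (R \<inter> (- A) \<times> (- A))\<^sup>+"
  using assms
proof (induction rule: trancl_induct)
  case (base y)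
  then show ?case by blast
next
  case (step y z)
  show ?case
  proof (cases "y \<in> A \<or> z \<in> A")
    case True
    then show ?thesis using step.hyps by (meson r_into_rtrancl rtrancl.rtrancl_refl trancl_into_rtrancl trancl_rtrancl_trancl)
  next
    case False
    from step.IH show ?thesis
    proof
      assume "\<exists>a\<in>A. (x, a) \<in> R\<^sup>* \<and> (a, y) \<in> R\<^sup>*"
      then show ?thesis using step.hyps(2) by (meson rtrancl.rtrancl_into_rtrancl)
    next
      assume "(x, y) \<in> (R \<inter> (- A) \<times> (- A))\<^sup>+"
      moreover have "(y, z) \<in> R \<inter> (- A) \<times> (- A)" using False step.hyps by auto
      ultimately show ?thesis by (meson trancl.trancl_into_trancl)
    qed
  qed
qed

text \<open>A colouring of the contraction extends to \<open>E\<close>: in the colour of \<open>a\<close> cycles survive the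
  contraction, and with three colours \<open>u\<close> can be kept out of the colour of \<open>t\<close>.\<close>

lemma contract_not_colourable:
  assumes E: "crit_sep k E" and k: "3 \<le> k" and a: "a \<notin> A" "a \<in> Field E"
    and A: "A \<inter> Field E \<noteq> {}" and tu: "out_cut E A \<subseteq> A \<times> {a} \<union> {(t, u)}"
  shows "\<not> colourable k (contract_to E A a)"
proof
  let ?E1 = "contract_to E A a"
  assume "colourable k ?E1"
  then obtain f where f: "kcol k ?E1 f" by (auto simp: colourable_def)
  obtain x0 where "x0 \<in> A" "x0 \<in> Field E" using A by blast
  then obtain g where g: "kcol k (induced E (- A)) g"
    using crit_sepD(4)[OF E ind_psubset[of x0 E "- A"]] by (auto simp: colourable_def)
  have lt: "f v < k" "g v < k" for v using f g by (auto simp: kcol_def)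
  obtain c where c: "c < k" "c \<noteq> f a" "c \<noteq> f t" using third_colour[OF k] by blast
  \<comment> \<open>\<open>p\<close> makes the two colourings agree at \<open>a\<close>. If
    \<open>u\<close> and \<open>a\<close> differ in colour, \<open>u\<close> is moved to the third
    colour \<open>c\<close>, so \<open>(t, u)\<close> can be monochromatic only in the colour of
    \<open>a\<close>.\<close>
  obtain p where p: "inj p" "\<And>i. i < k \<Longrightarrow> p i < k" "p (g a) = f a" "g u \<noteq> g a \<Longrightarrow> p (g u) \<noteq> f t"
  proof (cases "g u = g a")
    case True
    show ?thesis
      by (rule that[of "transpose (g a) (f a)"]) (use True lt in \<open>auto simp: inj_transpose intro!: transpose_less\<close>)
  next
    case False
    obtain p where "inj p" "\<And>i. i < k \<Longrightarrow> p i < k" "p (g a) = f a" "p (g u) = c"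
      using exists_perm2[OF lt(2)[of a] lt(2)[of u] lt(1)[of a] c(1)] False c by metis
    then show ?thesis using that[of p] c by auto
  qed
  define h where "h v = (if v \<in> A then f v else p (g v))" for v
  have ha: "h a = f a" using a p by (simp add: h_def)
  let ?R = "mono_arcs E h"
  have sq: "squash A a a = a" using a by (simp add: squash_def)
  have step: "(squash A a x, squash A a y) \<in> mono_arcs ?E1 f"
    if "(x, y) \<in> ?R" "h x = f a" "squash A a x \<noteq> squash A a y" for x y
  proof -
    have "f (squash A a z) = f a" if "h z = f a" for z using that by (simp add: squash_def h_def split: if_splits)
    moreover have "h y = f a" "(x, y) \<in> E" using that by (simp_all add: mono_arcs_def)
    ultimately show ?thesis using contract_toI[OF _ that(3)] that(2) by (simp add: mono_arcs_iff)
  qed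
  have walk: "(squash A a x, squash A a y) \<in> (mono_arcs ?E1 f)\<^sup>*"
    if "(x, y) \<in> ?R\<^sup>*" "h x = f a" for x y
    using that
  proof (induction rule: rtrancl_induct)
    case base
    then show ?case by simp
  next
    case (step y z)
    have "h y = f a" using mono_rtrancl_colour[OF step.hyps(1)] step.prems by simp
    then show ?case using step.IH[OF step.prems] \<open>\<And>x y. (x, y) \<in> ?R \<Longrightarrow> h x = f a \<Longrightarrow> squash A a x \<noteq> squash A a y \<Longrightarrow> (squash A a x, squash A a y) \<in> mono_arcs ?E1 f\<close>[OF step.hyps(2)]
      by (cases "squash A a y = squash A a z") (auto intro: rtrancl_into_rtrancl)
  qed
  have acf: "acyclic (mono_arcs ?E1 f)" using f by (simp add: kcol_def)
  have no: False if x: "x \<in> A" "(x, x) \<in> ?R\<^sup>+" for x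
  proof (cases "h x = f a")
    case True
    obtain y where y: "(x, y) \<in> ?R" "(y, x) \<in> ?R\<^sup>*" using tranclD[OF x(2)] by blast
    have "squash A a x \<noteq> squash A a y"
      using y(1) x a crit_sepD(2)[OF E] by (auto simp: squash_def mono_arcs_def)
    then have "(squash A a x, squash A a y) \<in> mono_arcs ?E1 f" using step[OF y(1) True] by blast
    moreover have "h y = f a" using y(1) True by (simp add: mono_arcs_def)
    then have "(squash A a y, squash A a x) \<in> (mono_arcs ?E1 f)\<^sup>*" using walk[OF y(2)] by blast
    ultimately have "(squash A a x, squash A a x) \<in> (mono_arcs ?E1 f)\<^sup>+" by (rule rtrancl_into_trancl2)
    then show False using acf by (simp add: acyclic_def)
  next
    case False
    \<comment> \<open>In any colour other than that of \<open>a\<close> a cycle cannot leave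
      \<open>A\<close>, and inside \<open>A\<close> the contraction changes nothing.\<close>
    let ?X = "A \<inter> {z. h z = h x}"
    have "e \<in> ?X" if "(d, e) \<in> ?R" "d \<in> ?X" for d e
    proof (rule ccontr)
      assume n: "e \<notin> ?X"
      have de: "(d, e) \<in> E" "h d = h e" "d \<in> A" "h d = h x" using that by (auto simp: mono_arcs_def)
      then have "e \<notin> A" using n by auto
      then have "(d, e) \<in> out_cut E A" using de by (auto simp: out_cut_def)
      then have "e = a \<or> (d, e) = (t, u)" using tu by auto
      moreover have "e \<noteq> a" using de False ha by auto
      ultimately have e: "d = t" "e = u" by auto
      then have "p (g u) = f t" using de \<open>e \<notin> A\<close> by (simp add: h_def)
      then have "g u = g a" using p(4) by blast
      then have "h e = f a" using e \<open>e \<notin> A\<close> p(3) by (simp add: h_def)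
      then show False using de False by simp
    qed
    then have "(x, x) \<in> (?R \<inter> ?X \<times> ?X)\<^sup>+" using trancl_stays_in[OF x(2), of ?X] x(1) by blast
    moreover have "?R \<inter> ?X \<times> ?X \<subseteq> mono_arcs ?E1 f"
    proof
      fix e assume e: "e \<in> ?R \<inter> ?X \<times> ?X"
      obtain y z where yz: "e = (y, z)" by force
      then have "y \<in> A" "z \<in> A" "(y, z) \<in> E" "h y = h z" using e by (auto simp: mono_arcs_def)
      moreover have "y \<noteq> z" using calculation crit_sepD(2)[OF E] by auto
      ultimately have "(y, z) \<in> ?E1" using contract_toI[of y z E A a] by (simp add: squash_def)
      then show "e \<in> mono_arcs ?E1 f" using \<open>y \<in> A\<close> \<open>z \<in> A\<close> \<open>h y = h z\<close> yz by (simp add: mono_arcs_def h_def)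
    qed
    ultimately have "(x, x) \<in> (mono_arcs ?E1 f)\<^sup>+" using trancl_mono by blast
    then show False using acf by (simp add: acyclic_def)
  qed
  have "acyclic ?R"
  proof (unfold acyclic_def, intro allI notI)
    fix z assume z: "(z, z) \<in> ?R\<^sup>+"
    from trancl_meets_or_avoids[OF this, of A] show False
    proof
      assume "\<exists>b\<in>A. (z, b) \<in> ?R\<^sup>* \<and> (b, z) \<in> ?R\<^sup>*"
      then obtain b where "b \<in> A" "(z, b) \<in> ?R\<^sup>*" "(b, z) \<in> ?R\<^sup>*" by blast
      then show False using no[of b] z by (meson rtrancl_trancl_trancl trancl_rtrancl_trancl)
    next
      assume "(z, z) \<in> (?R \<inter> (- A) \<times> (- A))\<^sup>+"
      moreover have "?R \<inter> (- A) \<times> (- A) = mono_arcs (induced E (- A)) g"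
        using p(1) by (auto simp: mono_arcs_def induced_def h_def inj_eq)
      ultimately show False using g by (simp add: kcol_def acyclic_def)
    qed
  qed
  moreover have "\<forall>v. h v < k" using lt p by (simp add: h_def)
  ultimately show False using crit_sepD(3)[OF E] colourableI by blast
qed

text \<open>Connectedness of the underlying graph on \<open>A\<close>, phrased by cuts so that a
  failure directly provides a part \<open>P\<close> without arcs to the rest of
  \<open>A\<close>.\<close>

definition linked :: "'a rel \<Rightarrow> 'a set \<Rightarrow> bool" where
  "linked E A \<longleftrightarrow> (\<forall>P. P \<subseteq> A \<longrightarrow> P \<noteq> {} \<longrightarrow> P \<noteq> A \<longrightarrow> (\<exists>x\<in>P. \<exists>y\<in>A - P. (x, y) \<in> E \<or> (y, x) \<in> E))"

lemma crit_sep_two_conn: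
  assumes E: "crit_sep k E"
  shows "two_conn (Field E) E"
  unfolding two_conn_def
proof (intro ballI allI impI, rule ccontr)
  fix a A assume a: "a \<in> Field E" and A: "A \<subseteq> Field E - {a}" "A \<noteq> {}" "A \<noteq> Field E - {a}"
    and n: "\<not> (\<exists>x\<in>A. \<exists>y\<in>Field E - {a} - A. (x, y) \<in> E \<or> (y, x) \<in> E)"
  show False
  proof (rule crit_sep_no_cutvertex[OF E, of A a])
    show "A \<inter> Field E \<noteq> {}" "Field E - A - {a} \<noteq> {}" "a \<notin> A" using A by auto
    show "out_cut E A \<subseteq> A \<times> {a}" using n by (auto simp: out_cut_def Field_def)
    show "out_cut E (- A) \<subseteq> {a} \<times> A" using n by (auto simp: out_cut_def Field_def)
  qed
qed

lemma card_le_1_subset: "finite S \<Longrightarrow> card S \<le> 1 \<Longrightarrow> \<exists>x. S \<subseteq> {x}"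
  by (metis One_nat_def card_le_Suc0_iff_eq empty_subsetI insertI1 subsetI subset_singletonD singletonI equals0I)

lemma splits_commute: "splits E a A B \<Longrightarrow> splits E a B A"
  by (auto simp: splits_def)

lemma splits_arcs:
  assumes E: "crit_sep k E" and s: "splits E a A B"
  obtains t u v w where "E \<inter> A \<times> B \<subseteq> {(t, u)}" "E \<inter> B \<times> A \<subseteq> {(v, w)}"
proof -
  have "finite (E \<inter> A \<times> B)" "finite (E \<inter> B \<times> A)" using crit_sepD(1)[OF E] by auto
  then show ?thesis
    using card_le_1_subset[of "E \<inter> A \<times> B"] card_le_1_subset[of "E \<inter> B \<times> A"] s that
    unfolding splits_def by (metis prod.collapse)
qed

lemma contract_to_eq:
  assumes E: "crit_sep k E" and s: "splits E a A B"
  shows "contract_to E A a = induced E (A \<union> {a}) \<union> {(x, a) | x. \<exists>y. (x, y) \<in> E \<inter> A \<times> B}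
    \<union> {(a, y) | y. \<exists>x. (x, y) \<in> E \<inter> B \<times> A}"
proof (intro equalityI subsetI)
  note sp = s[unfolded splits_def]
  fix e assume "e \<in> contract_to E A a"
  then obtain x y where xy: "e = (squash A a x, squash A a y)" "(x, y) \<in> E" "squash A a x \<noteq> squash A a y"
    by (auto simp: contract_to_def)
  have V: "x \<in> A \<union> B \<union> {a}" "y \<in> A \<union> B \<union> {a}" using sp xy(2) by (auto simp: Field_def)
  show "e \<in> induced E (A \<union> {a}) \<union> {(x, a) | x. \<exists>y. (x, y) \<in> E \<inter> A \<times> B}
    \<union> {(a, y) | y. \<exists>x. (x, y) \<in> E \<inter> B \<times> A}"
    using xy V sp by (auto simp: squash_def induced_def split: if_splits)
next
  note sp = s[unfolded splits_def]
  fix e assume "e \<in> induced E (A \<union> {a}) \<union> {(x, a) | x. \<exists>y. (x, y) \<in> E \<inter> A \<times> B}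
    \<union> {(a, y) | y. \<exists>x. (x, y) \<in> E \<inter> B \<times> A}"
  then consider x y where "e = (x, y)" "(x, y) \<in> E" "x \<in> A \<union> {a}" "y \<in> A \<union> {a}"
    | x y where "e = (x, a)" "(x, y) \<in> E" "x \<in> A" "y \<in> B"
    | x y where "e = (a, y)" "(x, y) \<in> E" "x \<in> B" "y \<in> A" by (auto simp: induced_def)
  then show "e \<in> contract_to E A a"
  proof cases
    case (1 x y)
    have "x \<noteq> y" using 1 crit_sepD(2)[OF E] by auto
    then show ?thesis using contract_toI[OF 1(2), of A a] 1 sp by (auto simp: squash_def split: if_splits)
  next
    case (2 x y)
    then have "y \<notin> A" "x \<noteq> a" using sp by blast+
    then show ?thesis using contract_toI[OF 2(2), of A a] 2 by (simp add: squash_def)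
  next
    case (3 x y)
    then have "x \<notin> A" "y \<noteq> a" using sp by blast+
    then show ?thesis using contract_toI[OF 3(2), of A a] 3 by (simp add: squash_def)
  qed
qed

text \<open>Strong connectivity and 2-connectivity carry over along \<open>squash\<close>, except
  that deleting \<open>a\<close> itself requires \<open>A\<close> to be linked. For the cuts, the
  arcs that contraction adds at \<open>a\<close> stand for paths through \<open>B\<close>; these
  exist because a set inside \<open>B\<close> left, or entered, by at most one arc would violate the
  lower bound \<open>k\<close>.\<close>

lemma contract_extremal_rel:
  assumes E: "crit_sep k E" and k: "3 \<le> k" and s: "splits E a A B" and conn: "linked E A"
  shows "extremal_rel k (A \<union> {a}) (contract_to E A a)"
proof -
  have k1: "1 \<le> k" using k by simp
  let ?E1 = "contract_to E A a"
  let ?V1 = "A \<union> {a}"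
  let ?F = "induced E (A \<union> {a})"
  note sp = s[unfolded splits_def]
  note irr = crit_sepD(2)[OF E]
  have finV: "finite (Field E)" using crit_sepD(1)[OF E] by (simp add: finite_Field)
  obtain t u v w where tu: "E \<inter> A \<times> B \<subseteq> {(t, u)}" and vw: "E \<inter> B \<times> A \<subseteq> {(v, w)}"
    using splits_arcs[OF E s] by blast
  have V: "Field E = A \<union> B \<union> {a}" using sp by auto
  have nbr: "x \<in> A \<union> B \<union> {a}" "y \<in> A \<union> B \<union> {a}" if "(x, y) \<in> E" for x y
    using that V by (auto simp: Field_def)
  have sqV: "squash A a z \<in> ?V1" for z by (simp add: squash_def)
  have sqid: "squash A a z = z" if "z \<in> ?V1" for z using that sp by (auto simp: squash_def)
  have nc: "\<not> colourable k ?E1"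
  proof (rule contract_not_colourable[OF E k])
    show "a \<notin> A" "a \<in> Field E" "A \<inter> Field E \<noteq> {}" using sp by auto
    show "out_cut E A \<subseteq> A \<times> {a} \<union> {(t, u)}"
    proof
      fix e assume "e \<in> out_cut E A"
      then obtain x y where "e = (x, y)" "(x, y) \<in> E" "x \<in> A" "y \<notin> A" by (auto simp: out_cut_def)
      then show "e \<in> A \<times> {a} \<union> {(t, u)}" using nbr(2)[of x y] tu by auto
    qed
  qed
  have fin1: "finite ?V1" using finV V by (auto intro: finite_subset)
  have E1V: "?E1 \<subseteq> ?V1 \<times> ?V1" using sqV by (auto simp: contract_to_def)
  have irr1: "(x, x) \<notin> ?E1" for x by (auto simp: contract_to_def)
  have card3: "3 \<le> card ?V1"
    using few_vertices_colourable[OF fin1 E1V _ k1 irr1] nc k by fastforce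
  have walk: "(squash A a x, squash A a y) \<in> ?E1\<^sup>*" if "(x, y) \<in> E\<^sup>*" for x y
    using that
  proof (induction rule: rtrancl_induct)
    case (step y z)
    then show ?case using contract_toI[of y z E A a]
      by (cases "squash A a y = squash A a z") (auto intro: rtrancl_into_rtrancl)
  qed simp
  have strong: "(x, y) \<in> ?E1\<^sup>*" if "x \<in> ?V1" "y \<in> ?V1" for x y
    using walk[OF crit_sep_strong[OF E k1, of x y]] sqid that V by auto
  have conn2: "two_conn ?V1 ?E1"
    unfolding two_conn_def
  proof (intro ballI allI impI)
    fix z P assume z: "z \<in> ?V1" and P: "P \<subseteq> ?V1 - {z}" "P \<noteq> {}" "P \<noteq> ?V1 - {z}"
    show "\<exists>x\<in>P. \<exists>y\<in>?V1 - {z} - P. (x, y) \<in> ?E1 \<or> (y, x) \<in> ?E1"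
    proof (cases "z = a")
      case True
      then have "P \<subseteq> A" "P \<noteq> A" using P sp by auto
      then obtain x y where xy: "x \<in> P" "y \<in> A - P" "(x, y) \<in> E \<or> (y, x) \<in> E"
        using conn P unfolding linked_def by blast
      then have "x \<noteq> y" "x \<in> A" "y \<in> A" using \<open>P \<subseteq> A\<close> by auto
      then have "(x, y) \<in> ?E1 \<or> (y, x) \<in> ?E1"
        using xy(3) contract_toI[of x y E A a] contract_toI[of y x E A a] by (auto simp: squash_def)
      then show ?thesis using xy True sp by auto
    next
      case False
      then have zA: "z \<in> A" using z by simp
      let ?P = "{x \<in> Field E. squash A a x \<in> P}"
      have "z \<notin> P" using P(1) by blast
      then have PV: "?P \<subseteq> Field E - {z}" using sqid[of z] zA by auto
      obtain y0 where y0: "y0 \<in> P" using P(2) by blast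
      then have "y0 \<in> ?V1" using P(1) by blast
      then have "y0 \<in> ?P" using y0 sqid[of y0] V by auto
      then have "?P \<noteq> {}" by blast
      moreover have "?P \<noteq> Field E - {z}"
      proof -
        obtain y where y: "y \<in> ?V1" "y \<noteq> z" "y \<notin> P" using P(1,3) by blast
        then have "y \<in> Field E - {z}" using V by blast
        moreover have "y \<notin> ?P" using y(3) sqid[OF y(1)] by simp
        ultimately show ?thesis by blast
      qed
      moreover have "z \<in> Field E" using zA V by simp
      ultimately have "\<exists>x\<in>?P. \<exists>y\<in>Field E - {z} - ?P. (x, y) \<in> E \<or> (y, x) \<in> E"
        using crit_sep_two_conn[OF E, unfolded two_conn_def, rule_format, of z ?P] PV by simp
      then obtain x y where xy: "x \<in> ?P" "y \<in> Field E - {z} - ?P" "(x, y) \<in> E \<or> (y, x) \<in> E"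
        by (elim bexE)
      have x': "squash A a x \<in> P" and y': "squash A a y \<notin> P" using xy by auto
      have "squash A a y \<noteq> z" using xy False by (auto simp: squash_def)
      then have "squash A a y \<in> ?V1 - {z} - P" using y' sqV by blast
      moreover have "squash A a x \<noteq> squash A a y" using x' y' by auto
      then have "(squash A a x, squash A a y) \<in> ?E1 \<or> (squash A a y, squash A a x) \<in> ?E1"
        using xy(3) contract_toI[of x y E A a] contract_toI[of y x E A a] by auto
      ultimately show ?thesis using x' by blast
    qed
  qed
  have FE: "?F \<subseteq> E" by (auto simp: induced_def)
  have BF: "induced E (B \<union> {a}) \<subseteq> E - ?F"
    using irr sp by (auto simp: induced_def)
  have to_a: "(x, a) \<in> (E - ?F)\<^sup>*" if x: "x \<in> B" for x
  proof (rule ccontr)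
    assume n: "(x, a) \<notin> (E - ?F)\<^sup>*"
    let ?Z = "{z. (x, z) \<in> (induced E (B \<union> {a}))\<^sup>*}"
    have aZ: "a \<notin> ?Z" using n rtrancl_mono[OF BF] by blast
    have "z \<in> B \<union> {a}" if "(x, z) \<in> (induced E (B \<union> {a}))\<^sup>*" for z
      using that by (induction rule: rtrancl_induct) (use x in \<open>auto simp: induced_def\<close>)
    then have ZB: "?Z \<subseteq> B" using aZ by blast
    have "out_cut E ?Z \<subseteq> E \<inter> B \<times> A"
    proof
      fix e assume "e \<in> out_cut E ?Z"
      then obtain p q where pq: "e = (p, q)" "(p, q) \<in> E" "p \<in> ?Z" "q \<notin> ?Z" by (auto simp: out_cut_def)
      have "q \<in> A"
      proof (rule ccontr)
        assume "q \<notin> A"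
        then have "(p, q) \<in> induced E (B \<union> {a})" using nbr[OF pq(2)] ZB pq by (auto simp: induced_def)
        then show False using pq by (auto intro: rtrancl_into_rtrancl)
      qed
      then show "e \<in> E \<inter> B \<times> A" using pq ZB by blast
    qed
    then have "card (out_cut E ?Z) \<le> 1"
      using sp crit_sepD(1)[OF E] by (meson card_mono finite_Int le_trans)
    moreover have "k \<le> card (out_cut E ?Z)"
    proof (rule crit_sep_cut_ge[OF E k1])
      show "?Z \<inter> Field E \<noteq> {}" using x V by auto
      show "Field E - ?Z \<noteq> {}" using aZ V by auto
    qed
    ultimately show False using k by simp
  qed
  have from_a: "(a, x) \<in> (E - ?F)\<^sup>*" if x: "x \<in> B" for x
  proof (rule ccontr)
    assume n: "(a, x) \<notin> (E - ?F)\<^sup>*"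
    let ?Z = "{z. (z, x) \<in> (induced E (B \<union> {a}))\<^sup>*}"
    have aZ: "a \<notin> ?Z" using n rtrancl_mono[OF BF] by blast
    have "z \<in> B \<union> {a}" if "(z, x) \<in> (induced E (B \<union> {a}))\<^sup>*" for z
      using that by (induction rule: converse_rtrancl_induct) (use x in \<open>auto simp: induced_def\<close>)
    then have ZB: "?Z \<subseteq> B" using aZ by blast
    have "out_cut E (- ?Z) \<subseteq> E \<inter> A \<times> B"
    proof
      fix e assume "e \<in> out_cut E (- ?Z)"
      then obtain p q where pq: "e = (p, q)" "(p, q) \<in> E" "p \<notin> ?Z" "q \<in> ?Z" by (auto simp: out_cut_def)
      have "p \<in> A"
      proof (rule ccontr)
        assume "p \<notin> A"
        then have "(p, q) \<in> induced E (B \<union> {a})" using nbr[OF pq(2)] ZB pq by (auto simp: induced_def)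
        then show False using pq by (auto intro: converse_rtrancl_into_rtrancl)
      qed
      then show "e \<in> E \<inter> A \<times> B" using pq ZB by blast
    qed
    then have "card (out_cut E (- ?Z)) \<le> 1"
      using sp crit_sepD(1)[OF E] by (meson card_mono finite_Int le_trans)
    moreover have "k \<le> card (out_cut E (- ?Z))"
    proof (rule crit_sep_cut_ge[OF E k1])
      show "- ?Z \<inter> Field E \<noteq> {}" using aZ V by auto
      show "Field E - - ?Z \<noteq> {}" using x V by auto
    qed
    ultimately show False using k by simp
  qed
  have E1eq: "?E1 = ?F \<union> {(x, a) | x. \<exists>y. (x, y) \<in> E \<inter> A \<times> B} \<union> {(a, y) | y. \<exists>x. (x, y) \<in> E \<inter> B \<times> A}"
    by (rule contract_to_eq[OF E s])
  have sub: "?E1 \<subseteq> ?F \<union> {(t, a), (a, w)}"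
    unfolding E1eq using tu vw by blast
  have "sep_le k ?V1 ?E1"
    unfolding sep_le_def
  proof (intro ballI impI)
    fix x y assume xy: "x \<in> ?V1" "y \<in> ?V1" "x \<noteq> y"
    then obtain X where "x \<in> X" "y \<notin> X" "card (out_cut E X) \<le> k" using crit_sepD(5)[OF E _ _ xy(3)] V by blast
    moreover have "card (out_cut ?E1 X) \<le> card (out_cut E X)"
    proof (rule card_cut_replace[OF crit_sepD(1)[OF E] FE sub])
      assume "(t, a) \<in> ?E1 - ?F"
      then obtain y where "(t, y) \<in> E" "t \<in> A" "y \<in> B" unfolding E1eq using sp by blast
      moreover from this have "(t, y) \<in> E - ?F" using sp by (auto simp: induced_def)
      ultimately show "(t, a) \<in> (E - ?F)\<^sup>*" using to_a by (meson converse_rtrancl_into_rtrancl)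
    next
      assume "(a, w) \<in> ?E1 - ?F"
      then obtain y where "(y, w) \<in> E" "w \<in> A" "y \<in> B" unfolding E1eq using sp by blast
      moreover from this have "(y, w) \<in> E - ?F" using sp by (auto simp: induced_def)
      ultimately show "(a, w) \<in> (E - ?F)\<^sup>*" using from_a by (meson rtrancl.rtrancl_into_rtrancl)
    qed
    ultimately show "\<exists>X. x \<in> X \<and> y \<notin> X \<and> card (out_cut ?E1 X) \<le> k" by (meson le_trans)
  qed
  then show ?thesis unfolding extremal_rel_def using fin1 E1V irr1 card3 strong conn2 nc by blast
qed

section \<open>From splits to directed Hajos joins and bijoins\<close>

lemma isolated_part:
  assumes E: "crit_sep k E" and s: "splits E a A B" and P: "P \<subseteq> A" "P \<noteq> {}"
    and no: "\<not> (\<exists>x\<in>P. \<exists>y\<in>A - P. (x, y) \<in> E \<or> (y, x) \<in> E)" "E \<inter> P \<times> B = {}" "E \<inter> B \<times> P = {}"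
  shows False
proof (rule crit_sep_no_cutvertex[OF E, of P a])
  note sp = s[unfolded splits_def]
  show "P \<inter> Field E \<noteq> {}" "Field E - P - {a} \<noteq> {}" "a \<notin> P" using sp P by blast+
  have nbr: "x \<in> A \<union> B \<union> {a}" "y \<in> A \<union> B \<union> {a}" if "(x, y) \<in> E" for x y
    using that sp by (auto simp: Field_def)
  show "out_cut E P \<subseteq> P \<times> {a}"
  proof
    fix e assume "e \<in> out_cut E P"
    then obtain x y where xy: "e = (x, y)" "(x, y) \<in> E" "x \<in> P" "y \<notin> P" by (auto simp: out_cut_def)
    then have "y \<notin> A" "y \<notin> B" using no by blast+
    then show "e \<in> P \<times> {a}" using nbr[OF xy(2)] xy by auto
  qed
  show "out_cut E (- P) \<subseteq> {a} \<times> P"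
  proof
    fix e assume "e \<in> out_cut E (- P)"
    then obtain x y where xy: "e = (x, y)" "(x, y) \<in> E" "x \<notin> P" "y \<in> P" by (auto simp: out_cut_def)
    then have "x \<notin> A" "x \<notin> B" using no by blast+
    then show "e \<in> {a} \<times> P" using nbr[OF xy(2)] xy by auto
  qed
qed

text \<open>All arcs between the parts meet \<open>A\<close> in \<open>t\<close>, so a piece of
  \<open>A\<close> without \<open>t\<close> would hang on \<open>a\<close> alone.\<close>

lemma single_contact_linked:
  assumes E: "crit_sep k E" and s: "splits E a A B"
    and c: "E \<inter> A \<times> B \<subseteq> {(t, u)}" "E \<inter> B \<times> A \<subseteq> {(u, t)}"
  shows "linked E A"
  unfolding linked_def
proof (intro allI impI, rule ccontr)
  fix P assume P: "P \<subseteq> A" "P \<noteq> {}" "P \<noteq> A" and n: "\<not> (\<exists>x\<in>P. \<exists>y\<in>A - P. (x, y) \<in> E \<or> (y, x) \<in> E)"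
  show False
  proof (cases "t \<in> P")
    case False
    show False
      by (rule isolated_part[OF E s P(1,2) n]) (use c P False in blast)+
  next
    case True
    have "A - (A - P) = P" using P by blast
    then have n': "\<not> (\<exists>x\<in>A - P. \<exists>y\<in>A - (A - P). (x, y) \<in> E \<or> (y, x) \<in> E)" using n by auto
    show False
      by (rule isolated_part[OF E s _ _ n']) (use c P True in blast)+
  qed
qed

text \<open>The join is described inside \<open>E\<close>, before any disjoint union is formed. As
  \<open>(t, a)\<close> and \<open>(a, u)\<close> are no arcs of \<open>E\<close>, deleting them
  from the two extremal parts gives back the induced subdigraphs.\<close>

definition hajos_split :: "nat \<Rightarrow> 'a rel \<Rightarrow> 'a \<Rightarrow> 'a set \<Rightarrow> 'a set \<Rightarrow> 'a \<Rightarrow> 'a \<Rightarrow> bool" where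
  "hajos_split k E a A B t u \<longleftrightarrow> a \<notin> A \<and> a \<notin> B \<and> A \<inter> B = {} \<and> A \<union> B \<union> {a} = Field E \<and> t \<in> A \<and> u \<in> B
     \<and> (t, a) \<notin> E \<and> (a, u) \<notin> E \<and> E = induced E (A \<union> {a}) \<union> induced E (B \<union> {a}) \<union> {(t, u)}
     \<and> extremal_rel k (A \<union> {a}) (induced E (A \<union> {a}) \<union> {(t, a)}) \<and> extremal_rel k (B \<union> {a}) (induced E (B \<union> {a}) \<union> {(a, u)})"

text \<open>The two \<open>linked\<close> conditions supply the component conditions of a
  bijoin.\<close>

definition bijoin_split ::
  "nat \<Rightarrow> 'a rel \<Rightarrow> 'a \<Rightarrow> 'a set \<Rightarrow> 'a set \<Rightarrow> 'a \<Rightarrow> 'a \<Rightarrow> 'a \<Rightarrow> 'a \<Rightarrow> bool" where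
  "bijoin_split k E a A B t u v w \<longleftrightarrow> a \<notin> A \<and> a \<notin> B \<and> A \<inter> B = {} \<and> A \<union> B \<union> {a} = Field E
     \<and> t \<in> A \<and> u \<in> B \<and> v \<in> B \<and> w \<in> A \<and> linked E A \<and> linked E B
     \<and> (t, a) \<notin> E \<and> (a, w) \<notin> E \<and> (v, a) \<notin> E \<and> (a, u) \<notin> E
     \<and> E = induced E (A \<union> {a}) \<union> induced E (B \<union> {a}) \<union> {(t, u), (v, w)}
     \<and> extremal_rel k (A \<union> {a}) (induced E (A \<union> {a}) \<union> {(t, a), (a, w)})
     \<and> extremal_rel k (B \<union> {a}) (induced E (B \<union> {a}) \<union> {(v, a), (a, u)})"

lemma splits_union:
  assumes s: "splits E a A B"
  shows "E = induced E (A \<union> {a}) \<union> induced E (B \<union> {a}) \<union> (E \<inter> A \<times> B) \<union> (E \<inter> B \<times> A)"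
proof -
  have "x \<in> A \<union> B \<union> {a} \<and> y \<in> A \<union> B \<union> {a}" if "(x, y) \<in> E" for x y
    using that s unfolding splits_def by (auto simp: Field_def)
  then show ?thesis by (auto simp: induced_def)
qed

lemma splits_ind_colourable:
  assumes E: "crit_sep k E" and s: "splits E a A B"
  shows "colourable k (induced E (A \<union> {a}))"
proof -
  obtain b where "b \<in> Field E" "b \<notin> A \<union> {a}" using s unfolding splits_def by blast
  then show ?thesis by (rule crit_sepD(4)[OF E ind_psubset])
qed

text \<open>The arcs added at \<open>a\<close> are new: otherwise a contraction would coincide with
  a proper induced subdigraph of \<open>E\<close> and be colourable.\<close>

lemma one_way_split:
  assumes E: "crit_sep k E" and k: "3 \<le> k" and s: "splits E a A B"
    and tu: "E \<inter> A \<times> B = {(t, u)}" and no: "E \<inter> B \<times> A = {}"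
  shows "hajos_split k E a A B t u"
proof -
  note sp = s[unfolded splits_def]
  note s' = splits_commute[OF s]
  have lA: "linked E A" by (rule single_contact_linked[OF E s, of t u]) (use tu no in auto)
  have lB: "linked E B" by (rule single_contact_linked[OF E s', of u t]) (use tu no in auto)
  have "{(x, a) | x. \<exists>y. (x, y) \<in> E \<inter> A \<times> B} = {(t, a)}" "{(a, y) | y. \<exists>x. (x, y) \<in> E \<inter> A \<times> B} = {(a, u)}"
    unfolding tu by auto
  then have 1: "extremal_rel k (A \<union> {a}) (induced E (A \<union> {a}) \<union> {(t, a)})"
    and 2: "extremal_rel k (B \<union> {a}) (induced E (B \<union> {a}) \<union> {(a, u)})"
    using contract_extremal_rel[OF E k s lA] contract_extremal_rel[OF E k s' lB] no
    unfolding contract_to_eq[OF E s] contract_to_eq[OF E s'] by simp_all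
  have tuAB: "t \<in> A" "u \<in> B" using tu by auto
  have "(t, a) \<notin> E"
  proof
    assume "(t, a) \<in> E"
    then have "induced E (A \<union> {a}) \<union> {(t, a)} = induced E (A \<union> {a})" using tuAB by (auto simp: induced_def)
    then show False using extremal_relD(7)[OF 1] splits_ind_colourable[OF E s] by simp
  qed
  moreover have "(a, u) \<notin> E"
  proof
    assume "(a, u) \<in> E"
    then have "induced E (B \<union> {a}) \<union> {(a, u)} = induced E (B \<union> {a})" using tuAB by (auto simp: induced_def)
    then show False using extremal_relD(7)[OF 2] splits_ind_colourable[OF E s'] by simp
  qed
  moreover have "E = induced E (A \<union> {a}) \<union> induced E (B \<union> {a}) \<union> {(t, u)}"
    using splits_union[OF s] tu no by simp
  ultimately show ?thesis unfolding hajos_split_def using sp tuAB 1 2 by simp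
qed

text \<open>Both \<open>E\<close> and the contraction are balanced at \<open>A\<close>, so \<open>ta\<close> and \<open>aw\<close> are either both arcs of
  \<open>E\<close> or both absent from it.\<close>

lemma bijoin_arcs_new:
  assumes E: "crit_sep k E" and k: "1 \<le> k" and s: "splits E a A B"
    and tu: "E \<inter> A \<times> B = {(t, u)}" and vw: "E \<inter> B \<times> A = {(v, w)}"
    and c: "extremal_rel k (A \<union> {a}) (induced E (A \<union> {a}) \<union> {(t, a), (a, w)})"
  shows "(t, a) \<notin> E \<and> (a, w) \<notin> E"
proof -
  let ?E1 = "induced E (A \<union> {a}) \<union> {(t, a), (a, w)}"
  note sp = s[unfolded splits_def]
  have E1: "crit_sep k ?E1" using extremal_rel_crit_sep[OF c k] by simp
  have fin: "finite E" using crit_sepD(1)[OF E] .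
  have tw: "t \<in> A" "w \<in> A" "u \<in> B" "v \<in> B" using tu vw by auto
  have nbr: "x \<in> A \<union> B \<union> {a}" "y \<in> A \<union> B \<union> {a}" if "(x, y) \<in> E" for x y
    using that sp by (auto simp: Field_def)
  have u: "u \<noteq> a" "v \<noteq> a" using tw sp by auto
  have cA: "out_cut E A = insert (t, u) (E \<inter> A \<times> {a})"
  proof
    show "out_cut E A \<subseteq> insert (t, u) (E \<inter> A \<times> {a})"
    proof
      fix e assume "e \<in> out_cut E A"
      then obtain x y where xy: "e = (x, y)" "(x, y) \<in> E" "x \<in> A" "y \<notin> A" by (auto simp: out_cut_def)
      then show "e \<in> insert (t, u) (E \<inter> A \<times> {a})" using nbr(2)[OF xy(2)] tu by auto
    qed
    show "insert (t, u) (E \<inter> A \<times> {a}) \<subseteq> out_cut E A" using tu sp tw by (auto simp: out_cut_def)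
  qed
  have cB: "out_cut E (- A) = insert (v, w) (E \<inter> {a} \<times> A)"
  proof
    show "out_cut E (- A) \<subseteq> insert (v, w) (E \<inter> {a} \<times> A)"
    proof
      fix e assume "e \<in> out_cut E (- A)"
      then obtain x y where xy: "e = (x, y)" "(x, y) \<in> E" "x \<notin> A" "y \<in> A" by (auto simp: out_cut_def)
      then show "e \<in> insert (v, w) (E \<inter> {a} \<times> A)" using nbr(1)[OF xy(2)] vw by auto
    qed
    show "insert (v, w) (E \<inter> {a} \<times> A) \<subseteq> out_cut E (- A)" using vw sp tw by (auto simp: out_cut_def)
  qed
  have "card (E \<inter> A \<times> {a}) = card (E \<inter> {a} \<times> A)"
    using crit_sep_balanced[OF E k, of A] u fin unfolding cA cB by simp
  moreover have "out_cut ?E1 A = insert (t, a) (E \<inter> A \<times> {a})" "out_cut ?E1 (- A) = insert (a, w) (E \<inter> {a} \<times> A)"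
    using sp tw by (auto simp: out_cut_def induced_def)
  then have "card (insert (t, a) (E \<inter> A \<times> {a})) = card (insert (a, w) (E \<inter> {a} \<times> A))"
    using crit_sep_balanced[OF E1 k, of A] by simp
  ultimately have iff: "(t, a) \<in> E \<longleftrightarrow> (a, w) \<in> E"
    using tw fin by (auto simp: card_insert_if split: if_splits)
  have "\<not> ((t, a) \<in> E \<and> (a, w) \<in> E)"
  proof
    assume "(t, a) \<in> E \<and> (a, w) \<in> E"
    then have "?E1 = induced E (A \<union> {a})" using tw by (auto simp: induced_def)
    then show False using extremal_relD(7)[OF c] splits_ind_colourable[OF E s] by simp
  qed
  then show ?thesis using iff by blast
qed

text \<open>When \<open>A\<close> falls apart, \<open>t\<close> and \<open>w\<close> lie in
  different pieces, since a piece with neither would hang on \<open>a\<close> alone. Moving the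
  piece without \<open>t\<close> over to \<open>B\<close> leaves \<open>(t, u)\<close> as the only
  crossing arc.\<close>

lemma unlinked_one_way:
  assumes E: "crit_sep k E" and k: "3 \<le> k" and s: "splits E a A B"
    and tu: "E \<inter> A \<times> B = {(t, u)}" and vw: "E \<inter> B \<times> A = {(v, w)}" and nl: "\<not> linked E A"
  shows "\<exists>a A B t u. hajos_split k E a A B t u"
proof -
  note sp = s[unfolded splits_def]
  obtain P where P: "P \<subseteq> A" "P \<noteq> {}" "P \<noteq> A" and n: "\<not> (\<exists>x\<in>P. \<exists>y\<in>A - P. (x, y) \<in> E \<or> (y, x) \<in> E)"
    using nl unfolding linked_def by blast
  let ?Q = "A - P"
  have Q: "?Q \<subseteq> A" "?Q \<noteq> {}" "A - ?Q = P" using P by blast+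
  have n': "\<not> (\<exists>x\<in>?Q. \<exists>y\<in>A - ?Q. (x, y) \<in> E \<or> (y, x) \<in> E)" using n Q(3) by auto
  have tw: "t \<in> A" "w \<in> A" using tu vw by auto
  have splitP: "splits E a S (B \<union> (A - S))" "E \<inter> S \<times> (B \<union> (A - S)) = E \<inter> S \<times> B"
     "E \<inter> (B \<union> (A - S)) \<times> S = E \<inter> B \<times> S"
    if S: "S \<subseteq> A" "S \<noteq> {}" "\<not> (\<exists>x\<in>S. \<exists>y\<in>A - S. (x, y) \<in> E \<or> (y, x) \<in> E)" for S
  proof -
    show 1: "E \<inter> S \<times> (B \<union> (A - S)) = E \<inter> S \<times> B" "E \<inter> (B \<union> (A - S)) \<times> S = E \<inter> B \<times> S"
      using S by auto
    have sub: "E \<inter> S \<times> B \<subseteq> E \<inter> A \<times> B" "E \<inter> B \<times> S \<subseteq> E \<inter> B \<times> A" using S by auto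
    have "finite E" using crit_sepD(1)[OF E] .
    then have "card (E \<inter> S \<times> B) \<le> 1" "card (E \<inter> B \<times> S) \<le> 1"
      using sub sp card_mono[of "E \<inter> A \<times> B" "E \<inter> S \<times> B"] card_mono[of "E \<inter> B \<times> A" "E \<inter> B \<times> S"] by auto
    then show "splits E a S (B \<union> (A - S))" unfolding splits_def 1 using sp S by auto
  qed
  have go: "\<exists>a A B t u. hajos_split k E a A B t u"
    if S: "S \<subseteq> A" "S \<noteq> {}" "\<not> (\<exists>x\<in>S. \<exists>y\<in>A - S. (x, y) \<in> E \<or> (y, x) \<in> E)" "t \<in> S" "w \<notin> S" for S
  proof -
    have "E \<inter> S \<times> B = (E \<inter> A \<times> B) \<inter> S \<times> UNIV" "E \<inter> B \<times> S = (E \<inter> B \<times> A) \<inter> UNIV \<times> S"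
      using S(1) by blast+
    then have "E \<inter> S \<times> B = {(t, u)}" "E \<inter> B \<times> S = {}" unfolding tu vw using S(4,5) by auto
    then show ?thesis using one_way_split[OF E k splitP(1)[OF S(1-3)], of t u] splitP(2,3)[OF S(1-3)] by auto
  qed
  show ?thesis
  proof (cases "t \<in> P")
    case tP: True
    show ?thesis
    proof (cases "w \<in> P")
      case True
      have "E \<inter> ?Q \<times> B = (E \<inter> A \<times> B) \<inter> ?Q \<times> UNIV" "E \<inter> B \<times> ?Q = (E \<inter> B \<times> A) \<inter> UNIV \<times> ?Q"
        by blast+
      then have "E \<inter> ?Q \<times> B = {}" "E \<inter> B \<times> ?Q = {}" unfolding tu vw using tP True by auto
      then show ?thesis using isolated_part[OF E s Q(1,2) n'] by blast
    next
      case False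
      then show ?thesis using go[OF P(1,2) n tP] by blast
    qed
  next
    case tP: False
    show ?thesis
    proof (cases "w \<in> P")
      case True
      then show ?thesis using go[OF Q(1,2) n'] tP tw by blast
    next
      case False
      have "E \<inter> P \<times> B = (E \<inter> A \<times> B) \<inter> P \<times> UNIV" "E \<inter> B \<times> P = (E \<inter> B \<times> A) \<inter> UNIV \<times> P"
        using P(1) by blast+
      then have "E \<inter> P \<times> B = {}" "E \<inter> B \<times> P = {}" unfolding tu vw using tP False by auto
      then show ?thesis using isolated_part[OF E s P(1,2) n] by blast
    qed
  qed
qed

lemma decomposable_cases:
  assumes E: "crit_sep k E" and k: "3 \<le> k" and d: "decomposable E"
  shows "(\<exists>a A B t u. hajos_split k E a A B t u) \<or> (\<exists>a A B t u v w. bijoin_split k E a A B t u v w)"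
proof -
  have k1: "1 \<le> k" using k by simp
  obtain a A B where s: "splits E a A B" using d by (auto simp: decomposable_def)
  note sp = s[unfolded splits_def]
  note s' = splits_commute[OF s]
  obtain t u v w where tu: "E \<inter> A \<times> B \<subseteq> {(t, u)}" and vw: "E \<inter> B \<times> A \<subseteq> {(v, w)}"
    using splits_arcs[OF E s] by blast
  consider "E \<inter> A \<times> B = {}" "E \<inter> B \<times> A = {}" | "E \<inter> A \<times> B = {(t, u)}" "E \<inter> B \<times> A = {}"
    | "E \<inter> A \<times> B = {}" "E \<inter> B \<times> A = {(v, w)}" | "E \<inter> A \<times> B = {(t, u)}" "E \<inter> B \<times> A = {(v, w)}"
    using tu vw by (meson subset_singletonD)
  then show ?thesis
  proof cases
    case 1
    then show ?thesis using isolated_part[OF E s, of A] sp by blast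
  next
    case 2
    then show ?thesis using one_way_split[OF E k s] by blast
  next
    case 3
    then show ?thesis using one_way_split[OF E k s'] by blast
  next
    case 4
    show ?thesis
    proof (cases "linked E A \<and> linked E B")
      case False
      then show ?thesis using unlinked_one_way[OF E k s 4] unlinked_one_way[OF E k s' 4(2,1)] by blast
    next
      case True
      have eqs: "{(x, a) | x. \<exists>y. (x, y) \<in> E \<inter> A \<times> B} = {(t, a)}" "{(a, y) | y. \<exists>x. (x, y) \<in> E \<inter> A \<times> B} = {(a, u)}"
        "{(x, a) | x. \<exists>y. (x, y) \<in> E \<inter> B \<times> A} = {(v, a)}" "{(a, y) | y. \<exists>x. (x, y) \<in> E \<inter> B \<times> A} = {(a, w)}"
        unfolding 4 by auto
      have 1: "extremal_rel k (A \<union> {a}) (induced E (A \<union> {a}) \<union> {(t, a), (a, w)})"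
        using contract_extremal_rel[OF E k s] True unfolding contract_to_eq[OF E s] eqs by (simp add: insert_commute)
      have 2: "extremal_rel k (B \<union> {a}) (induced E (B \<union> {a}) \<union> {(v, a), (a, u)})"
        using contract_extremal_rel[OF E k s'] True unfolding contract_to_eq[OF E s'] eqs by (simp add: insert_commute)
      have "E = induced E (A \<union> {a}) \<union> induced E (B \<union> {a}) \<union> {(t, u), (v, w)}"
        using splits_union[OF s] 4 by (simp add: insert_commute)
      moreover have "t \<in> A" "u \<in> B" "v \<in> B" "w \<in> A" using 4 by auto
      ultimately have "bijoin_split k E a A B t u v w"
        unfolding bijoin_split_def
        using sp True 1 2 bijoin_arcs_new[OF E k1 s 4 1] bijoin_arcs_new[OF E k1 s' 4(2,1) 2] by simp
      then show ?thesis by blast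
    qed
  qed
qed

section \<open>Menger's theorem for arc-disjoint paths\<close>

lemma excess_insert:
  assumes "finite F" "(x, y) \<notin> F" "x \<noteq> y"
  shows "excess (insert (x, y) F) z = excess F z + (if z = x then 1 else 0) - (if z = y then 1 else 0)"
proof -
  have fin: "finite (F `` {a})" "finite (F\<inverse> `` {a})" for a using assms by (auto simp: finite_Image)
  have "insert (x, y) F `` {z} = (if z = x then insert y (F `` {z}) else F `` {z})" by auto
  moreover have "(insert (x, y) F)\<inverse> `` {z} = (if z = y then insert x (F\<inverse> `` {z}) else F\<inverse> `` {z})" by auto
  ultimately show ?thesis using assms fin by (auto simp: excess_def)
qed

lemma excess_Diff:
  assumes "finite F" "A \<subseteq> F"
  shows "excess (F - A) z = excess F z - excess A z"
proof -
  have fin: "finite (F `` {z})" "finite (F\<inverse> `` {z})" using assms by (auto simp: finite_Image)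
  have sub: "A `` {z} \<subseteq> F `` {z}" "A\<inverse> `` {z} \<subseteq> F\<inverse> `` {z}" using assms by auto
  have "(F - A) `` {z} = F `` {z} - A `` {z}" "(F - A)\<inverse> `` {z} = F\<inverse> `` {z} - A\<inverse> `` {z}" by auto
  moreover have "card (F `` {z} - A `` {z}) = card (F `` {z}) - card (A `` {z})"
    "card (F\<inverse> `` {z} - A\<inverse> `` {z}) = card (F\<inverse> `` {z}) - card (A\<inverse> `` {z})"
    using sub fin by (auto intro!: card_Diff_subset intro: finite_subset)
  moreover have "card (A `` {z}) \<le> card (F `` {z})" "card (A\<inverse> `` {z}) \<le> card (F\<inverse> `` {z})"
    using sub fin by (auto intro: card_mono)
  ultimately show ?thesis by (simp add: excess_def)
qed

lemma excess_Diff_single: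
  assumes "finite F" "(x, y) \<in> F" "x \<noteq> y"
  shows "excess (F - {(x, y)}) z = excess F z - (if z = x then 1 else 0) + (if z = y then 1 else 0)"
  using excess_insert[of "F - {(x, y)}" x y z] assms by (simp add: insert_absorb)

text \<open>A flow with unit capacities is a set of arcs, and \<open>p\<close> is a path in the
  residual relation. The induction augments along the tail first; the last clause then guarantees
  that the arc for the first step is still in its original state.\<close>

lemma augment_flow:
  assumes "successively (\<lambda>a b. (a, b) \<in> (E - F) \<union> F\<inverse>) p" "distinct p" "p \<noteq> []"
    and F: "F \<subseteq> E" and fin: "finite E"
  shows "\<exists>F'\<subseteq>E. (\<forall>z. excess F' z = excess F z + (if z = hd p then 1 else 0) - (if z = last p then 1 else 0))
    \<and> (\<forall>a b. a \<notin> set p \<or> b \<notin> set p \<longrightarrow> ((a, b) \<in> F' \<longleftrightarrow> (a, b) \<in> F))"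
  using assms(1-3)
proof (induction p)
  case (Cons x r)
  show ?case
  proof (cases r)
    case Nil
    then show ?thesis using F by (intro exI[of _ F]) auto
  next
    case (Cons z s)
    have r: "successively (\<lambda>a b. (a, b) \<in> (E - F) \<union> F\<inverse>) r" "distinct r" "r \<noteq> []"
      and xz: "(x, z) \<in> (E - F) \<union> F\<inverse>" "x \<notin> set r" "x \<noteq> z"
      using Cons.prems Cons by auto
    from Cons.IH[OF r] obtain F' where F0: "F' \<subseteq> E"
      "\<forall>y. excess F' y = excess F y + (if y = hd r then 1 else 0) - (if y = last r then 1 else 0)"
      "\<forall>a b. a \<notin> set r \<or> b \<notin> set r \<longrightarrow> ((a, b) \<in> F' \<longleftrightarrow> (a, b) \<in> F)"
      by (elim exE conjE)
    have F': "F' \<subseteq> E" by (rule F0(1))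
    have F'2: "\<And>y. excess F' y = excess F y + (if y = z then 1 else 0) - (if y = last r then 1 else 0)"
      using F0(2) Cons by simp
    have F'3: "\<And>a b. a \<notin> set r \<or> b \<notin> set r \<Longrightarrow> (a, b) \<in> F' \<longleftrightarrow> (a, b) \<in> F"
      using F0(3) by blast
    have finF': "finite F'" using F' fin finite_subset by blast
    show ?thesis
    proof (cases "(x, z) \<in> E - F")
      case True
      then have n: "(x, z) \<notin> F'" using F'3[of x z] xz by auto
      show ?thesis
      proof (intro exI[of _ "insert (x, z) F'"] conjI allI impI)
        show "insert (x, z) F' \<subseteq> E" using True F' by auto
        show "excess (insert (x, z) F') y =
            excess F y + (if y = hd (x # r) then 1 else 0) - (if y = last (x # r) then 1 else 0)" for y
          using excess_insert[OF finF' n xz(3), of y] F'2[of y] Cons by simp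
        show "(a, b) \<in> insert (x, z) F' \<longleftrightarrow> (a, b) \<in> F" if "a \<notin> set (x # r) \<or> b \<notin> set (x # r)" for a b
          using that F'3[of a b] Cons by auto
      qed
    next
      case False
      then have zx: "(z, x) \<in> F" using xz by auto
      then have n: "(z, x) \<in> F'" using F'3[of z x] xz by auto
      show ?thesis
      proof (intro exI[of _ "F' - {(z, x)}"] conjI allI impI)
        show "F' - {(z, x)} \<subseteq> E" using F' by auto
        show "excess (F' - {(z, x)}) y =
            excess F y + (if y = hd (x # r) then 1 else 0) - (if y = last (x # r) then 1 else 0)" for y
          using excess_Diff_single[OF finF' n, of y] xz(3) F'2[of y] Cons by simp
        show "(a, b) \<in> F' - {(z, x)} \<longleftrightarrow> (a, b) \<in> F" if "a \<notin> set (x # r) \<or> b \<notin> set (x # r)" for a b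
          using that F'3[of a b] Cons by auto
      qed
    qed
  qed
qed simp

lemma rtrancl_distinct_path:
  assumes "(x, y) \<in> R\<^sup>*"
  shows "\<exists>p. p \<noteq> [] \<and> hd p = x \<and> last p = y \<and> distinct p \<and> successively (\<lambda>a b. (a, b) \<in> R) p"
  using assms
proof (induction rule: converse_rtrancl_induct)
  case base
  then show ?case by (intro exI[of _ "[y]"]) auto
next
  case (step x z)
  then obtain p where p: "p \<noteq> []" "hd p = z" "last p = y" "distinct p" "successively (\<lambda>a b. (a, b) \<in> R) p"
    by blast
  show ?case
  proof (cases "x \<in> set p")
    case True
    then obtain q r where "p = q @ x # r" by (meson split_list)
    then show ?thesis using p by (intro exI[of _ "x # r"]) (auto simp: successively_append_iff)
  next
    case False
    then show ?thesis using p step.hyps(1)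
      by (intro exI[of _ "x # p"]) (auto simp: successively_Cons)
  qed
qed

text \<open>If no augmenting path exists, every arc of \<open>E\<close> leaving the set reached in
  the residual relation carries flow and no flow enters the set, so its cut has exactly
  \<open>n\<close> arcs, one too few.\<close>

lemma exists_flow:
  fixes n :: nat
  assumes fin: "finite E" and uv: "u \<noteq> v"
    and cuts: "\<And>X. u \<in> X \<Longrightarrow> v \<notin> X \<Longrightarrow> n \<le> card (out_cut E X)"
  shows "\<exists>F\<subseteq>E. \<forall>z. excess F z = (if z = u then int n else if z = v then - int n else 0)"
  using cuts
proof (induction n)
  case 0
  then show ?case by (intro exI[of _ "{}"]) (simp add: excess_def)
next
  case (Suc n)
  then obtain F where F: "F \<subseteq> E" "\<And>z. excess F z = (if z = u then int n else if z = v then - int n else 0)"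
    by (metis Suc_leD)
  let ?R = "(E - F) \<union> F\<inverse>"
  have "(u, v) \<in> ?R\<^sup>*"
  proof (rule ccontr)
    assume n: "(u, v) \<notin> ?R\<^sup>*"
    let ?S = "{z. (u, z) \<in> ?R\<^sup>*}"
    have finF: "finite F" using F fin finite_subset by blast
    have "?S \<subseteq> insert u (Field E)"
    proof
      fix z assume "z \<in> ?S"
      then have "u = z \<or> z \<in> Field ?R" by (auto dest: rtrancl_in_Field)
      then show "z \<in> insert u (Field E)" using F(1) by (auto simp: Field_def)
    qed
    then have finS: "finite ?S" using fin by (auto intro: finite_subset simp: finite_Field)
    have "out_cut E ?S = out_cut F ?S"
    proof
      show "out_cut E ?S \<subseteq> out_cut F ?S"
      proof
        fix e assume "e \<in> out_cut E ?S"
        then obtain a b where ab: "e = (a, b)" "(a, b) \<in> E" "(u, a) \<in> ?R\<^sup>*" "(u, b) \<notin> ?R\<^sup>*"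
          by (auto simp: out_cut_def)
        then have "(a, b) \<notin> ?R" by (meson rtrancl.rtrancl_into_rtrancl)
        then show "e \<in> out_cut F ?S" using ab by (auto simp: out_cut_def)
      qed
    qed (use F in \<open>auto simp: out_cut_def\<close>)
    moreover have "out_cut F (- ?S) = {}"
    proof -
      have "(u, a) \<in> ?R\<^sup>*" if "(a, b) \<in> F" "(u, b) \<in> ?R\<^sup>*" for a b
      proof -
        have "(b, a) \<in> ?R" using that by auto
        then show ?thesis using that(2) by (meson rtrancl.rtrancl_into_rtrancl)
      qed
      then show ?thesis by (auto simp: out_cut_def)
    qed
    moreover have "(\<Sum>z\<in>?S. excess F z) = int n"
    proof -
      have "(\<Sum>z\<in>?S. excess F z) = (\<Sum>z\<in>?S. if z = u then int n else 0)"
        using n F(2) by (intro sum.cong) auto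
      then show ?thesis using finS by simp
    qed
    ultimately have "card (out_cut E ?S) = n" using cut_excess[OF finF finS] by simp
    then show False using Suc.prems[of ?S] n by simp
  qed
  from rtrancl_distinct_path[OF this]
  obtain p where p: "p \<noteq> []" "hd p = u" "last p = v" "distinct p" "successively (\<lambda>a b. (a, b) \<in> ?R) p"
    by (elim exE conjE)
  obtain F' where "F' \<subseteq> E" "\<And>z. excess F' z = excess F z + (if z = u then 1 else 0) - (if z = v then 1 else 0)"
    using augment_flow[OF p(5,4,1) F(1) fin] p(2,3) by blast
  then show ?case using uv F(2) by (intro exI[of _ F']) auto
qed

lemma path_arcs:
  assumes "p \<noteq> []" "distinct p"
  shows "pcas (hd p) (zip p (tl p)) (last p)" "pawalk_verts (hd p) (zip p (tl p)) = p"
    "excess (set (zip p (tl p))) z = (if z = hd p then 1 else 0) - (if z = last p then 1 else 0)"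
    "successively (\<lambda>a b. (a, b) \<in> R) p \<Longrightarrow> set (zip p (tl p)) \<subseteq> R"
  using assms
proof (induction p)
  case (Cons x r)
  {
    case 1
    then show ?case using Cons by (cases r) auto
  next
    case 2
    then show ?case using Cons by (cases r) auto
  next
    case 3
    show ?case
    proof (cases r)
      case Nil then show ?thesis by (simp add: excess_def)
    next
      case C: (Cons y s)
      have "(x, y) \<notin> set (zip r (tl r))" "x \<noteq> y" using 3 C by (auto dest: set_zip_leftD)
      then have "excess (insert (x, y) (set (zip r (tl r)))) z =
          excess (set (zip r (tl r))) z + (if z = x then 1 else 0) - (if z = y then 1 else 0)"
        by (intro excess_insert) auto
      then show ?thesis using Cons.IH(3) 3 C by simp
    qed
  next
    case 4
    then show ?case using Cons by (cases r) auto
  }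
qed simp_all

definition arc_path :: "'a rel \<Rightarrow> 'a \<Rightarrow> ('a \<times> 'a) list \<Rightarrow> 'a \<Rightarrow> bool" where
  "arc_path F u q v \<longleftrightarrow> set q \<subseteq> F \<and> pcas u q v \<and> distinct (pawalk_verts u q)"

text \<open>Conservation keeps \<open>v\<close> reachable as long as the value is positive; removing
  the arcs of one path lowers the value by one and keeps the inner vertices balanced.\<close>

lemma flow_paths:
  fixes n :: nat
  assumes "finite F" "u \<noteq> v" "\<And>z. excess F z = (if z = u then int n else if z = v then - int n else 0)"
  shows "\<exists>P. finite P \<and> card P = n \<and> (\<forall>q\<in>P. arc_path F u q v) \<and> pairwise (\<lambda>p q. set p \<inter> set q = {}) P"
  using assms(1,3)
proof (induction n arbitrary: F)
  case 0
  then show ?case by (intro exI[of _ "{}"]) auto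
next
  case (Suc n)
  have "(u, v) \<in> F\<^sup>*"
  proof (rule ccontr)
    assume n: "(u, v) \<notin> F\<^sup>*"
    let ?S = "{z. (u, z) \<in> F\<^sup>*}"
    have "?S \<subseteq> insert u (Field F)" by (auto dest: rtrancl_in_Field)
    then have finS: "finite ?S" using Suc.prems by (auto intro: finite_subset simp: finite_Field)
    have "out_cut F ?S = {}" by (auto simp: out_cut_def intro: rtrancl_into_rtrancl)
    moreover have "(\<Sum>z\<in>?S. excess F z) = (\<Sum>z\<in>?S. if z = u then int (Suc n) else 0)"
      using n Suc.prems(2) by (intro sum.cong) auto
    then have "(\<Sum>z\<in>?S. excess F z) = int (Suc n)" using finS by simp
    ultimately show False using cut_excess[OF Suc.prems(1) finS] by simp
  qed
  from rtrancl_distinct_path[OF this]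
  obtain p where p: "p \<noteq> []" "hd p = u" "last p = v" "distinct p" "successively (\<lambda>a b. (a, b) \<in> F) p"
    by (elim exE conjE)
  let ?q = "zip p (tl p)"
  note pa = path_arcs[OF p(1,4)]
  have qF: "set ?q \<subseteq> F" using pa(4) p(5) by blast
  have q: "arc_path F u ?q v" using pa(1,2) p qF by (simp add: arc_path_def)
  have "excess (F - set ?q) z = (if z = u then int n else if z = v then - int n else 0)" for z
    using excess_Diff[OF Suc.prems(1) qF, of z] Suc.prems(2)[of z] pa(3)[of z] p(2,3) assms(2) by auto
  then obtain P where P: "finite P" "card P = n" "\<forall>q\<in>P. arc_path (F - set ?q) u q v"
    "pairwise (\<lambda>p q. set p \<inter> set q = {}) P"
    using Suc.IH[of "F - set ?q"] Suc.prems(1) by blast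
  have disj: "set q' \<inter> set ?q = {}" if "q' \<in> P" for q' using P(3) that by (auto simp: arc_path_def)
  \<comment> \<open>Two equal paths count as arc-disjoint only if they are empty, so nonemptiness
    makes the new path different from the old ones.\<close>
  have "set ?q \<noteq> {}" using q assms(2) by (auto simp: arc_path_def)
  then have "?q \<notin> P" using disj[of ?q] by auto
  then show ?case
    using P q disj Suc.prems(1)
    by (intro exI[of _ "insert ?q P"]) (auto simp: arc_path_def pairwise_insert)
qed

lemma menger_arcs:
  assumes "finite E" "u \<noteq> v" "\<And>X. u \<in> X \<Longrightarrow> v \<notin> X \<Longrightarrow> n \<le> card (out_cut E X)"
  shows "\<exists>P. finite P \<and> card P = n \<and> (\<forall>q\<in>P. arc_path E u q v) \<and> pairwise (\<lambda>p q. set p \<inter> set q = {}) P"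
proof -
  obtain F where F: "F \<subseteq> E" "\<And>z. excess F z = (if z = u then int n else if z = v then - int n else 0)"
    using exists_flow[OF assms] by blast
  then obtain P where P: "finite P" "card P = n" "\<forall>q\<in>P. arc_path F u q v" "pairwise (\<lambda>p q. set p \<inter> set q = {}) P"
    using flow_paths[OF finite_subset[OF F(1) assms(1)] assms(2)] by blast
  then show ?thesis using F(1) by (intro exI[of _ P]) (auto simp: arc_path_def)
qed

lemma pcas_crosses: "pcas u q v \<Longrightarrow> u \<in> X \<Longrightarrow> v \<notin> X \<Longrightarrow> \<exists>e\<in>set q. e \<in> X \<times> (- X)"
proof (induction q arbitrary: u)
  case (Cons e q)
  then show ?case by (cases "snd e \<in> X") (auto simp: mem_Times_iff)
qed simp

lemma disjoint_paths_le_cut: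
  assumes fin: "finite E" and P: "\<forall>q\<in>P. arc_path E u q v" "pairwise (\<lambda>p q. set p \<inter> set q = {}) P"
    and X: "u \<in> X" "v \<notin> X"
  shows "card P \<le> card (out_cut E X)"
proof -
  have "\<forall>q\<in>P. \<exists>e. e \<in> set q \<and> e \<in> out_cut E X"
    using P(1) pcas_crosses[OF _ X] unfolding arc_path_def out_cut_def by blast
  then obtain g where g: "\<And>q. q \<in> P \<Longrightarrow> g q \<in> set q \<and> g q \<in> out_cut E X" by metis
  have "inj_on g P"
    using g P(2) unfolding inj_on_def pairwise_def by (metis disjoint_iff)
  then show ?thesis using card_inj_on_le[of g P "out_cut E X"] g fin by (auto simp: finite_cut)
qed

section \<open>Translation between digraphs and relations\<close>

abbreviation pgraph :: "'a set \<Rightarrow> 'a rel \<Rightarrow> 'a pair_pre_digraph" where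
  "pgraph V E \<equiv> \<lparr>pverts = V, parcs = E\<rparr>"

lemma induce_with_proj: "with_proj D \<restriction> S = with_proj (pgraph S (induced (parcs D) S))"
  by (auto simp: induce_subgraph_def with_proj_def induced_def)

lemma apath_with_proj:
  "pre_digraph.apath (with_proj D) u q v \<longleftrightarrow> u \<in> pverts D \<and> arc_path (parcs D) u q v"
  by (auto simp: pre_digraph.apath_def pre_digraph.awalk_def arc_path_def cas_with_proj_eq awalk_verts_with_proj_eq)

lemma cycle_with_proj:
  "pre_digraph.cycle (with_proj D) p \<longleftrightarrow> (\<exists>u\<in>pverts D. set p \<subseteq> parcs D \<and> pcas u p u
     \<and> distinct (tl (pawalk_verts u p)) \<and> p \<noteq> [])"
  by (auto simp: pre_digraph.cycle_def pre_digraph.awalk_def cas_with_proj_eq awalk_verts_with_proj_eq)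

lemma pcas_rtrancl: "pcas u p v \<Longrightarrow> set p \<subseteq> R \<Longrightarrow> (u, v) \<in> R\<^sup>*"
  by (induction p arbitrary: u) (auto intro: converse_rtrancl_into_rtrancl)

text \<open>A closed walk need not be a library cycle, which has distinct vertices; one arc of it
  together with a distinct path back is.\<close>

lemma acyclic_set_iff: "acyclic_set D S \<longleftrightarrow> acyclic (induced (parcs D) S)"
proof -
  let ?R = "induced (parcs D) S"
  have "(\<exists>p. pre_digraph.cycle (with_proj D \<restriction> S) p) \<longleftrightarrow> (\<exists>x. (x, x) \<in> ?R\<^sup>+)"
  proof
    assume "\<exists>p. pre_digraph.cycle (with_proj D \<restriction> S) p"
    then obtain p u where p: "set p \<subseteq> ?R" "pcas u p u" "p \<noteq> []"
      unfolding induce_with_proj cycle_with_proj by auto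
    then obtain e q where "p = e # q" by (cases p) auto
    then have "(u, snd e) \<in> ?R" "(snd e, u) \<in> ?R\<^sup>*" using p pcas_rtrancl[of "snd e" q u ?R] by auto
    then show "\<exists>x. (x, x) \<in> ?R\<^sup>+" by (meson rtrancl_into_trancl2)
  next
    assume "\<exists>x. (x, x) \<in> ?R\<^sup>+"
    then obtain x y where xy: "(x, y) \<in> ?R" "(y, x) \<in> ?R\<^sup>*" by (meson tranclD)
    from rtrancl_distinct_path[OF xy(2)]
    obtain p where p: "p \<noteq> []" "hd p = y" "last p = x" "distinct p" "successively (\<lambda>a b. (a, b) \<in> ?R) p"
      by (elim exE conjE)
    let ?c = "(x, y) # zip p (tl p)"
    have "set ?c \<subseteq> ?R" using path_arcs(4)[OF p(1,4,5)] xy by auto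
    moreover have "pcas x ?c x" using path_arcs(1)[OF p(1,4)] p by simp
    moreover have "distinct (tl (pawalk_verts x ?c))" using path_arcs(2)[OF p(1,4)] p by simp
    moreover have "x \<in> S" using xy by (auto simp: induced_def)
    ultimately have "pre_digraph.cycle (with_proj D \<restriction> S) ?c"
      unfolding induce_with_proj cycle_with_proj by auto
    then show "\<exists>p. pre_digraph.cycle (with_proj D \<restriction> S) p" ..
  qed
  then show ?thesis by (simp add: acyclic_set_def acyclic_def)
qed

text \<open>Reachability in the library is reflexive only on the vertex set, whereas reflexive
  transitive closure is reflexive everywhere; hence the condition on \<open>u\<close>.\<close>

lemma reachable_pgraph:
  assumes "R \<subseteq> W \<times> W" "u \<in> W"
  shows "u \<rightarrow>\<^sup>*\<^bsub>with_proj (pgraph W R)\<^esub> v \<longleftrightarrow> (u, v) \<in> R\<^sup>*"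
proof -
  have "(u, v) \<in> rtrancl_on W R \<longleftrightarrow> (u, v) \<in> R\<^sup>*"
  proof
    assume "(u, v) \<in> rtrancl_on W R"
    then show "(u, v) \<in> R\<^sup>*" by (induction rule: rtrancl_on_induct) (auto intro: rtrancl_into_rtrancl)
  next
    assume "(u, v) \<in> R\<^sup>*"
    then show "(u, v) \<in> rtrancl_on W R"
      by (induction rule: rtrancl_induct) (use assms in \<open>auto intro: rtrancl_on_into_rtrancl_on\<close>)
  qed
  then show ?thesis by (simp add: reachable_def)
qed

lemma mk_symmetric_pgraph: "mk_symmetric (with_proj (pgraph W R)) = pgraph W (R \<union> R\<inverse>)"
  by (auto simp: mk_symmetric_def)

lemma strongly_connected_pgraph:
  assumes "R \<subseteq> W \<times> W"
  shows "strongly_connected (with_proj (pgraph W R)) \<longleftrightarrow> W \<noteq> {} \<and> (\<forall>u\<in>W. \<forall>v\<in>W. (u, v) \<in> R\<^sup>*)"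
  using reachable_pgraph[OF assms] by (auto simp: strongly_connected_def)

lemma linked_iff: "linked E W \<longleftrightarrow> (\<forall>u\<in>W. \<forall>v\<in>W. (u, v) \<in> (induced E W \<union> (induced E W)\<inverse>)\<^sup>*)"
proof
  let ?R = "induced E W \<union> (induced E W)\<inverse>"
  assume l: "linked E W"
  show "\<forall>u\<in>W. \<forall>v\<in>W. (u, v) \<in> ?R\<^sup>*"
  proof (intro ballI, rule ccontr)
    fix u v assume uv: "u \<in> W" "v \<in> W" "(u, v) \<notin> ?R\<^sup>*"
    let ?P = "{z \<in> W. (u, z) \<in> ?R\<^sup>*}"
    have "?P \<subseteq> W" "?P \<noteq> {}" "?P \<noteq> W" using uv by auto
    then obtain x y where xy: "x \<in> ?P" "y \<in> W - ?P" "(x, y) \<in> E \<or> (y, x) \<in> E"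
      using l unfolding linked_def by meson
    then have "(x, y) \<in> ?R" by (auto simp: induced_def)
    then have "(u, y) \<in> ?R\<^sup>*" using xy by (auto intro: rtrancl_into_rtrancl)
    then show False using xy by simp
  qed
next
  let ?R = "induced E W \<union> (induced E W)\<inverse>"
  assume c: "\<forall>u\<in>W. \<forall>v\<in>W. (u, v) \<in> ?R\<^sup>*"
  show "linked E W"
    unfolding linked_def
  proof (intro allI impI)
    fix P assume P: "P \<subseteq> W" "P \<noteq> {}" "P \<noteq> W"
    then obtain x0 y0 where "x0 \<in> P" "y0 \<in> W" "y0 \<notin> P" by blast
    then have "out_cut ?R P \<noteq> {}" using rtrancl_crosses[of x0 y0 ?R P] c P by blast
    then obtain x y where "(x, y) \<in> ?R" "x \<in> P" "y \<notin> P" by (auto simp: out_cut_def)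
    then show "\<exists>x\<in>P. \<exists>y\<in>W - P. (x, y) \<in> E \<or> (y, x) \<in> E" by (auto simp: induced_def)
  qed
qed

lemma connected_pgraph: "connected (with_proj (pgraph W (induced E W))) \<longleftrightarrow> W \<noteq> {} \<and> linked E W"
proof -
  have "induced E W \<union> (induced E W)\<inverse> \<subseteq> W \<times> W" by (auto simp: induced_def)
  then show ?thesis
    unfolding connected_def mk_symmetric_pgraph linked_iff by (rule strongly_connected_pgraph)
qed

lemma two_conn_linked: "two_conn V E \<longleftrightarrow> (\<forall>a\<in>V. linked E (V - {a}))"
  unfolding two_conn_def linked_def by simp

lemma partition_colourable:
  assumes P: "partition_on V P" "\<forall>S\<in>P. acyclic (induced E S)" "card P = n"
    and V: "finite V" "V \<noteq> {}" "E \<subseteq> V \<times> V"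
  shows "colourable n E"
proof -
  have finP: "finite P" using finite_elements[OF V(1) P(1)] .
  obtain b where b: "bij_betw b P {0..<n}" using ex_bij_betw_finite_nat[OF finP] P(3) by blast
  have ex: "\<exists>S. S \<in> P \<and> v \<in> S" if "v \<in> V" for v using that partition_onD1[OF P(1)] by auto
  define part where "part v = (SOME S. S \<in> P \<and> v \<in> S)" for v
  have part: "part v \<in> P" "v \<in> part v" if "v \<in> V" for v
    using someI_ex[OF ex[OF that]] by (auto simp: part_def)
  \<comment> \<open>Colourings are total, so vertices outside \<open>V\<close> get colour 0; it is
    below \<open>n\<close> because \<open>V\<close> is nonempty.\<close>
  define f where "f v = (if v \<in> V then b (part v) else 0)" for v
  obtain v0 where v0: "v0 \<in> V" using V by blast
  have lt: "b (part v) < n" if "v \<in> V" for v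
    using bij_betw_apply[OF b part(1)[OF that]] by simp
  have "f v < n" for v using lt[of v] lt[OF v0] by (auto simp: f_def)
  moreover have "acyclic (mono_arcs E f)"
  proof (unfold acyclic_def, intro allI notI)
    fix z assume z: "(z, z) \<in> (mono_arcs E f)\<^sup>+"
    have zV: "z \<in> V" using trancl_Field[OF z] V(3) by (auto simp: mono_arcs_def Field_def)
    have step: "y \<in> part z" if xy: "(x, y) \<in> mono_arcs E f" "x \<in> part z" for x y
    proof -
      have xyV: "x \<in> V" "y \<in> V" "f x = f y" using xy V(3) by (auto simp: mono_arcs_def)
      then have "b (part x) = b (part y)" by (simp add: f_def)
      then have "part x = part y" using part xyV bij_betw_imp_inj_on[OF b] by (auto dest: inj_onD)
      moreover have "part x = part z"
      proof (rule ccontr)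
        assume "part x \<noteq> part z"
        then have "part x \<inter> part z = {}"
          using partition_onD2[OF P(1)] part(1) xyV zV by (auto simp: disjoint_def)
        then show False using part(2)[OF xyV(1)] xy(2) by blast
      qed
      ultimately show ?thesis using part(2)[OF xyV(2)] by simp
    qed
    have "(z, z) \<in> (mono_arcs E f \<inter> part z \<times> part z)\<^sup>+"
      using trancl_stays_in[OF z part(2)[OF zV]] step by blast
    then have "(z, z) \<in> (induced E (part z))\<^sup>+"
      by (rule trancl_mono) (auto simp: mono_arcs_def induced_def)
    then show False using P(2) part(1)[OF zV] by (auto simp: acyclic_def)
  qed
  ultimately show ?thesis using colourableI by blast
qed

lemma colourable_partition:
  assumes c: "colourable n E" and V: "finite V"
  shows "\<exists>P. partition_on V P \<and> (\<forall>S\<in>P. acyclic (induced E S)) \<and> card P \<le> n"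
proof -
  obtain f where f: "kcol n E f" using c by (auto simp: colourable_def)
  let ?P = "(\<lambda>i. {v \<in> V. f v = i}) ` (f ` V)"
  have "partition_on V ?P"
    by (rule partition_onI) (auto simp: disjnt_def)
  moreover have "acyclic (induced E S)" if "S \<in> ?P" for S
  proof -
    have "induced E S \<subseteq> mono_arcs E f" using that by (auto simp: induced_def mono_arcs_def)
    moreover have "acyclic (mono_arcs E f)" using f by (simp add: kcol_def)
    ultimately show ?thesis using acyclic_subset by blast
  qed
  moreover have "card ?P \<le> n"
  proof -
    have "card ?P \<le> card (f ` V)" using V by (intro card_image_le) auto
    also have "\<dots> \<le> card {..<n}" using f by (intro card_mono) (auto simp: kcol_def)
    finally show ?thesis by simp
  qed
  ultimately show ?thesis by blast
qed

lemma colourable_le: "colourable m E \<Longrightarrow> m \<le> n \<Longrightarrow> colourable n E"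
  unfolding colourable_def kcol_def using order_less_le_trans by blast

lemma dichromatic_number_le_iff:
  assumes V: "finite (pverts D)" "pverts D \<noteq> {}" "parcs D \<subseteq> pverts D \<times> pverts D"
    and irr: "\<And>x. (x, x) \<notin> parcs D"
  shows "dichromatic_number D \<le> n \<longleftrightarrow> colourable n (parcs D)"
proof -
  let ?Q = "\<lambda>n. \<exists>P. partition_on (pverts D) P \<and> (\<forall>S\<in>P. acyclic_set D S) \<and> card P = n"
  have d: "dichromatic_number D = (LEAST n. ?Q n)" by (simp add: dichromatic_number_def)
  have QC: "colourable m (parcs D)" if "?Q m" for m
    using that partition_colourable[OF _ _ _ V] unfolding acyclic_set_iff by blast
  have CQ: "\<exists>m\<le>n. ?Q m" if "colourable n (parcs D)" for n
    using colourable_partition[OF that V(1)] unfolding acyclic_set_iff by blast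
  \<comment> \<open>The minimum is attained only if some suitable partition exists; a separate
    colour for each vertex provides one.\<close>
  have "1 \<le> card (pverts D)" using V by (simp add: Suc_leI card_gt_0_iff)
  then have "\<exists>m. ?Q m" using CQ few_vertices_colourable[OF V(1,3) order_refl _ irr] by blast
  then have "?Q (dichromatic_number D)" unfolding d by (rule LeastI_ex)
  then have c: "colourable (dichromatic_number D) (parcs D)" by (rule QC)
  show ?thesis
  proof
    assume "dichromatic_number D \<le> n"
    then show "colourable n (parcs D)" using c colourable_le by blast
  next
    assume "colourable n (parcs D)"
    then obtain m where "m \<le> n" "?Q m" using CQ by blast
    then show "dichromatic_number D \<le> n" unfolding d using Least_le[of ?Q m] by simp
  qed
qed

text \<open>A cut bounds every family of arc-disjoint paths, which also makes the set under
  \<open>Max\<close> finite; Menger's theorem gives the converse.\<close>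

lemma local_arc_connectivity_le_iff:
  assumes E: "finite (parcs D)" and u: "u \<in> pverts D" and uv: "u \<noteq> v"
  shows "local_arc_connectivity D u v \<le> k \<longleftrightarrow> (\<exists>X. u \<in> X \<and> v \<notin> X \<and> card (out_cut (parcs D) X) \<le> k)"
proof -
  let ?S = "{card P | P. arc_disjoint_paths D u v P}"
  have adp: "arc_disjoint_paths D u v P \<longleftrightarrow>
      (\<forall>q\<in>P. arc_path (parcs D) u q v) \<and> pairwise (\<lambda>p q. set p \<inter> set q = {}) P" for P
    using u by (simp add: arc_disjoint_paths_def apath_with_proj)
  have bound: "n \<le> card (out_cut (parcs D) X)" if "n \<in> ?S" "u \<in> X" "v \<notin> X" for n X
    using that disjoint_paths_le_cut[OF E] unfolding adp by blast
  have "?S \<subseteq> {..card (out_cut (parcs D) {u})}" using bound[of _ "{u}"] uv by auto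
  then have fin: "finite ?S" using finite_subset by blast
  have "arc_disjoint_paths D u v {}" by (simp add: adp)
  then have ne: "?S \<noteq> {}" by blast
  show ?thesis
  proof
    assume le: "local_arc_connectivity D u v \<le> k"
    show "\<exists>X. u \<in> X \<and> v \<notin> X \<and> card (out_cut (parcs D) X) \<le> k"
    proof (rule ccontr)
      assume "\<not> ?thesis"
      then have cuts: "Suc k \<le> card (out_cut (parcs D) X)" if "u \<in> X" "v \<notin> X" for X
        using that by (meson not_less_eq_eq)
      have "\<exists>P. finite P \<and> card P = Suc k \<and> (\<forall>q\<in>P. arc_path (parcs D) u q v)
          \<and> pairwise (\<lambda>p q. set p \<inter> set q = {}) P"
        by (rule menger_arcs[OF E uv]) (rule cuts)
      then obtain P where "card P = Suc k" "arc_disjoint_paths D u v P"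
        unfolding adp by (elim exE conjE) simp
      then have "Suc k \<in> ?S" by force
      then have "Suc k \<le> Max ?S" using Max_ge[OF fin] by blast
      then show False using le by (simp add: local_arc_connectivity_def)
    qed
  next
    assume "\<exists>X. u \<in> X \<and> v \<notin> X \<and> card (out_cut (parcs D) X) \<le> k"
    then show "local_arc_connectivity D u v \<le> k"
      unfolding local_arc_connectivity_def using Max_le_iff[OF fin ne] bound le_trans by blast
  qed
qed

lemma max_arc_connectivity_le_iff:
  assumes V: "finite (pverts D)" "2 \<le> card (pverts D)" and E: "finite (parcs D)"
  shows "max_arc_connectivity D \<le> k \<longleftrightarrow> sep_le k (pverts D) (parcs D)"
proof -
  let ?S = "{local_arc_connectivity D u v | u v. u \<in> pverts D \<and> v \<in> pverts D \<and> u \<noteq> v}"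
  have "?S \<subseteq> (\<lambda>(u, v). local_arc_connectivity D u v) ` (pverts D \<times> pverts D)" by auto
  then have fin: "finite ?S" using V(1) finite_subset by blast
  have "\<not> card (pverts D) \<le> Suc 0" using V(2) by simp
  then have ne: "?S \<noteq> {}" using card_le_Suc0_iff_eq[OF V(1)] by blast
  have "max_arc_connectivity D \<le> k \<longleftrightarrow> (\<forall>n\<in>?S. n \<le> k)"
    unfolding max_arc_connectivity_def by (rule Max_le_iff[OF fin ne])
  also have "\<dots> \<longleftrightarrow> (\<forall>u\<in>pverts D. \<forall>v\<in>pverts D. u \<noteq> v \<longrightarrow> local_arc_connectivity D u v \<le> k)" by blast
  also have "\<dots> \<longleftrightarrow> sep_le k (pverts D) (parcs D)"
    unfolding sep_le_def using local_arc_connectivity_le_iff[OF E] by simp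
  finally show ?thesis .
qed

lemma pair_digraph_pgraph_iff:
  "pair_digraph (pgraph V E) \<longleftrightarrow> finite V \<and> E \<subseteq> V \<times> V \<and> (\<forall>x. (x, x) \<notin> E)"
proof
  assume "pair_digraph (pgraph V E)"
  then interpret pair_digraph "pgraph V E" .
  show "finite V \<and> E \<subseteq> V \<times> V \<and> (\<forall>x. (x, x) \<notin> E)"
    using pair_finite_verts in_arcsD1 in_arcsD2 pair_no_loops[of "(x, x)" for x] by auto
next
  assume "finite V \<and> E \<subseteq> V \<times> V \<and> (\<forall>x. (x, x) \<notin> E)"
  moreover from this have "finite E" by (meson finite_SigmaI finite_subset)
  ultimately show "pair_digraph (pgraph V E)" by unfold_locales auto
qed

lemma underlying_2_connected_pgraph_iff:
  assumes E: "E \<subseteq> V \<times> V"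
  shows "underlying_2_connected (pgraph V E) \<longleftrightarrow> 3 \<le> card V \<and> linked E V \<and> two_conn V E"
proof (cases "3 \<le> card V")
  case True
  have induced: "induced E V = E" using E by (auto simp: induced_def)
  have "V \<noteq> {}" using True by auto
  then have 1: "connected (with_proj (pgraph V E)) \<longleftrightarrow> linked E V" using connected_pgraph[of V E] induced by simp
  have "V - {x} \<noteq> {}" for x
  proof
    assume "V - {x} = {}"
    then have "card V \<le> card {x}" by (intro card_mono) auto
    then show False using True by simp
  qed
  then have "connected (with_proj (pgraph V E) \<restriction> (V - {x})) \<longleftrightarrow> linked E (V - {x})" for x
    using connected_pgraph[of "V - {x}" E] unfolding induce_with_proj by simp
  then show ?thesis
    unfolding underlying_2_connected_def two_conn_linked using 1 by simp
qed (simp add: underlying_2_connected_def)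

text \<open>The exact values of both invariants come from \<open>colourable_Suc\<close>: for
  \<open>k\<close> it bounds the dichromatic number from above, for \<open>k - 1\<close> it bounds
  the connectivity from below.\<close>

lemma extremal_iff_extremal_rel:
  assumes k: "1 \<le> k"
  shows "extremal k (pgraph V E) \<longleftrightarrow> extremal_rel k V E"
proof
  assume x: "extremal k (pgraph V E)"
  have V: "finite V" "E \<subseteq> V \<times> V" "(x, x) \<notin> E" for x
    using x by (auto simp: extremal_def pair_digraph_pgraph_iff)
  have U: "3 \<le> card V" "two_conn V E"
    using x by (auto simp: extremal_def underlying_2_connected_pgraph_iff[OF V(2)])
  have S: "V \<noteq> {}" "\<And>u v. u \<in> V \<Longrightarrow> v \<in> V \<Longrightarrow> (u, v) \<in> E\<^sup>*"
    using x by (auto simp: extremal_def strongly_connected_pgraph[OF V(2)])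
  have finE: "finite E" using V by (meson finite_SigmaI finite_subset)
  have "dichromatic_number (pgraph V E) = k + 1" "max_arc_connectivity (pgraph V E) = k"
    using x by (auto simp: extremal_def)
  then have "\<not> colourable k E" "sep_le k V E"
    using dichromatic_number_le_iff[of "pgraph V E" k] max_arc_connectivity_le_iff[of "pgraph V E" k]
      V S(1) U(1) finE by auto
  then show "extremal_rel k V E" unfolding extremal_rel_def using V U S by blast
next
  assume c: "extremal_rel k V E"
  note V = extremal_relD(1-3)[OF c]
  have finE: "finite E" using V by (meson finite_SigmaI finite_subset)
  have ne: "V \<noteq> {}" using extremal_relD(4)[OF c] by auto
  have FE: "Field E = V" using extremal_rel_crit_sep[OF c k] by simp
  have st: "strongly_connected (with_proj (pgraph V E))"
    using ne extremal_relD(5)[OF c] by (simp add: strongly_connected_pgraph[OF V(2)])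
  have "linked E V"
    unfolding linked_iff
  proof (intro ballI)
    fix u v assume "u \<in> V" "v \<in> V"
    then have "(u, v) \<in> E\<^sup>*" by (rule extremal_relD(5)[OF c])
    then show "(u, v) \<in> (induced E V \<union> (induced E V)\<inverse>)\<^sup>*"
      by (rule rtrancl_mono[THEN subsetD, rotated]) (use V in \<open>auto simp: induced_def\<close>)
  qed
  then have u2: "underlying_2_connected (pgraph V E)"
    using extremal_relD(4,6)[OF c] by (simp add: underlying_2_connected_pgraph_iff[OF V(2)])
  have nc: "\<not> colourable k E" and sep: "sep_le k V E" using extremal_relD(7,8)[OF c] by auto
  have "colourable (k + 1) E" using colourable_Suc[OF finE V(3)] sep FE by simp
  moreover have "dichromatic_number (pgraph V E) \<le> n \<longleftrightarrow> colourable n E" for n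
    using dichromatic_number_le_iff[of "pgraph V E" n] V ne by simp
  ultimately have dn: "dichromatic_number (pgraph V E) = k + 1"
    using nc by (metis Suc_eq_plus1 le_antisym not_less_eq_eq)
  have "\<not> sep_le (k - 1) V E"
    using colourable_Suc[OF finE V(3), of "k - 1"] nc FE k by auto
  moreover have "2 \<le> card V" using extremal_relD(4)[OF c] by simp
  ultimately have "max_arc_connectivity (pgraph V E) = k"
    using max_arc_connectivity_le_iff[of "pgraph V E" k] max_arc_connectivity_le_iff[of "pgraph V E" "k - 1"]
      V(1) finE sep by simp
  then show "extremal k (pgraph V E)"
    unfolding extremal_def using st u2 dn V by (simp add: pair_digraph_pgraph_iff)
qed

section \<open>Realising the four outcomes up to isomorphism\<close>

lemma digraph_iso_pgraph:
  assumes E: "E \<subseteq> V \<times> V" and inj: "inj_on \<phi> V"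
  shows "digraph_iso (with_proj (pgraph V E)) (with_proj (pgraph (\<phi> ` V) (map_prod \<phi> \<phi> ` E)))"
proof -
  let ?h = "\<lparr>iso_verts = \<phi>, iso_arcs = map_prod \<phi> \<phi>, iso_head = snd, iso_tail = fst\<rparr>"
  have "inj_on (map_prod \<phi> \<phi>) E"
    using map_prod_inj_on[OF inj inj] E inj_on_subset by blast
  then have "pre_digraph.digraph_isomorphism (with_proj (pgraph V E)) ?h"
    unfolding pre_digraph.digraph_isomorphism_def
    using E inj by (auto simp: wf_digraph_def)
  moreover have "with_proj (pgraph (\<phi> ` V) (map_prod \<phi> \<phi> ` E)) = app_iso ?h (with_proj (pgraph V E))"
    by (simp add: app_iso_def with_proj_def)
  ultimately show ?thesis unfolding digraph_iso_def by blast
qed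

lemma complete_digraph_pgraph:
  assumes V: "finite V" "card V = n" and E: "E = {(u, v). u \<in> V \<and> v \<in> V \<and> u \<noteq> v}"
  shows "complete_digraph n (with_proj (pgraph V E))"
proof -
  have "E \<subseteq> V \<times> V" by (auto simp: E)
  then have "finite E" using V(1) by (meson finite_SigmaI finite_subset)
  then interpret pair_graph "pgraph V E"
    using V by unfold_locales (auto simp: E symmetric_def sym_def)
  have "graph (with_proj (pgraph V E))" by unfold_locales
  then show ?thesis using V by (simp add: complete_digraph_def E)
qed

lemma wheel_edges_subset: "wheel_edges n \<subseteq> {..n} \<times> {..n}"
proof -
  have "Suc i mod n \<le> n" if "i < n" for i using that by (simp add: less_imp_le)
  then show ?thesis by (auto simp: wheel_edges_def)
qed

lemma symmetric_odd_wheel_pgraph: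
  assumes n: "3 \<le> n" "odd n" and s: "inj_on s {..n}" "s ` {..n} = V"
    and E: "E = map_prod s s ` (wheel_edges n \<union> (wheel_edges n)\<inverse>)"
  shows "symmetric_odd_wheel (pgraph V E)"
proof -
  let ?W = "wheel_edges n \<union> (wheel_edges n)\<inverse>"
  have W: "?W \<subseteq> {..n} \<times> {..n}" using wheel_edges_subset[of n] by auto
  then have "wf_digraph (with_proj (symmetric_wheel n))"
    by (auto simp: wf_digraph_def symmetric_wheel_def)
  moreover have "digraph_iso (with_proj (symmetric_wheel n)) (with_proj (pgraph V E))"
    using digraph_iso_pgraph[OF W s(1)] s(2) E by (simp add: symmetric_wheel_def)
  ultimately show ?thesis unfolding symmetric_odd_wheel_def using n digraph_iso_swap by blast
qed

text \<open>\<open>\<phi>\<close> embeds the vertices of \<open>E\<close> into the sum type, with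
  \<open>a\<close> on the left. The two embeddings used by the joins are its restrictions to
  \<open>A \<union> {a}\<close> and \<open>B \<union> {a}\<close>, so both parts can be mapped by
  one injection.\<close>

lemma glue_image:
  assumes "a \<notin> A" "a \<notin> B" "A \<inter> B = {}" and \<phi>_def: "\<phi> = (\<lambda>x. if x \<in> A \<union> {a} then Inl x else Inr x)"
  shows "inj_on \<phi> V" "x \<in> B \<union> {a} \<Longrightarrow> glue a a x = \<phi> x" "x \<in> A \<union> {a} \<Longrightarrow> Inl x = \<phi> x"
    "map_prod Inl Inl ` induced E (A \<union> {a}) = map_prod \<phi> \<phi> ` induced E (A \<union> {a})"
    "map_prod (glue a a) (glue a a) ` induced E (B \<union> {a}) = map_prod \<phi> \<phi> ` induced E (B \<union> {a})"
    "Inl ` (A \<union> {a}) \<union> glue a a ` (B \<union> {a}) = \<phi> ` (A \<union> B \<union> {a})"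
proof -
  show "inj_on \<phi> V" by (auto simp: \<phi>_def inj_on_def)
  show g: "glue a a x = \<phi> x" if "x \<in> B \<union> {a}" for x using that assms by (auto simp: glue_def)
  show l: "Inl x = \<phi> x" if "x \<in> A \<union> {a}" for x using that by (simp add: \<phi>_def)
  show "map_prod Inl Inl ` induced E (A \<union> {a}) = map_prod \<phi> \<phi> ` induced E (A \<union> {a})"
    by (rule image_cong) (use l in \<open>auto simp: induced_def\<close>)
  show "map_prod (glue a a) (glue a a) ` induced E (B \<union> {a}) = map_prod \<phi> \<phi> ` induced E (B \<union> {a})"
    by (rule image_cong) (use g in \<open>auto simp: induced_def\<close>)
  have "Inl ` (A \<union> {a}) = \<phi> ` (A \<union> {a})" "glue a a ` (B \<union> {a}) = \<phi> ` (B \<union> {a})"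
    by (rule image_cong[OF refl], use l g in blast)+
  then show "Inl ` (A \<union> {a}) \<union> glue a a ` (B \<union> {a}) = \<phi> ` (A \<union> B \<union> {a})" by auto
qed

lemma hajos_split_join:
  fixes E :: "'a rel"
  assumes k: "1 \<le> k" and EV: "Field E = V" and s: "hajos_split k E a A B t u"
  shows "\<exists>(D1 :: 'a pair_pre_digraph) (D2 :: 'a pair_pre_digraph).
    extremal k D1 \<and> extremal k D2 \<and> is_directed_hajos_join (pgraph V E) D1 D2"
proof -
  note sp = s[unfolded hajos_split_def]
  let ?FA = "induced E (A \<union> {a})"
  let ?FB = "induced E (B \<union> {a})"
  let ?D1 = "pgraph (A \<union> {a}) (?FA \<union> {(t, a)})"
  let ?D2 = "pgraph (B \<union> {a}) (?FB \<union> {(a, u)})"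
  have ext: "extremal k ?D1" "extremal k ?D2"
    unfolding extremal_iff_extremal_rel[OF k] using sp by simp_all
  define \<phi> where "\<phi> = (\<lambda>x. if x \<in> A \<union> {a} then Inl x else Inr x)"
  have ABa: "a \<notin> A" "a \<notin> B" "A \<inter> B = {}" using sp by auto
  note gi = glue_image[OF ABa \<phi>_def]
  have U: "A \<union> B \<union> {a} = V" using sp EV by auto
  have verts: "Inl ` (A \<union> {a}) \<union> glue a a ` (B \<union> {a}) = \<phi> ` V" using gi(6) unfolding U .
  have "?FA \<union> {(t, a)} - {(t, a)} = ?FA" "?FB \<union> {(a, u)} - {(a, u)} = ?FB"
    using sp by (auto simp: induced_def)
  moreover have "glue a a u = \<phi> u" "Inl t = \<phi> t" using gi(2)[of u] gi(3)[of t] sp by simp_all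
  ultimately have "directed_hajos_join ?D1 t a ?D2 a u =
      pgraph (\<phi> ` V) (map_prod \<phi> \<phi> ` ?FA \<union> map_prod \<phi> \<phi> ` ?FB \<union> {(\<phi> t, \<phi> u)})"
    using verts gi(4,5)[of E] by (simp only: directed_hajos_join_def pair_pre_digraph.select_convs)
  also have "map_prod \<phi> \<phi> ` ?FA \<union> map_prod \<phi> \<phi> ` ?FB \<union> {(\<phi> t, \<phi> u)} = map_prod \<phi> \<phi> ` (?FA \<union> ?FB \<union> {(t, u)})"
    by (simp add: image_Un)
  also have "?FA \<union> ?FB \<union> {(t, u)} = E" using sp by simp
  finally have j: "directed_hajos_join ?D1 t a ?D2 a u = pgraph (\<phi> ` V) (map_prod \<phi> \<phi> ` E)" .
  have "E \<subseteq> V \<times> V" using EV by (auto simp: Field_def)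
  then have "digraph_iso (with_proj (pgraph V E)) (with_proj (directed_hajos_join ?D1 t a ?D2 a u))"
    unfolding j by (rule digraph_iso_pgraph[OF _ gi(1)])
  then have "is_directed_hajos_join (pgraph V E) ?D1 ?D2"
    unfolding is_directed_hajos_join_def
    by (intro exI[of _ t] exI[of _ a] exI[of _ u] conjI) simp_all
  then show ?thesis using ext by blast
qed

lemma same_component_pgraph:
  assumes l: "linked E A" and a: "a \<notin> A" and xy: "x \<in> A" "y \<in> A" and F: "induced F A = induced E A"
  shows "same_component_without (pgraph (A \<union> {a}) F) a x y"
proof -
  have A: "A \<union> {a} - {a} = A" using a by auto
  have sub: "induced F A \<union> (induced F A)\<inverse> \<subseteq> A \<times> A" by (auto simp: induced_def)
  have "(x, y) \<in> (induced F A \<union> (induced F A)\<inverse>)\<^sup>*" using l xy unfolding linked_iff F by blast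
  then show ?thesis
    unfolding same_component_without_def induce_with_proj mk_symmetric_pgraph
    using reachable_pgraph[OF sub xy(1), of y] A by simp
qed

lemma bijoin_split_bijoin:
  fixes E :: "'a rel"
  assumes k: "1 \<le> k" and EV: "Field E = V" and s: "bijoin_split k E a A B t u v w"
  shows "\<exists>(D1 :: 'a pair_pre_digraph) (D2 :: 'a pair_pre_digraph).
    extremal k D1 \<and> extremal k D2 \<and> is_hajos_bijoin (pgraph V E) D1 D2"
proof -
  note sp = s[unfolded bijoin_split_def]
  let ?FA = "induced E (A \<union> {a})"
  let ?FB = "induced E (B \<union> {a})"
  let ?D1 = "pgraph (A \<union> {a}) (?FA \<union> {(t, a), (a, w)})"
  let ?D2 = "pgraph (B \<union> {a}) (?FB \<union> {(v, a), (a, u)})"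
  have ext: "extremal k ?D1" "extremal k ?D2"
    unfolding extremal_iff_extremal_rel[OF k] using sp by simp_all
  define \<phi> where "\<phi> = (\<lambda>x. if x \<in> A \<union> {a} then Inl x else Inr x)"
  have ABa: "a \<notin> A" "a \<notin> B" "A \<inter> B = {}" using sp by auto
  note gi = glue_image[OF ABa \<phi>_def]
  have U: "A \<union> B \<union> {a} = V" using sp EV by auto
  have verts: "Inl ` (A \<union> {a}) \<union> glue a a ` (B \<union> {a}) = \<phi> ` V" using gi(6) unfolding U .
  have "?FA \<union> {(t, a), (a, w)} - {(t, a), (a, w)} = ?FA" "?FB \<union> {(v, a), (a, u)} - {(v, a), (a, u)} = ?FB"
    using sp by (auto simp: induced_def)
  moreover have "glue a a u = \<phi> u" "glue a a v = \<phi> v" "Inl t = \<phi> t" "Inl w = \<phi> w"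
    using gi(2)[of u] gi(2)[of v] gi(3)[of t] gi(3)[of w] sp by simp_all
  ultimately have "hajos_bijoin ?D1 t a w ?D2 v a u =
      pgraph (\<phi> ` V) (map_prod \<phi> \<phi> ` ?FA \<union> map_prod \<phi> \<phi> ` ?FB \<union> {(\<phi> t, \<phi> u), (\<phi> v, \<phi> w)})"
    using verts gi(4,5)[of E] by (simp only: hajos_bijoin_def pair_pre_digraph.select_convs)
  also have "map_prod \<phi> \<phi> ` ?FA \<union> map_prod \<phi> \<phi> ` ?FB \<union> {(\<phi> t, \<phi> u), (\<phi> v, \<phi> w)} =
      map_prod \<phi> \<phi> ` (?FA \<union> ?FB \<union> {(t, u), (v, w)})"
    by (simp add: image_Un)
  also have "?FA \<union> ?FB \<union> {(t, u), (v, w)} = E" using sp by simp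
  finally have j: "hajos_bijoin ?D1 t a w ?D2 v a u = pgraph (\<phi> ` V) (map_prod \<phi> \<phi> ` E)" .
  have "E \<subseteq> V \<times> V" using EV by (auto simp: Field_def)
  then have iso: "digraph_iso (with_proj (pgraph V E)) (with_proj (hajos_bijoin ?D1 t a w ?D2 v a u))"
    unfolding j by (rule digraph_iso_pgraph[OF _ gi(1)])
  have "induced (?FA \<union> {(t, a), (a, w)}) A = induced E A" "induced (?FB \<union> {(v, a), (a, u)}) B = induced E B"
    using ABa by (auto simp: induced_def)
  then have "same_component_without ?D1 a t w" "same_component_without ?D2 a u v"
    using same_component_pgraph[of E A a t w] same_component_pgraph[of E B a u v] sp by blast+
  then have "is_hajos_bijoin (pgraph V E) ?D1 ?D2"
    unfolding is_hajos_bijoin_def using iso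
    by (intro exI[of _ t] exI[of _ a] exI[of _ w] exI[of _ v] exI[of _ u] conjI) simp_all
  then show ?thesis using ext by blast
qed

theorem theorem4p4p1:
  fixes k :: nat and D :: "'a pair_pre_digraph"
  assumes "3 \<le> k"
    and "extremal k D"
  shows "complete_digraph (k + 1) (with_proj D)
    \<or> (k = 3 \<and> symmetric_odd_wheel D)
    \<or> (\<exists>(D1 :: 'a pair_pre_digraph) (D2 :: 'a pair_pre_digraph).
         extremal k D1 \<and> extremal k D2 \<and> is_directed_hajos_join D D1 D2)
    \<or> (\<exists>(D1 :: 'a pair_pre_digraph) (D2 :: 'a pair_pre_digraph).
         extremal k D1 \<and> extremal k D2 \<and> is_hajos_bijoin D D1 D2)"
proof -
  define V where "V = pverts D"
  define E where "E = parcs D"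
  have D: "D = pgraph V E" by (simp add: V_def E_def)
  have k1: "1 \<le> k" using assms(1) by simp
  have c: "extremal_rel k V E" using assms(2) extremal_iff_extremal_rel[OF k1, of V E] unfolding D by blast
  have E: "crit_sep k E" and FE: "Field E = V" using extremal_rel_crit_sep[OF c k1] by auto
  show ?thesis
  proof (cases "decomposable E")
    case True
    then show ?thesis
      using decomposable_cases[OF E assms(1)] hajos_split_join[OF k1 FE] bijoin_split_bijoin[OF k1 FE]
      unfolding D by blast
  next
    case nd: False
    obtain x where x: "x \<in> Field E" "\<And>v. v \<in> Field E \<Longrightarrow> v \<noteq> x \<Longrightarrow> card (E `` {v}) = k"
      using at_most_one_high[OF E assms(1) nd] by blast
    show ?thesis
    \<comment> \<open>For \<open>k = 3\<close> the complete digraph on four vertices needs no case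
      of its own: it is the symmetric wheel with a rim of length 3.\<close>
    proof (cases "k = 3")
      case True
      obtain n s where "3 \<le> n" "odd n" "inj_on s {..n}" "s ` {..n} = Field E"
        "E = map_prod s s ` (wheel_edges n \<union> (wheel_edges n)\<inverse>)"
        using hub_wheel[of E x] E nd x True by metis
      then have "symmetric_odd_wheel (pgraph V E)" using symmetric_odd_wheel_pgraph FE by metis
      then show ?thesis using True D by simp
    next
      case False
      then have k4: "4 \<le> k" using assms(1) by simp
      note hc = hub_complete[OF E k4 nd x]
      have "E = {(u, v). u \<in> V \<and> v \<in> V \<and> u \<noteq> v}"
        using hc(2) extremal_relD(2,3)[OF c] FE by auto
      moreover have "card V = k + 1" using hc(1) FE by simp
      ultimately have "complete_digraph (k + 1) (with_proj (pgraph V E))"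
        using complete_digraph_pgraph extremal_relD(1)[OF c] by blast
      then show ?thesis unfolding D by blast
    qed
  qed
qed

end
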